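(* Let $D$ be a bounded open subset of $\mathbb R^d$ whose closure $\overline D$ is contained in some domain (connected open subset) of $\mathbb R^d\setminus\bigcup_{\alpha\in R_+}H_\alpha$. If $D$ is $\Delta$-regular, then $D$ is $\Delta_k$-regular. Moreover, for every continuous function $f:\mathbb R^d\setminus D\to\mathbb R$ and every $x\in D$, $$ H_D^{\Delta_k}f(x)=\frac{1}{\sqrt{w_k(x)}}\left(H_D^{\Delta-q}(f\sqrt{w_k})(x)+G_D^{\Delta-q}\left(\sqrt{w_k}\,Nf\right)(x)\right), $$ where $q$ and $Nf$ are the functions defined for $x\in D$ by $$ q(x)=\sum_{\alpha\in R_+}\left(\frac{|\alpha|k(\alpha)}{\langle x,\alpha\rangle}\right)^2,\qquad Nf(x)=\sum_{\alpha\in R_+}\frac{|\alpha|^2k(\alpha)}{\langle x,\alpha\rangle^2}f(\sigma_\alpha x). $$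
   Context: Let $d\ge1$, $\langle\cdot,\cdot\rangle$ the Euclidean inner product on $\mathbb R^d$ and $|\cdot|$ its norm. For $\alpha\in\mathbb R^d\setminus\{0\}$, $H_\alpha$ is the hyperplane orthogonal to $\alpha$ and $\sigma_\alpha x=x-2\frac{\langle x,\alpha\rangle}{|\alpha|^2}\alpha$ is the reflection with respect to $H_\alpha$. $R\subset\mathbb R^d\setminus\{0\}$ is a root system (a finite set with $R\cap\mathbb R\alpha=\{\alpha,-\alpha\}$ and $\sigma_\alpha R=R$ for all $\alpha\in R$), $R_+$ is a fixed positive subsystem, and $k:R\to[0,\infty)$ is a multiplicity function (invariant under the group generated by the reflections $\sigma_\alpha$, $\alpha\in R$). The Dunkl Laplacian is $$\Delta_kf(x)=\Delta f(x)+2\sum_{\alpha\in R_+}k(\alpha)\left(\frac{\langle\nabla f(x),\alpha\rangle}{\langle\alpha,x\rangle}-\frac{|\alpha|^2}{2}\frac{f(x)-f(\sigma_\alpha x)}{\langle\alpha,x\rangle^2}\right),\quad f\in C^2(\mathbb R^d),$$ and the invariant weight is $w_k(x)=\prod_{\alpha\in R_+}|\langle x,\alpha\rangle|^{2k(\alpha)}$. $C_c^\infty(D)$ is the space of infinitely differentiable functions with compact support in $D$ (extended by $0$ to $\mathbb R^d$). $\Delta_k$-regularity: for $f$ continuous on $\mathbb R^d\setminus D$, a solution of the Dirichlet problem ($\Delta_kh=0$ on $D$, $h=f$ on $\mathbb R^d\setminus D$) is a continuous function $h:\mathbb R^d\to\mathbb R$ with $h=f$ on $\mathbb R^d\setminus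 D$ and $\int_{\mathbb R^d}h(x)\Delta_k\varphi(x)w_k(x)\,dx=0$ for every $\varphi\in C_c^\infty(D)$. The set $D$ is $\Delta_k$-regular if for every continuous $f$ on $\mathbb R^d\setminus D$ this problem has one and only one solution, which is denoted $H_D^{\Delta_k}f$. $\Delta$-regularity: $D$ is $\Delta$-regular if for every continuous function $g$ on $\partial D$ there is a unique continuous function on $\overline D$ that equals $g$ on $\partial D$ and is harmonic on $D$. Schrödinger operators: for $D$ bounded and $\Delta$-regular and $q\ge0$ bounded Borel on $D$, and $g$ continuous on $\partial D$, $H_D^{\Delta-q}g$ is the unique continuous function $h$ on $\overline D$ with $h=g$ on $\partial D$ and $\int_D h(x)(\Delta-q)\varphi(x)\,dx=0$ for every $\varphi\in C_c^\infty(D)$; for a function $f$ on $\mathbb R^d\setminus D$, $H_D^{\Delta-q}(f\sqrt{w_k})$ is formed with the restriction of $f\sqrt{w_k}$ to $\partial D$. $G_D^{\Delta-q}$ is the Green potential operator of $\Delta-q$ in $D$: for $g$ bounded Borel on $D$, $G_D^{\Delta-q}g$ is the unique continuous function on $\overline D$, vanishing on $\partial D$, with $\int_D G_D^{\Delta-q}g(x)(\Delta-q)\varphi(x)\,dx=-\int_D g(x)\varphi(x)\,dx$ for every $\varphi\in C_c^\infty(D)$. *)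

theory Defs
  imports "HOL-Analysis.Analysis"
begin

definition reflection :: "'a::euclidean_space \<Rightarrow> 'a \<Rightarrow> 'a" where
  "reflection \<alpha> x = x - (2 * (x \<bullet> \<alpha>) / (norm \<alpha>)\<^sup>2) *\<^sub>R \<alpha>"

definition orth_hyperplane :: "'a::euclidean_space \<Rightarrow> 'a set" where
  "orth_hyperplane \<alpha> = {x. x \<bullet> \<alpha> = 0}"

definition root_system :: "'a::euclidean_space set \<Rightarrow> bool" where
  "root_system R \<longleftrightarrow> finite R \<and> 0 \<notin> R \<and>
     (\<forall>\<alpha>\<in>R. R \<inter> range (\<lambda>c. c *\<^sub>R \<alpha>) = {\<alpha>, - \<alpha>} \<and> reflection \<alpha> ` R = R)"

text \<open>A positive subsystem is one half of \<open>R\<close> cut out by a hyperplane through the origin that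
  contains no root.\<close>

definition positive_subsystem :: "'a::euclidean_space set \<Rightarrow> 'a set \<Rightarrow> bool" where
  "positive_subsystem R Rp \<longleftrightarrow>
     (\<exists>\<beta>. (\<forall>\<alpha>\<in>R. \<alpha> \<bullet> \<beta> \<noteq> 0) \<and> Rp = {\<alpha>\<in>R. \<alpha> \<bullet> \<beta> > 0})"

text \<open>Reflections are involutions, so closing under composition with generators already yields
  the generated group.\<close>

inductive_set reflection_group :: "'a::euclidean_space set \<Rightarrow> ('a \<Rightarrow> 'a) set"
  for R :: "'a set" where
  id: "id \<in> reflection_group R"
| comp: "w \<in> reflection_group R \<Longrightarrow> \<alpha> \<in> R \<Longrightarrow> reflection \<alpha> \<circ> w \<in> reflection_group R"

definition multiplicity_function :: "'a::euclidean_space set \<Rightarrow> ('a \<Rightarrow> real) \<Rightarrow> bool" where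
  "multiplicity_function R k \<longleftrightarrow>
     (\<forall>\<alpha>\<in>R. k \<alpha> \<ge> 0) \<and> (\<forall>w\<in>reflection_group R. \<forall>\<alpha>\<in>R. k (w \<alpha>) = k \<alpha>)"

definition partial_deriv :: "'a::euclidean_space \<Rightarrow> ('a \<Rightarrow> real) \<Rightarrow> 'a \<Rightarrow> real" where
  "partial_deriv b f x = frechet_derivative f (at x) b"

definition gradient :: "('a::euclidean_space \<Rightarrow> real) \<Rightarrow> 'a \<Rightarrow> 'a" where
  "gradient f x = (\<Sum>b\<in>Basis. partial_deriv b f x *\<^sub>R b)"

definition laplacian :: "('a::euclidean_space \<Rightarrow> real) \<Rightarrow> 'a \<Rightarrow> real" where
  "laplacian f x = (\<Sum>b\<in>Basis. partial_deriv b (partial_deriv b f) x)"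

text \<open>\<open>C_on n S f\<close>: \<open>f\<close> is of class \<open>C\<^sup>n\<close> on \<open>S\<close>. Meant for open \<open>S\<close> only.\<close>

primrec C_on :: "nat \<Rightarrow> 'a::euclidean_space set \<Rightarrow> ('a \<Rightarrow> real) \<Rightarrow> bool" where
  "C_on 0 S f \<longleftrightarrow> continuous_on S f"
| "C_on (Suc n) S f \<longleftrightarrow>
     (\<forall>x\<in>S. f differentiable (at x)) \<and> (\<forall>b\<in>Basis. C_on n S (partial_deriv b f))"

text \<open>\<open>C\<^sub>c\<^sup>\<infinity>(D)\<close>, with its elements already extended by \<open>0\<close> to the whole space.\<close>

definition test_functions :: "'a::euclidean_space set \<Rightarrow> ('a \<Rightarrow> real) set" where
  "test_functions D = {\<phi>. (\<forall>n. C_on n UNIV \<phi>) \<and>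
     compact (closure {x. \<phi> x \<noteq> 0}) \<and> closure {x. \<phi> x \<noteq> 0} \<subseteq> D}"

text \<open>Off the hyperplanes orthogonal to the roots this is the usual formula. On these hyperplanes,
  a Lebesgue null set, the convention \<open>x / 0 = 0\<close> replaces the limit values; this is immaterial
  below because the operator only occurs under integrals.\<close>

definition dunkl_laplacian ::
  "'a::euclidean_space set \<Rightarrow> ('a \<Rightarrow> real) \<Rightarrow> ('a \<Rightarrow> real) \<Rightarrow> 'a \<Rightarrow> real" where
  "dunkl_laplacian Rp k f x = laplacian f x + 2 * (\<Sum>\<alpha>\<in>Rp. k \<alpha> *
     ((gradient f x \<bullet> \<alpha>) / (\<alpha> \<bullet> x)
      - (norm \<alpha>)\<^sup>2 / 2 * ((f x - f (reflection \<alpha> x)) / (\<alpha> \<bullet> x)\<^sup>2)))"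

text \<open>The case distinction implements \<open>0\<^sup>0 = 1\<close>, whereas \<open>0 powr 0 = 0\<close>.\<close>

definition dunkl_weight ::
  "'a::euclidean_space set \<Rightarrow> ('a \<Rightarrow> real) \<Rightarrow> 'a \<Rightarrow> real" where
  "dunkl_weight Rp k x =
     (\<Prod>\<alpha>\<in>Rp. if k \<alpha> = 0 then 1 else \<bar>x \<bullet> \<alpha>\<bar> powr (2 * k \<alpha>))"

definition dunkl_potential ::
  "'a::euclidean_space set \<Rightarrow> ('a \<Rightarrow> real) \<Rightarrow> 'a \<Rightarrow> real" where
  "dunkl_potential Rp k x = (\<Sum>\<alpha>\<in>Rp. (norm \<alpha> * k \<alpha> / (x \<bullet> \<alpha>))\<^sup>2)"

definition dunkl_nonlocal ::
  "'a::euclidean_space set \<Rightarrow> ('a \<Rightarrow> real) \<Rightarrow> ('a \<Rightarrow> real) \<Rightarrow> 'a \<Rightarrow> real" where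
  "dunkl_nonlocal Rp k f x =
     (\<Sum>\<alpha>\<in>Rp. (norm \<alpha>)\<^sup>2 * k \<alpha> / (x \<bullet> \<alpha>)\<^sup>2 * f (reflection \<alpha> x))"

definition dunkl_dirichlet_solution ::
  "'a::euclidean_space set \<Rightarrow> ('a \<Rightarrow> real) \<Rightarrow> 'a set \<Rightarrow> ('a \<Rightarrow> real) \<Rightarrow> ('a \<Rightarrow> real) \<Rightarrow> bool" where
  "dunkl_dirichlet_solution Rp k D f h \<longleftrightarrow>
     continuous_on UNIV h \<and> (\<forall>x\<in>- D. h x = f x) \<and>
     (\<forall>\<phi>\<in>test_functions D.
        (LINT x|lborel. h x * dunkl_laplacian Rp k \<phi> x * dunkl_weight Rp k x) = 0)"

definition dunkl_regular ::
  "'a::euclidean_space set \<Rightarrow> ('a \<Rightarrow> real) \<Rightarrow> 'a set \<Rightarrow> bool" where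
  "dunkl_regular Rp k D \<longleftrightarrow>
     (\<forall>f. continuous_on (- D) f \<longrightarrow> (\<exists>!h. dunkl_dirichlet_solution Rp k D f h))"

definition H_dunkl ::
  "'a::euclidean_space set \<Rightarrow> ('a \<Rightarrow> real) \<Rightarrow> 'a set \<Rightarrow> ('a \<Rightarrow> real) \<Rightarrow> 'a \<Rightarrow> real" where
  "H_dunkl Rp k D f = (THE h. dunkl_dirichlet_solution Rp k D f h)"

text \<open>Functions on the closure of \<open>D\<close> are represented by total functions that are \<open>undefined\<close>
  elsewhere, so that uniqueness means equality on the closure of \<open>D\<close>.\<close>

definition harmonic_on :: "'a::euclidean_space set \<Rightarrow> ('a \<Rightarrow> real) \<Rightarrow> bool" where
  "harmonic_on D h \<longleftrightarrow> C_on 2 D h \<and> (\<forall>x\<in>D. laplacian h x = 0)"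

definition laplace_regular :: "'a::euclidean_space set \<Rightarrow> bool" where
  "laplace_regular D \<longleftrightarrow>
     (\<forall>g. continuous_on (frontier D) g \<longrightarrow>
        (\<exists>!h. h \<in> extensional (closure D) \<and> continuous_on (closure D) h \<and>
              (\<forall>x\<in>frontier D. h x = g x) \<and> harmonic_on D h))"

definition H_schroedinger ::
  "('a::euclidean_space \<Rightarrow> real) \<Rightarrow> 'a set \<Rightarrow> ('a \<Rightarrow> real) \<Rightarrow> 'a \<Rightarrow> real" where
  "H_schroedinger q D g = (THE h. h \<in> extensional (closure D) \<and> continuous_on (closure D) h \<and>
     (\<forall>x\<in>frontier D. h x = g x) \<and>
     (\<forall>\<phi>\<in>test_functions D. (LINT x:D|lborel. h x * (laplacian \<phi> x - q x * \<phi> x)) = 0))"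

definition G_schroedinger ::
  "('a::euclidean_space \<Rightarrow> real) \<Rightarrow> 'a set \<Rightarrow> ('a \<Rightarrow> real) \<Rightarrow> 'a \<Rightarrow> real" where
  "G_schroedinger q D g = (THE u. u \<in> extensional (closure D) \<and> continuous_on (closure D) u \<and>
     (\<forall>x\<in>frontier D. u x = 0) \<and>
     (\<forall>\<phi>\<in>test_functions D.
        (LINT x:D|lborel. u x * (laplacian \<phi> x - q x * \<phi> x)) = - (LINT x:D|lborel. g x * \<phi> x)))"

end

theory Submission
  imports Defs
begin

text \<open>Multiplication by \<open>sqrt w\<^sub>k\<close> conjugates the local part of \<open>\<Delta>\<^sub>k\<close> into \<open>\<Delta> - q\<close>: the first order
  terms cancel, and the mixed terms of \<open>|\<nabla> log (sqrt w\<^sub>k)|\<^sup>2\<close> sum to zero by a residue computation.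
  Since \<open>D\<close> lies in one chamber, its reflections are disjoint from \<open>D\<close>, so the nonlocal part of
  \<open>\<Delta>\<^sub>k\<close> only sees the prescribed values outside \<open>D\<close>. Hence \<open>h\<close> solves the Dunkl problem iff
  \<open>h sqrt w\<^sub>k\<close> solves the Schroedinger problem with right-hand side \<open>- sqrt w\<^sub>k N f\<close>.

  The Schroedinger problem has at most one solution by a maximum principle for weak solutions.
  For existence, a parametrix whose error is a contraction solves the Poisson equation near \<open>D\<close>
  without a fundamental solution, uniformly in the dimension; \<open>\<Delta>\<close>-regularity corrects the boundary
  values; and the potential is switched on in finitely many small steps, the a priori bound being
  independent of the potential.\<close>

section \<open>Functions of class \<open>C\<^sup>n\<close> and test functions\<close>

text \<open>Solutions are merely continuous and are tested against smooth functions, and no step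
  improves their regularity. The maximum principle therefore works on mollifications, and the
  passage between classical and weak solutions is used in one direction only: for the harmonic
  functions supplied by \<Delta>-regularity and for an explicit quadratic barrier.

  That the closure of \<open>D\<close>, and not just \<open>D\<close>, avoids the hyperplanes keeps
  \<open>sqrt w\<^sub>k\<close> away from 0 and \<open>q\<close> continuous up to the boundary.
  Hence division by \<open>sqrt w\<^sub>k\<close> preserves continuity, and finitely many steps in
  the potential suffice.

  The parametrix comes from dilating a radial profile: the s-derivative of the integral of
  \<open>cap z * \<phi> (x + s z)\<close> over z is \<open>s\<close> times the integral of
  \<open>cap2 z * \<Delta> \<phi> (x + s z)\<close>. Integrated over 0 \<le> s \<le> S, this
  expresses \<phi> x through \<Delta>\<phi> and one average at scale S. A large S spreads that
  average so thinly that it is small on functions of bounded support; this is the source of the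
  contraction.\<close>

lemma partial_deriv_eq: "(f has_derivative f') (at x) \<Longrightarrow> partial_deriv b f x = f' b"
  using frechet_derivative_at[of f f' x] by (simp add: partial_deriv_def)

lemma has_derivative_frechet:
  "f differentiable (at x) \<Longrightarrow> (f has_derivative (\<lambda>h. partial_deriv h f x)) (at x)"
  using frechet_derivative_works[of f "at x"] by (simp add: partial_deriv_def)

text \<open>\<open>frechet_derivative\<close> chooses from the set of all derivatives at the point,
  and that set depends on the germ alone. So the equality holds even where neither function is
  differentiable.\<close>

lemma partial_deriv_cong_open:
  assumes "open S" "x \<in> S" "\<And>y. y \<in> S \<Longrightarrow> f y = g y"
  shows "partial_deriv b f x = partial_deriv b g x"
proof -
  have "(\<lambda>f'. (f has_derivative f') (at x)) = (\<lambda>f'. (g has_derivative f') (at x))"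
    using has_derivative_transform_within_open[OF _ assms(1,2)] assms(3) by metis
  then show ?thesis by (simp add: partial_deriv_def frechet_derivative_def)
qed

lemma differentiable_cong_open:
  assumes "open S" "x \<in> S" "\<And>y. y \<in> S \<Longrightarrow> f y = g y" "f differentiable (at x)"
  shows "g differentiable (at x)"
  using assms has_derivative_transform_within_open[OF _ assms(1,2)]
  unfolding differentiable_def by metis

lemma C_on_cong:
  assumes "open S" "\<And>x. x \<in> S \<Longrightarrow> f x = g x" "C_on n S f"
  shows "C_on n S g"
  using assms(2,3)
proof (induction n arbitrary: f g)
  case 0
  then show ?case by (metis C_on.simps(1) continuous_on_cong)
next
  case (Suc n)
  show ?case unfolding C_on.simps
  proof safe
    fix x assume "x \<in> S"
    then show "g differentiable at x"
      using Suc.prems differentiable_cong_open[OF assms(1), of x f g] by auto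
  next
    fix b :: 'a assume b: "b \<in> Basis"
    show "C_on n S (partial_deriv b g)"
      using Suc.IH[of "partial_deriv b f" "partial_deriv b g"] Suc.prems b
        partial_deriv_cong_open[OF assms(1), of _ f g b] by auto
  qed
qed

text \<open>Reduces each closure property of \<open>C_on\<close> to an induction whose step is a
  single derivative rule, valid on the open set only.\<close>

lemma C_on_Suc_intro:
  assumes "open S" "\<And>x. x \<in> S \<Longrightarrow> (f has_derivative f' x) (at x)"
    and "\<And>b. b \<in> Basis \<Longrightarrow> C_on n S (\<lambda>x. f' x b)"
  shows "C_on (Suc n) S f"
proof -
  have "C_on n S (partial_deriv b f)" if "b \<in> Basis" for b
    using C_on_cong[OF assms(1) _ assms(3)[OF that]] assms(2) partial_deriv_eq by metis
  then show ?thesis using assms(2) by (auto simp: differentiable_def)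
qed

lemma C_on_has_derivative:
  "C_on (Suc n) S f \<Longrightarrow> x \<in> S \<Longrightarrow> (f has_derivative (\<lambda>h. partial_deriv h f x)) (at x)"
  by (simp add: has_derivative_frechet)

lemma C_on_partial_deriv: "C_on (Suc n) S f \<Longrightarrow> b \<in> Basis \<Longrightarrow> C_on n S (partial_deriv b f)"
  by simp

lemma C_on_Suc_lower: "C_on (Suc n) S f \<Longrightarrow> C_on n S f"
proof (induction n arbitrary: f)
  case 0
  then show ?case
    by (auto intro!: continuous_at_imp_continuous_on differentiable_imp_continuous_within)
next
  case (Suc n)
  have "C_on n S (partial_deriv b f)" if "b \<in> Basis" for b
    using Suc.IH[OF C_on_partial_deriv[OF Suc.prems that]] .
  then show ?case using Suc.prems by simp
qed

lemma C_on_le: "C_on n S f \<Longrightarrow> m \<le> n \<Longrightarrow> C_on m S f"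
  by (induction n) (auto simp: le_Suc_eq simp del: C_on.simps dest: C_on_Suc_lower)

lemma C_on_imp_continuous_on: "C_on n S f \<Longrightarrow> continuous_on S f"
  using C_on_le[of n S f 0] by simp

lemma C_on_subset: "C_on n S f \<Longrightarrow> T \<subseteq> S \<Longrightarrow> C_on n T f"
  by (induction n arbitrary: f) (auto intro: continuous_on_subset)

lemma C_on_Un: "open S \<Longrightarrow> open T \<Longrightarrow> C_on n S f \<Longrightarrow> C_on n T f \<Longrightarrow> C_on n (S \<union> T) f"
  by (induction n arbitrary: f) (auto simp: continuous_on_open_Un)

section \<open>Closure properties of the classes C^n\<close>

lemma C_on_const: "open S \<Longrightarrow> C_on n S (\<lambda>x. c)"
proof (induction n arbitrary: c)
  case (Suc n)
  show ?case
    by (rule C_on_Suc_intro[OF Suc.prems has_derivative_const]) (rule Suc.IH[OF Suc.prems])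
qed simp

lemma C_on_add:
  assumes "open S" shows "C_on n S f \<Longrightarrow> C_on n S g \<Longrightarrow> C_on n S (\<lambda>x. f x + g x)"
proof (induction n arbitrary: f g)
  case 0
  then show ?case by (simp add: continuous_on_add)
next
  case (Suc n)
  show ?case
    by (rule C_on_Suc_intro[OF assms
          has_derivative_add[OF C_on_has_derivative[OF Suc.prems(1)] C_on_has_derivative[OF Suc.prems(2)]]])
      (auto intro!: Suc.IH C_on_partial_deriv Suc.prems simp del: C_on.simps)
qed

lemma C_on_mult:
  assumes "open S" shows "C_on n S f \<Longrightarrow> C_on n S g \<Longrightarrow> C_on n S (\<lambda>x. f x * g x)"
proof (induction n arbitrary: f g)
  case 0
  then show ?case by (simp add: continuous_on_mult)
next
  case (Suc n)
  show ?case
    by (rule C_on_Suc_intro[OF assms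
          has_derivative_mult[OF C_on_has_derivative[OF Suc.prems(1)] C_on_has_derivative[OF Suc.prems(2)]]])
      (auto intro!: C_on_add assms Suc.IH C_on_partial_deriv C_on_Suc_lower[OF Suc.prems(1)]
          C_on_Suc_lower[OF Suc.prems(2)] Suc.prems simp del: C_on.simps)
qed

lemma C_on_cmult: "open S \<Longrightarrow> C_on n S f \<Longrightarrow> C_on n S (\<lambda>x. c * f x)"
  by (rule C_on_mult) (auto intro: C_on_const)

lemma C_on_minus: "open S \<Longrightarrow> C_on n S f \<Longrightarrow> C_on n S (\<lambda>x. - f x)"
  using C_on_cmult[of S n f "-1"] by simp

lemma C_on_diff: "open S \<Longrightarrow> C_on n S f \<Longrightarrow> C_on n S g \<Longrightarrow> C_on n S (\<lambda>x. f x - g x)"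
  using C_on_add[of S n f "\<lambda>x. - g x"] C_on_minus[of S n g] by simp

lemma C_on_sum:
  "open S \<Longrightarrow> (\<And>i. i \<in> I \<Longrightarrow> C_on n S (f i)) \<Longrightarrow> C_on n S (\<lambda>x. \<Sum>i\<in>I. f i x)"
  by (induction I rule: infinite_finite_induct) (auto intro: C_on_const C_on_add)

lemma C_on_inner: 
  assumes "open S" shows "C_on n S (\<lambda>x. (x - a) \<bullet> b)"
proof (cases n)
  case (Suc m)
  show ?thesis unfolding Suc
    by (rule C_on_Suc_intro[where f' = "\<lambda>x h. h \<bullet> b"])
      (auto intro!: assms C_on_const derivative_eq_intros)
qed (auto intro!: continuous_intros)

lemma C_on_exp:
  assumes "open S" shows "C_on n S f \<Longrightarrow> C_on n S (\<lambda>x. exp (f x))"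
proof (induction n arbitrary: f)
  case 0
  then show ?case by (simp add: continuous_on_exp)
next
  case (Suc n)
  show ?case
    by (rule C_on_Suc_intro[OF assms has_derivative_exp[OF C_on_has_derivative[OF Suc.prems]]])
      (auto intro!: C_on_mult assms Suc.IH C_on_partial_deriv C_on_Suc_lower[OF Suc.prems] Suc.prems simp del: C_on.simps)
qed

lemma C_on_inverse:
  assumes "open S" "\<And>x. x \<in> S \<Longrightarrow> f x \<noteq> 0" shows "C_on n S f \<Longrightarrow> C_on n S (\<lambda>x. inverse (f x))"
proof (induction n)
  case 0
  then show ?case using assms(2) by (simp add: continuous_on_inverse)
next
  case (Suc n)
  note IH = Suc.IH[OF C_on_Suc_lower[OF Suc.prems]]
  show ?case
    by (rule C_on_Suc_intro[OF assms(1) Deriv.has_derivative_inverse[OF assms(2) C_on_has_derivative[OF Suc.prems]]])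
      (auto intro!: C_on_mult C_on_minus assms(1) IH C_on_partial_deriv Suc.prems simp del: C_on.simps)
qed

section \<open>Smoothness of ln |f| and of exp (- 1 / t)\<close>

lemma has_real_derivative_ln_abs:
  assumes "t \<noteq> 0" shows "((\<lambda>t. ln \<bar>t\<bar>) has_real_derivative inverse t) (at (t::real))"
proof (cases "t > 0")
  case True
  have "((\<lambda>t. ln t) has_real_derivative inverse t) (at t)"
    using True by (auto intro!: derivative_eq_intros simp: inverse_eq_divide)
  then show ?thesis
    by (rule has_field_derivative_transform_within_open[of _ _ _ "{0<..}"]) (use True in auto)
next
  case False
  have "((\<lambda>t. ln (- t)) has_real_derivative inverse t) (at t)"
    using False assms by (auto intro!: derivative_eq_intros simp: field_simps)
  then show ?thesis
    by (rule has_field_derivative_transform_within_open[of _ _ _ "{..<0}"]) (use False assms in auto)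
qed

lemma has_derivative_ln_abs:
  fixes f :: "'a::euclidean_space \<Rightarrow> real"
  assumes "(f has_derivative f') (at x)" "f x \<noteq> 0"
  shows "((\<lambda>x. ln \<bar>f x\<bar>) has_derivative (\<lambda>h. inverse (f x) * f' h)) (at x)"
  using has_derivative_compose[OF assms(1),of "\<lambda>t. ln \<bar>t\<bar>"]
    has_real_derivative_ln_abs[OF assms(2)] by (simp add: has_field_derivative_def)

lemma C_on_ln_abs:
  assumes "open S" "\<And>x. x \<in> S \<Longrightarrow> f x \<noteq> 0" "C_on n S f"
  shows "C_on n S (\<lambda>x. ln \<bar>f x\<bar>)"
proof (cases n)
  case 0
  then show ?thesis using assms by (auto intro!: continuous_intros)
next
  case (Suc m)
  note f = assms(3)[unfolded Suc]
  show ?thesis unfolding Suc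
    by (rule C_on_Suc_intro[OF assms(1) has_derivative_ln_abs[OF C_on_has_derivative[OF f] assms(2)]])
      (auto intro!: C_on_mult C_on_inverse assms(1,2) C_on_partial_deriv f C_on_Suc_lower[OF f] simp del: C_on.simps)
qed

text \<open>The family is closed under differentiation up to linear combinations, which makes
  smoothness of \<open>exp (- 1 / t)\<close> a plain induction.\<close>

definition flat_exp :: "nat \<Rightarrow> real \<Rightarrow> real" where
  "flat_exp m t = (if t > 0 then exp (- 1 / t) / t ^ m else 0)"

lemma flat_exp_tendsto_0: "((\<lambda>t. exp (- 1 / t) / t ^ m) \<longlongrightarrow> 0) (at_right (0::real))"
proof -
  have "((\<lambda>t::real. t ^ m / exp t) \<longlongrightarrow> 0) at_top"
    by (rule tendsto_power_div_exp_0)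
  then have "((\<lambda>t::real. inverse t ^ m / exp (inverse t)) \<longlongrightarrow> 0) (at_right 0)"
    by (rule filterlim_compose[OF _ filterlim_inverse_at_top_right])
  then show ?thesis
    by (simp add: exp_minus field_simps)
qed

lemma flat_exp_has_derivative:
  "(flat_exp m has_real_derivative flat_exp (m + 2) t - real m * flat_exp (m + 1) t) (at t)"
proof -
  consider "t > 0" | "t < 0" | "t = 0" by linarith
  then show ?thesis
  proof cases
    case 1
    have e: "exp (- 1 / s) / s ^ j = exp (- inverse s) * inverse s ^ j" for s :: real and j
      by (simp add: divide_inverse power_inverse)
    have i: "((\<lambda>t. exp (- inverse t)) has_real_derivative exp (- inverse t) * inverse t ^ 2) (at t)"
      using 1 by (auto intro!: derivative_eq_intros simp: power2_eq_square)
    have p: "((\<lambda>t. inverse t ^ m) has_real_derivative - (real m * inverse t ^ (m + 1))) (at t)"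
    proof (cases m)
      case (Suc j)
      have "(inverse has_real_derivative - (inverse t ^ 2)) (at t)"
        using 1 by (auto intro!: derivative_eq_intros simp: power2_eq_square)
      then show ?thesis
        unfolding Suc by (rule DERIV_cong[OF DERIV_power_Suc]) (simp add: power2_eq_square)
    qed simp
    have "((\<lambda>t. exp (- 1 / t) / t ^ m) has_real_derivative
        flat_exp (m + 2) t - real m * flat_exp (m + 1) t) (at t)"
      unfolding flat_exp_def e
      by (rule DERIV_cong[OF DERIV_mult[OF i p]])
        (use 1 in \<open>simp add: power_add power2_eq_square algebra_simps\<close>)
    then show ?thesis
      by (rule DERIV_cong_ev[THEN iffD1, rotated -1, OF _ refl _ refl])
        (use 1 in \<open>auto simp: flat_exp_def eventually_nhds intro!: exI[of _ "{0<..}"]\<close>)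
  next
    case 2
    have "((\<lambda>t. 0) has_real_derivative flat_exp (m + 2) t - real m * flat_exp (m + 1) t) (at t)"
      using 2 by (auto simp: flat_exp_def)
    then show ?thesis
      by (rule DERIV_cong_ev[THEN iffD1, rotated -1, OF _ refl _ refl])
        (use 2 in \<open>auto simp: flat_exp_def eventually_nhds intro!: exI[of _ "{..<0}"]\<close>)
  next
    case 3
    have "((\<lambda>t. (flat_exp m t - flat_exp m 0) / (t - 0)) \<longlongrightarrow> 0) (at_left 0)"
      by (rule tendsto_eventually) (auto simp: flat_exp_def eventually_at_filter)
    \<comment> \<open>Division by \<open>t\<close> raises the exponent in the denominator by one,
      hence the limit is needed for \<open>Suc m\<close>.\<close>
    moreover have "((\<lambda>t. (flat_exp m t - flat_exp m 0) / (t - 0)) \<longlongrightarrow> 0) (at_right 0)"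
      by (rule Lim_transform_eventually[OF flat_exp_tendsto_0[of "Suc m"]])
        (auto simp: flat_exp_def eventually_at_filter)
    ultimately have "((\<lambda>t. (flat_exp m t - flat_exp m 0) / (t - 0)) \<longlongrightarrow> 0) (at 0)"
      using filterlim_split_at by blast
    then show ?thesis using 3 by (simp add: has_field_derivative_iff flat_exp_def)
  qed
qed

lemma C_on_flat_exp:
  assumes "open S" shows "C_on n S f \<Longrightarrow> C_on n S (\<lambda>x. flat_exp m (f x))"
proof (induction n arbitrary: m)
  case 0
  have "continuous_on UNIV (flat_exp m)"
    by (rule continuous_at_imp_continuous_on) (intro ballI DERIV_continuous[OF flat_exp_has_derivative])
  then show ?case
    using 0 continuous_on_compose2[of UNIV "flat_exp m" S f] by auto
next
  case (Suc n)
  have d: "((\<lambda>x. flat_exp m (f x)) has_derivative (\<lambda>h. (flat_exp (m + 2) (f x) - real m * flat_exp (m + 1) (f x)) * partial_deriv h f x)) (at x)"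
    if "x \<in> S" for x
    using has_derivative_compose[OF C_on_has_derivative[OF Suc.prems that]
        flat_exp_has_derivative[unfolded has_field_derivative_def]] .
  note IH = Suc.IH[OF C_on_Suc_lower[OF Suc.prems]]
  show ?case
  proof (rule C_on_Suc_intro[OF assms d])
    fix b :: 'a assume b: "b \<in> Basis"
    show "C_on n S (\<lambda>x. (flat_exp (m + 2) (f x) - real m * flat_exp (m + 1) (f x)) * partial_deriv b f x)"
      by (rule C_on_mult[OF assms C_on_diff[OF assms IH C_on_cmult[OF assms IH]] C_on_partial_deriv[OF Suc.prems b]])
  qed
qed

section \<open>Bumps and the construction of test functions\<close>

lemma C_on_norm_power2: "C_on n UNIV (\<lambda>x::'a::euclidean_space. (norm (x - a))\<^sup>2)"
proof -
  have "(\<lambda>x::'a. (norm (x - a))\<^sup>2) = (\<lambda>x. \<Sum>b\<in>Basis. ((x - a) \<bullet> b) * ((x - a) \<bullet> b))"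
    by (simp add: power2_norm_eq_inner euclidean_inner[symmetric])
  then show ?thesis
    by (simp only:) (intro C_on_sum C_on_mult C_on_inner open_UNIV)
qed

text \<open>The standard mollifier, not normalised:
  \<open>exp (- 1 / (\<epsilon>\<^sup>2 - |x - a|\<^sup>2))\<close> inside the ball and 0
  outside.\<close>

definition bump :: "'a::euclidean_space \<Rightarrow> real \<Rightarrow> 'a \<Rightarrow> real" where
  "bump a \<epsilon> x = flat_exp 0 (\<epsilon>\<^sup>2 - (norm (x - a))\<^sup>2)"

lemma C_on_bump: "C_on n UNIV (bump a \<epsilon>)"
  unfolding bump_def by (intro C_on_flat_exp C_on_diff C_on_const C_on_norm_power2 open_UNIV)

lemma bump_nonneg: "bump a \<epsilon> x \<ge> 0"
  by (simp add: bump_def flat_exp_def)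

lemma bump_pos_iff: "\<epsilon> > 0 \<Longrightarrow> bump a \<epsilon> x > 0 \<longleftrightarrow> x \<in> ball a \<epsilon>"
  by (auto simp: bump_def flat_exp_def dist_norm norm_minus_commute intro: power_strict_mono
      dest: power_less_imp_less_base)

lemma bump_zero: "\<epsilon> > 0 \<Longrightarrow> x \<notin> ball a \<epsilon> \<Longrightarrow> bump a \<epsilon> x = 0"
  using bump_pos_iff[of \<epsilon> a x] bump_nonneg[of a \<epsilon> x] by linarith

lemma test_functions_C_on: "\<phi> \<in> test_functions D \<Longrightarrow> C_on n UNIV \<phi>"
  by (simp add: test_functions_def)

text \<open>\<open>D\<close> and the complement of \<open>K\<close> are open and cover the space,
  and the function vanishes on the latter; so smoothness on \<open>D\<close> is enough. This admits
  products with factors that are singular away from \<open>D\<close>, such as powers of the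
  weight.\<close>

lemma test_functionsI:
  assumes "open D" "compact K" "K \<subseteq> D" "\<And>n. C_on n D \<phi>" "\<And>x. x \<notin> K \<Longrightarrow> \<phi> x = 0"
  shows "\<phi> \<in> test_functions D"
proof -
  have K: "open (- K)" "closed K" using compact_imp_closed[OF assms(2)] by auto
  have sub: "closure {x. \<phi> x \<noteq> 0} \<subseteq> K"
    by (rule closure_minimal[OF _ K(2)]) (use assms(5) in auto)
  have "C_on n (- K) \<phi>" for n
    by (rule C_on_cong[OF K(1) _ C_on_const[OF K(1), where c=0]]) (use assms(5) in auto)
  then have "C_on n (D \<union> - K) \<phi>" for n
    using assms K by (intro C_on_Un) auto
  moreover have "D \<union> - K = UNIV" using assms by auto
  ultimately have "C_on n UNIV \<phi>" for n by simp
  moreover have "compact (closure {x. \<phi> x \<noteq> 0})"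
    using compact_Int_closed[OF assms(2) closed_closure, of "{x. \<phi> x \<noteq> 0}"] sub
    by (simp add: Int_absorb1)
  ultimately show ?thesis using sub assms(3) by (auto simp: test_functions_def)
qed

lemma bump_test_function:
  assumes "\<epsilon> > 0" "cball a \<epsilon> \<subseteq> D" "open D"
  shows "bump a \<epsilon> \<in> test_functions D"
  using assms bump_zero[of \<epsilon> _ a]
  by (intro test_functionsI[of D "cball a \<epsilon>"]) (auto intro: C_on_subset[OF C_on_bump])

section \<open>Supports, and derivatives outside the support\<close>

definition supp :: "('a::euclidean_space \<Rightarrow> real) \<Rightarrow> 'a set" where
  "supp \<phi> = closure {x. \<phi> x \<noteq> 0}"

lemma test_functions_supp:
  assumes "\<phi> \<in> test_functions D"
  shows "compact (supp \<phi>)" "supp \<phi> \<subseteq> D" "closed (supp \<phi>)"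
  using assms by (auto simp: test_functions_def supp_def)

lemma not_supp: "x \<notin> supp \<phi> \<Longrightarrow> \<phi> x = 0"
  using closure_subset[of "{x. \<phi> x \<noteq> 0}"] by (auto simp: supp_def)

lemma partial_deriv_zero_open:
  assumes "open S" "x \<in> S" "\<And>y. y \<in> S \<Longrightarrow> f y = 0"
  shows "partial_deriv b f x = 0"
proof -
  have "partial_deriv b f x = partial_deriv b (\<lambda>y. 0) x"
    by (rule partial_deriv_cong_open[OF assms(1,2)]) (use assms(3) in auto)
  then show ?thesis using partial_deriv_eq[OF has_derivative_const[of 0 "at x"], of b] by simp
qed

lemma open_not_supp: "open (- supp \<phi>)"
  unfolding supp_def by (rule open_Compl[OF closed_closure])

lemma partial_deriv_not_supp: "x \<notin> supp \<phi> \<Longrightarrow> partial_deriv b \<phi> x = 0"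
  by (rule partial_deriv_zero_open[of "- supp \<phi>"]) (auto simp: not_supp open_not_supp)

lemma partial_deriv2_not_supp: "x \<notin> supp \<phi> \<Longrightarrow> partial_deriv b (partial_deriv c \<phi>) x = 0"
  by (rule partial_deriv_zero_open[of "- supp \<phi>"])
    (auto simp: partial_deriv_not_supp open_not_supp)

lemma laplacian_not_supp: "x \<notin> supp \<phi> \<Longrightarrow> laplacian \<phi> x = 0"
  by (simp add: laplacian_def partial_deriv2_not_supp)

lemma gradient_not_supp: "x \<notin> supp \<phi> \<Longrightarrow> gradient \<phi> x = 0"
  by (simp add: gradient_def partial_deriv_not_supp)

lemma continuous_on_partial_deriv:
  "C_on (Suc n) S f \<Longrightarrow> b \<in> Basis \<Longrightarrow> continuous_on S (partial_deriv b f)"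
  using C_on_imp_continuous_on C_on_partial_deriv by blast

lemma continuous_on_partial_deriv2:
  "C_on (Suc (Suc n)) S f \<Longrightarrow> b \<in> Basis \<Longrightarrow> c \<in> Basis \<Longrightarrow> continuous_on S (partial_deriv b (partial_deriv c f))"
  using continuous_on_partial_deriv C_on_partial_deriv by blast

lemma continuous_on_laplacian: "C_on (Suc (Suc n)) S f \<Longrightarrow> continuous_on S (laplacian f)"
  unfolding laplacian_def
  by (intro continuous_on_sum continuous_on_partial_deriv2)

lemma continuous_on_gradient: "C_on (Suc n) S f \<Longrightarrow> continuous_on S (gradient f)"
  unfolding gradient_def
  by (intro continuous_on_sum continuous_on_scaleR continuous_on_const continuous_on_partial_deriv)

section \<open>Product rule for the Laplacian\<close>

lemma partial_deriv_mult:
  "f differentiable (at x) \<Longrightarrow> g differentiable (at x) \<Longrightarrow>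
   partial_deriv b (\<lambda>x. f x * g x) x = f x * partial_deriv b g x + partial_deriv b f x * g x"
  by (rule partial_deriv_eq[OF has_derivative_mult[OF has_derivative_frechet has_derivative_frechet]])

lemma gradient_inner:
  assumes "f differentiable (at x)" shows "gradient f x \<bullet> h = partial_deriv h f x"
proof -
  interpret linear "\<lambda>h. partial_deriv h f x"
    using has_derivative_frechet[OF assms] by (rule has_derivative_linear)
  have "partial_deriv h f x = partial_deriv (\<Sum>b\<in>Basis. (h \<bullet> b) *\<^sub>R b) f x"
    by (simp add: euclidean_representation)
  also have "\<dots> = (\<Sum>b\<in>Basis. (h \<bullet> b) * partial_deriv b f x)"
    by (simp add: sum scaleR)
  finally show ?thesis
    by (simp add: gradient_def inner_sum_left inner_commute[of h] mult.commute)
qed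

lemma C_on_differentiable: "C_on (Suc n) S f \<Longrightarrow> x \<in> S \<Longrightarrow> f differentiable (at x)"
  by simp

lemma laplacian_mult:
  assumes "open S" "x \<in> S" "C_on 2 S f" "C_on 2 S g"
  shows "laplacian (\<lambda>x. f x * g x) x =
    f x * laplacian g x + 2 * (gradient f x \<bullet> gradient g x) + laplacian f x * g x"
proof -
  have f: "C_on (Suc (Suc 0)) S f" and g: "C_on (Suc (Suc 0)) S g"
    using assms by (simp_all add: numeral_2_eq_2)
  note df = C_on_differentiable[OF f] C_on_differentiable[OF g]
  have "partial_deriv b (partial_deriv b (\<lambda>x. f x * g x)) x =
     f x * partial_deriv b (partial_deriv b g) x + 2 * (partial_deriv b f x * partial_deriv b g x)
      + partial_deriv b (partial_deriv b f) x * g x" if b: "b \<in> Basis" for b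
  proof -
    note df2 = C_on_differentiable[OF C_on_partial_deriv[OF f b] assms(2)]
       C_on_differentiable[OF C_on_partial_deriv[OF g b] assms(2)]
    have "partial_deriv b (partial_deriv b (\<lambda>x. f x * g x)) x =
      partial_deriv b (\<lambda>x. f x * partial_deriv b g x + partial_deriv b f x * g x) x"
      by (rule partial_deriv_cong_open[OF assms(1,2)]) (simp add: partial_deriv_mult df)
    also have "\<dots> = (f x * partial_deriv b (partial_deriv b g) x + partial_deriv b f x * partial_deriv b g x)
       + (partial_deriv b f x * partial_deriv b g x + partial_deriv b (partial_deriv b f) x * g x)"
      by (rule partial_deriv_eq[OF has_derivative_add[OF has_derivative_mult has_derivative_mult]])
        (intro has_derivative_frechet df[OF assms(2)] df2)+
    finally show ?thesis by simp
  qed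
  moreover have "gradient f x \<bullet> gradient g x = (\<Sum>b\<in>Basis. partial_deriv b f x * partial_deriv b g x)"
    by (subst (2) gradient_def) (simp add: inner_sum_right gradient_inner df[OF assms(2)] mult.commute)
  ultimately show ?thesis
    by (simp add: laplacian_def sum.distrib sum_distrib_left sum_distrib_right)
qed

section \<open>Integration by parts\<close>

lemma integrable_bounded_support:
  fixes f :: "'a::euclidean_space \<Rightarrow> real"
  assumes "f \<in> borel_measurable borel" "\<And>x. \<bar>f x\<bar> \<le> B" "\<And>x. x \<notin> cball 0 r \<Longrightarrow> f x = 0"
  shows "integrable lborel f"
  by (rule integrableI_bounded_set[of "cball 0 r" _ f B])
    (use assms emeasure_bounded_finite[OF bounded_cball] in auto)

lemma compact_support_bounds:
  fixes f :: "'a::euclidean_space \<Rightarrow> real"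
  assumes "continuous_on UNIV f" "compact K" "\<And>x. x \<notin> K \<Longrightarrow> f x = 0"
  obtains B r where "B \<ge> 0" "\<And>x. \<bar>f x\<bar> \<le> B" "r > 0" "K \<subseteq> cball 0 r" 
proof -
  obtain r where r: "r > 0" "K \<subseteq> cball 0 r"
    using compact_imp_bounded[OF assms(2)] by (auto simp: subset_iff bounded_pos)
  have "compact (f ` K)"
    by (rule compact_continuous_image[OF continuous_on_subset[OF assms(1)] assms(2)]) auto
  then obtain B where B: "B > 0" "\<And>x. x \<in> K \<Longrightarrow> \<bar>f x\<bar> \<le> B"
    using compact_imp_bounded bounded_pos by (metis imageI real_norm_def)
  have "\<bar>f x\<bar> \<le> B" for x using B assms(3)[of x] by (cases "x \<in> K") auto
  then show ?thesis using that[of B r] r B by auto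
qed

lemma integrable_compact_support:
  fixes f :: "'a::euclidean_space \<Rightarrow> real"
  assumes "continuous_on UNIV f" "compact K" "\<And>x. x \<notin> K \<Longrightarrow> f x = 0"
  shows "integrable lborel f"
proof -
  obtain B r where "\<And>x. \<bar>f x\<bar> \<le> B" "K \<subseteq> cball 0 r"
    using compact_support_bounds[OF assms] by metis
  then show ?thesis
    using assms(3) by (intro integrable_bounded_support[of f B r] borel_measurable_continuous_onI assms(1)) blast+
qed

lemma continuous_on_zero_extension:
  fixes f :: "'a::euclidean_space \<Rightarrow> real"
  assumes "open D" "compact K" "K \<subseteq> D" "continuous_on D f" "\<And>x. x \<notin> K \<Longrightarrow> f x = 0"
  shows "continuous_on UNIV f"
proof -
  have K: "open (- K)" using compact_imp_closed[OF assms(2)] by auto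
  have "continuous_on (- K) f"
    by (rule continuous_on_cong[THEN iffD1, OF refl _ continuous_on_const[of _ 0]]) (use assms in auto)
  then have "continuous_on (D \<union> - K) f"
    using assms K by (simp add: continuous_on_open_Un)
  moreover have "D \<union> - K = UNIV" using assms by auto
  ultimately show ?thesis by simp
qed

lemma integrable_zero_extension:
  fixes f :: "'a::euclidean_space \<Rightarrow> real"
  assumes "open D" "compact K" "K \<subseteq> D" "continuous_on D f" "\<And>x. x \<notin> K \<Longrightarrow> f x = 0"
  shows "integrable lborel f"
  using integrable_compact_support[OF continuous_on_zero_extension[OF assms] assms(2,5)] .

lemma set_integral_supp:
  fixes f :: "'a::euclidean_space \<Rightarrow> real"
  assumes "\<And>x. x \<notin> D \<Longrightarrow> f x = 0"
  shows "(LINT x:D|M. f x) = (LINT x|M. f x)"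
  unfolding set_lebesgue_integral_def
  by (rule Bochner_Integration.integral_cong) (use assms in \<open>auto simp: indicator_def\<close>)

lemma integral_lborel_translation:
  fixes f :: "'a::euclidean_space \<Rightarrow> real"
  assumes "f \<in> borel_measurable borel"
  shows "(LBINT x. f (a + x)) = (LBINT x. f x)"
proof -
  have "(LBINT x. f x) = (LINT x|distr lborel borel ((+) a). f x)"
    by (simp add: lborel_distr_plus)
  also have "\<dots> = (LBINT x. f (a + x))"
    using assms by (intro integral_distr) auto
  finally show ?thesis by simp
qed

lemma integrable_lborel_translation:
  fixes f :: "'a::euclidean_space \<Rightarrow> real"
  assumes "integrable lborel f"
  shows "integrable lborel (\<lambda>x. f (a + x))"
proof -
  have "integrable (distr lborel borel ((+) a)) f" using assms by (simp add: lborel_distr_plus)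
  then show ?thesis
    using assms by (subst (asm) integrable_distr_eq) auto
qed

lemma directional_mvt:
  fixes F :: "'a::euclidean_space \<Rightarrow> real"
  assumes "\<And>x. (F has_derivative F' x) (at x)" "s > 0"
  obtains \<xi> where "0 < \<xi>" "\<xi> < s" "F (x + s *\<^sub>R b) - F x = s * F' (x + \<xi> *\<^sub>R b) b"
proof -
  have d: "((\<lambda>t. F (x + t *\<^sub>R b)) has_real_derivative F' (x + t *\<^sub>R b) b) (at t)" for t
  proof -
    interpret linear "F' (x + t *\<^sub>R b)" using assms(1) by (rule has_derivative_linear)
    have "((\<lambda>t. F (x + t *\<^sub>R b)) has_derivative (\<lambda>h. F' (x + t *\<^sub>R b) (h *\<^sub>R b))) (at t)"
      by (rule has_derivative_compose[OF _ assms(1)]) (auto intro!: derivative_eq_intros)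
    then show ?thesis by (simp add: has_field_derivative_def scaleR mult_commute_abs)
  qed
  show ?thesis using MVT2[OF assms(2), of "\<lambda>t. F (x + t *\<^sub>R b)" "\<lambda>t. F' (x + t *\<^sub>R b) b"] d that
    by auto
qed

text \<open>Translation invariance makes the integrals of all difference quotients vanish.\<close>

lemma integral_derivative_zero:
  fixes F :: "'a::euclidean_space \<Rightarrow> real"
  assumes d: "\<And>x. (F has_derivative F' x) (at x)"
    and c: "continuous_on UNIV (\<lambda>x. F' x b)"
    and K: "compact K" "\<And>x. x \<notin> K \<Longrightarrow> F x = 0"
  shows "(LBINT x. F' x b) = 0"
proof -
  have oK: "open (- K)" using compact_imp_closed[OF K(1)] by auto
  have F'0: "F' x b = 0" if "x \<notin> K" for x
    using partial_deriv_zero_open[OF oK, of x F b] that K(2) partial_deriv_eq[OF d] by auto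
  have cF: "continuous_on UNIV F"
    by (rule continuous_at_imp_continuous_on) (intro ballI has_derivative_continuous[OF d])
  obtain B r where B: "B \<ge> 0" "\<And>x. \<bar>F' x b\<bar> \<le> B" "r > 0" "K \<subseteq> cball 0 r"
    using compact_support_bounds[OF c K(1) F'0] by metis
  have iF: "integrable lborel F" by (rule integrable_compact_support[OF cF K])
  define s where "s n = inverse (real (Suc n))" for n
  have s: "s n > 0" "s n \<le> 1" for n by (auto simp: s_def field_simps)
  define h where "h n x = (F (x + s n *\<^sub>R b) - F x) / s n" for n x
  have h0: "(LBINT x. h n x) = 0" for n
  proof -
    have "(LBINT x. F (s n *\<^sub>R b + x)) = (LBINT x. F x)"
      using iF by (intro integral_lborel_translation) auto
    moreover have "integrable lborel (\<lambda>x. F (s n *\<^sub>R b + x))"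
      by (rule integrable_lborel_translation[OF iF])
    ultimately show ?thesis
      using iF by (simp add: h_def add.commute)
  qed
  have lim: "(\<lambda>n. h n x) \<longlonglongrightarrow> F' x b" for x
  proof -
    interpret linear "F' x" using d by (rule has_derivative_linear)
    have "((\<lambda>t. F (x + t *\<^sub>R b)) has_derivative (\<lambda>t. F' x (t *\<^sub>R b))) (at 0)"
      by (rule has_derivative_compose[of _ _ 0 UNIV F]) (auto intro!: derivative_eq_intros d)
    then have "((\<lambda>t. F (x + t *\<^sub>R b)) has_real_derivative F' x b) (at 0)"
      by (simp add: has_field_derivative_def scaleR mult_commute_abs)
    then have *: "((\<lambda>t. (F (x + t *\<^sub>R b) - F x) / t) \<longlongrightarrow> F' x b) (at 0)"
      by (simp add: DERIV_def)
    have "filterlim s (at 0) sequentially"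
      unfolding s_def filterlim_at
      using LIMSEQ_inverse_real_of_nat by (auto intro!: always_eventually)
    from filterlim_compose[OF * this] show ?thesis by (simp add: h_def)
  qed
  \<comment> \<open>The integrable majorant: the mean value theorem bounds the quotients by
    \<open>B\<close>, and as \<open>s n \<le> 1\<close> they vanish outside the ball enlarged by
    \<open>norm b\<close>.\<close>
  have bd: "\<bar>h n x\<bar> \<le> B * indicator (cball 0 (r + norm b)) x" for n x
  proof -
    obtain \<xi> where \<xi>: "F (x + s n *\<^sub>R b) - F x = s n * F' (x + \<xi> *\<^sub>R b) b"
      using directional_mvt[OF d s(1)] by metis
    have "\<bar>h n x\<bar> \<le> B" using \<xi> s(1)[of n] B(2)[of "x + \<xi> *\<^sub>R b"] by (simp add: h_def)
    moreover have "h n x = 0" if "x \<notin> cball 0 (r + norm b)"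
    proof -
      have n: "norm x > r + norm b" using that by auto
      have "norm (s n *\<^sub>R b) \<le> norm b" using s[of n] by (auto intro: mult_left_le_one_le)
      then have "norm (x + s n *\<^sub>R b) > r" "norm x > r"
        using n norm_diff_ineq[of x "s n *\<^sub>R b"] norm_ge_zero[of b] by linarith+
      then have "F (x + s n *\<^sub>R b) = 0" "F x = 0"
        using K(2)[of x] K(2)[of "x + s n *\<^sub>R b"] B(4) by force+
      then show ?thesis by (simp add: h_def)
    qed
    ultimately show ?thesis by (auto simp: indicator_def)
  qed
  have "(\<lambda>n. LBINT x. h n x) \<longlonglongrightarrow> (LBINT x. F' x b)"
  proof (rule integral_dominated_convergence[where w = "\<lambda>x. B * indicator (cball 0 (r + norm b)) x"])
    show "(\<lambda>x. F' x b) \<in> borel_measurable lborel"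
      using borel_measurable_continuous_onI[OF c] by simp
    show "h n \<in> borel_measurable lborel" for n
      unfolding h_def using cF
      by (auto intro!: borel_measurable_continuous_onI continuous_intros continuous_on_compose2[OF cF] simp: s_def)
    show "integrable lborel (\<lambda>x. B * indicator (cball 0 (r + norm b)) x :: real)"
      by (rule integrable_bounded_support[of _ B "r + norm b"]) (use B in \<open>auto simp: indicator_def\<close>)
  qed (use lim bd in auto)
  then show ?thesis by (simp add: h0 LIMSEQ_const_iff)
qed

text \<open>Taylor expansion of order two for the even function \<open>g t + g (- t)\<close>, whose
  first derivative vanishes at 0.\<close>

lemma second_difference_mvt:
  fixes g :: "real \<Rightarrow> real"
  assumes "\<And>t. (g has_real_derivative g1 t) (at t)" "\<And>t. (g1 has_real_derivative g2 t) (at t)" "h > 0"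
  obtains \<xi> where "0 < \<xi>" "\<xi> < h" "g h + g (- h) - 2 * g 0 = (g2 \<xi> + g2 (- \<xi>)) / 2 * h\<^sup>2"
proof -
  define d where "d m = (if m = 0 then (\<lambda>t. g t + g (- t)) else if m = 1 then (\<lambda>t. g1 t - g1 (- t))
     else (\<lambda>t. g2 t + g2 (- t)))" for m :: nat
  have neg: "((\<lambda>t. g (- t)) has_real_derivative - g1 (- t)) (at t)"
     "((\<lambda>t. g1 (- t)) has_real_derivative - g2 (- t)) (at t)" for t
    using DERIV_chain2[OF assms(1) DERIV_minus[OF DERIV_ident]] 
      DERIV_chain2[OF assms(2) DERIV_minus[OF DERIV_ident]] by simp_all
  have "DERIV (d m) t :> d (Suc m) t" if "m < 2" for m t
    using that DERIV_add[OF assms(1) neg(1)] DERIV_diff[OF assms(2) neg(2)]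
    by (auto simp: d_def less_2_cases_iff)
  then obtain t where "0 < t" "t < h" "d 0 h = (\<Sum>m<2. d m 0 / fact m * h ^ m) + d 2 t / fact 2 * h ^ 2"
    using Maclaurin[of h 2 d "d 0"] assms(3) by auto
  then show ?thesis using that[of t] by (simp add: d_def numeral_2_eq_2)
qed

text \<open>All differences fall on \<open>\<psi>\<close>, so \<open>v\<close> enters only as a
  bounded measurable factor. In this way the sign of second differences of a mollification reaches
  the distributional second derivatives of \<open>v\<close>.\<close>

lemma integral_second_difference_tendsto:
  fixes v \<psi> :: "'a::euclidean_space \<Rightarrow> real"
  assumes v: "v \<in> borel_measurable borel" "\<And>x. \<bar>v x\<bar> \<le> C"
    and \<psi>: "C_on 2 UNIV \<psi>" and K: "compact K" "\<And>x. x \<notin> K \<Longrightarrow> \<psi> x = 0"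
    and b: "b \<in> Basis"
  shows "(\<lambda>n. LBINT y. v y * ((\<psi> (y + inverse (real (Suc n)) *\<^sub>R b)
              + \<psi> (y - inverse (real (Suc n)) *\<^sub>R b) - 2 * \<psi> y) / (inverse (real (Suc n)))\<^sup>2))
     \<longlonglongrightarrow> (LBINT y. v y * partial_deriv b (partial_deriv b \<psi>) y)"
proof -
  define g2 where "g2 = partial_deriv b (partial_deriv b \<psi>)"
  define s where "s n = inverse (real (Suc n))" for n
  have s: "s n > 0" "s n \<le> 1" for n by (auto simp: s_def field_simps)
  have C2: "C_on (Suc (Suc 0)) UNIV \<psi>" using \<psi> by (simp add: numeral_2_eq_2)
  have c2: "continuous_on UNIV g2" unfolding g2_def
    by (rule continuous_on_partial_deriv2[OF C2 b b])
  have c0: "continuous_on UNIV \<psi>" using C_on_imp_continuous_on[OF C2] .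
  have d: "((\<lambda>t. f (y + t *\<^sub>R b)) has_real_derivative partial_deriv b f (y + t *\<^sub>R b)) (at t)"
    if "C_on (Suc 0) UNIV f" for f t y
  proof -
    have D: "(f has_derivative (\<lambda>h. partial_deriv h f x)) (at x)" for x
      using C_on_has_derivative[OF that] by simp
    interpret linear "\<lambda>h. partial_deriv h f (y + t *\<^sub>R b)" using D by (rule has_derivative_linear)
    have "((\<lambda>t. f (y + t *\<^sub>R b)) has_derivative (\<lambda>h. partial_deriv (h *\<^sub>R b) f (y + t *\<^sub>R b))) (at t)"
      by (rule has_derivative_compose[OF _ D]) (auto intro!: derivative_eq_intros)
    then show ?thesis by (simp add: has_field_derivative_def scaleR mult_commute_abs)
  qed
  note d = d[OF C_on_Suc_lower[OF C2]] d[OF C_on_partial_deriv[OF C2 b]]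
  have oK: "open (- K)" using compact_imp_closed[OF K(1)] by auto
  have g1_0: "partial_deriv b \<psi> x = 0" if "x \<notin> K" for x
    using partial_deriv_zero_open[OF oK, of x \<psi> b] that K(2) by auto
  have g2_0: "g2 x = 0" if "x \<notin> K" for x
    using partial_deriv_zero_open[OF oK, of x "partial_deriv b \<psi>" b] that g1_0 by (auto simp: g2_def)
  obtain B r where B: "B \<ge> 0" "\<And>x. \<bar>g2 x\<bar> \<le> B" "r > 0" "K \<subseteq> cball 0 r"
    using compact_support_bounds[OF c2 K(1) g2_0] by metis
  define h where "h n y = (\<psi> (y + s n *\<^sub>R b) + \<psi> (y - s n *\<^sub>R b) - 2 * \<psi> y) / (s n)\<^sup>2" for n y
  have ex: "\<exists>\<xi>. 0 < \<xi> \<and> \<xi> < s n \<and> h n y = (g2 (y + \<xi> *\<^sub>R b) + g2 (y - \<xi> *\<^sub>R b)) / 2" for n y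
  proof -
    obtain \<xi> where "0 < \<xi>" "\<xi> < s n" and
      e: "\<psi> (y + s n *\<^sub>R b) + \<psi> (y + - s n *\<^sub>R b) - 2 * \<psi> (y + 0 *\<^sub>R b) =
        (partial_deriv b (partial_deriv b \<psi>) (y + \<xi> *\<^sub>R b)
          + partial_deriv b (partial_deriv b \<psi>) (y + - \<xi> *\<^sub>R b)) / 2 * (s n)\<^sup>2"
      by (rule second_difference_mvt[OF d(1)[of y] d(2)[of y] s(1)[of n]])
    then show ?thesis
      using s(1)[of n] by (intro exI[of _ \<xi>]) (simp add: h_def g2_def)
  qed
  then obtain \<xi> where \<xi>: "\<And>n y. 0 < \<xi> n y" "\<And>n y. \<xi> n y < s n"
     "\<And>n y. h n y = (g2 (y + \<xi> n y *\<^sub>R b) + g2 (y - \<xi> n y *\<^sub>R b)) / 2"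
    by metis
  have lim: "(\<lambda>n. h n y) \<longlonglongrightarrow> g2 y" for y
  proof -
    have "s \<longlonglongrightarrow> 0" unfolding s_def by (rule LIMSEQ_inverse_real_of_nat)
    then have "(\<lambda>n. \<xi> n y) \<longlonglongrightarrow> 0"
      by (rule tendsto_sandwich[OF _ _ tendsto_const, rotated -1])
        (use \<xi> in \<open>auto intro!: always_eventually less_imp_le\<close>)
    moreover have "isCont g2 z" for z
      using c2 by (simp add: continuous_on_eq_continuous_at)
    ultimately have "(\<lambda>n. (g2 (y + \<xi> n y *\<^sub>R b) + g2 (y - \<xi> n y *\<^sub>R b)) / 2) \<longlonglongrightarrow>
         (g2 (y + 0 *\<^sub>R b) + g2 (y - 0 *\<^sub>R b)) / 2"
      by (intro tendsto_intros isCont_tendsto_compose[of _ g2]) auto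
    then show ?thesis by (simp add: \<xi>(3))
  qed
  have bd: "\<bar>h n y\<bar> \<le> B * indicator (cball 0 (r + norm b)) y" for n y
  proof -
    have "\<bar>h n y\<bar> \<le> B" unfolding \<xi>(3) using B(2)[of "y + \<xi> n y *\<^sub>R b"] B(2)[of "y - \<xi> n y *\<^sub>R b"]
      by (auto simp: abs_le_iff field_simps)
    moreover have "h n y = 0" if "y \<notin> cball 0 (r + norm b)"
    proof -
      have n: "norm y > r + norm b" using that by auto
      have "norm (s n *\<^sub>R b) \<le> norm b" using s[of n] by (auto intro: mult_left_le_one_le)
      then have "norm (y + s n *\<^sub>R b) > r" "norm (y - s n *\<^sub>R b) > r" "norm y > r"
        using n norm_diff_ineq[of y "s n *\<^sub>R b"] norm_triangle_ineq2[of y "s n *\<^sub>R b"] norm_ge_zero[of b] by linarith+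
      then have "\<psi> (y + s n *\<^sub>R b) = 0" "\<psi> (y - s n *\<^sub>R b) = 0" "\<psi> y = 0"
        using K(2)[of y] K(2)[of "y + s n *\<^sub>R b"] K(2)[of "y - s n *\<^sub>R b"] B(4) by force+
      then show ?thesis by (simp add: h_def)
    qed
    ultimately show ?thesis by (auto simp: indicator_def)
  qed
  have "(\<lambda>n. LBINT y. v y * h n y) \<longlonglongrightarrow> (LBINT y. v y * g2 y)"
  proof (rule integral_dominated_convergence[where w = "\<lambda>y. C * (B * indicator (cball 0 (r + norm b)) y)"])
    show "(\<lambda>y. v y * g2 y) \<in> borel_measurable lborel"
      using borel_measurable_continuous_onI[OF c2] v(1) by simp
    show "(\<lambda>y. v y * h n y) \<in> borel_measurable lborel" for n
    proof -
      have "continuous_on UNIV (h n)" unfolding h_def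
        by (auto intro!: continuous_intros continuous_on_compose2[OF c0] simp: s_def)
      from borel_measurable_continuous_onI[OF this] show ?thesis using v(1) by simp
    qed
    show "integrable lborel (\<lambda>y. C * (B * indicator (cball 0 (r + norm b)) y) :: real)"
      by (rule integrable_bounded_support[of _ "\<bar>C\<bar> * B" "r + norm b"]) 
        (use B in \<open>auto simp: indicator_def abs_mult\<close>)
    show "AE y in lborel. norm (v y * h n y) \<le> C * (B * indicator (cball 0 (r + norm b)) y)" for n
      using mult_mono[OF v(2) bd[of n]] order_trans[OF abs_ge_zero v(2)] by (auto simp: abs_mult)
  qed (use lim in \<open>auto intro!: tendsto_intros\<close>)
  then show ?thesis by (simp add: h_def s_def g2_def)
qed

text \<open>For each direction \<open>b\<close> the function
  \<open>F = h \<partial>\<phi> - \<partial>h \<phi>\<close> is C^1 on the whole space, because it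
  vanishes off the support of \<open>\<phi>\<close>, whatever \<open>h\<close> does outside
  \<open>D\<close>. In its derivative the mixed terms cancel, and the integral of that derivative is
  0.\<close>

lemma green_identity:
  fixes h \<phi> :: "'a::euclidean_space \<Rightarrow> real"
  assumes D: "open D" and h: "C_on 2 D h" and \<phi>: "\<phi> \<in> test_functions D"
  shows "(LBINT x:D. h x * laplacian \<phi> x) = (LBINT x:D. laplacian h x * \<phi> x)"
proof -
  note supp = test_functions_supp[OF \<phi>]
  have h2: "C_on (Suc (Suc 0)) D h" using h by (simp add: numeral_2_eq_2)
  have \<phi>2: "C_on (Suc (Suc 0)) UNIV \<phi>" "C_on (Suc (Suc 0)) D \<phi>"
    using test_functions_C_on[OF \<phi>] C_on_subset[OF test_functions_C_on[OF \<phi>] subset_UNIV] by blast+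
  have U: "D \<union> - supp \<phi> = UNIV" using supp by auto
  have z: "(LBINT x. h x * partial_deriv b (partial_deriv b \<phi>) x
            - partial_deriv b (partial_deriv b h) x * \<phi> x) = 0" if b: "b \<in> Basis" for b
  proof -
    define F where "F x = h x * partial_deriv b \<phi> x - partial_deriv b h x * \<phi> x" for x
    have "C_on (Suc 0) D F" unfolding F_def
      by (rule C_on_diff[OF D C_on_mult[OF D C_on_Suc_lower[OF h2] C_on_partial_deriv[OF \<phi>2(2) b]]
            C_on_mult[OF D C_on_partial_deriv[OF h2 b] C_on_Suc_lower[OF \<phi>2(2)]]])
    moreover have "C_on (Suc 0) (- supp \<phi>) F"
      by (rule C_on_cong[OF open_not_supp _ C_on_const[OF open_not_supp]]) 
        (auto simp: F_def not_supp partial_deriv_not_supp)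
    ultimately have F1: "C_on (Suc 0) UNIV F"
      using C_on_Un[OF D open_not_supp] U by metis
    have eq: "partial_deriv b F x = h x * partial_deriv b (partial_deriv b \<phi>) x
            - partial_deriv b (partial_deriv b h) x * \<phi> x" for x
    proof (cases "x \<in> D")
      case True
      have "(F has_derivative (\<lambda>k. (h x * partial_deriv k (partial_deriv b \<phi>) x + partial_deriv k h x * partial_deriv b \<phi> x)
         - (partial_deriv b h x * partial_deriv k \<phi> x + partial_deriv k (partial_deriv b h) x * \<phi> x))) (at x)"
        unfolding F_def
        by (rule has_derivative_diff[OF
             has_derivative_mult[OF C_on_has_derivative[OF h2 True] C_on_has_derivative[OF C_on_partial_deriv[OF \<phi>2(2) b] True]]
             has_derivative_mult[OF C_on_has_derivative[OF C_on_partial_deriv[OF h2 b] True] C_on_has_derivative[OF \<phi>2(2) True]]])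
      from partial_deriv_eq[OF this] show ?thesis by (simp add: mult.commute)
    next
      case False
      then have x: "x \<in> - supp \<phi>" using supp by auto
      then have "partial_deriv b F x = 0"
        by (intro partial_deriv_zero_open[OF open_not_supp]) (auto simp: F_def not_supp partial_deriv_not_supp)
      then show ?thesis using x by (simp add: not_supp partial_deriv2_not_supp)
    qed
    have "(LBINT x. partial_deriv b F x) = 0"
      by (rule integral_derivative_zero[OF C_on_has_derivative[OF F1] continuous_on_partial_deriv[OF F1 b] supp(1)])
        (auto simp: F_def not_supp partial_deriv_not_supp)
    then show ?thesis by (simp add: eq)
  qed
  have i1: "integrable lborel (\<lambda>x. h x * partial_deriv b (partial_deriv b \<phi>) x)" if b: "b \<in> Basis" for b
    by (rule integrable_zero_extension[OF D supp(1,2)])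
      (use continuous_on_mult[OF C_on_imp_continuous_on[OF h2] continuous_on_partial_deriv2[OF \<phi>2(2) b b]] in
        \<open>simp_all add: partial_deriv2_not_supp\<close>)
  have i2: "integrable lborel (\<lambda>x. partial_deriv b (partial_deriv b h) x * \<phi> x)" if b: "b \<in> Basis" for b
    by (rule integrable_zero_extension[OF D supp(1,2)])
      (use continuous_on_mult[OF continuous_on_partial_deriv2[OF h2 b b] C_on_imp_continuous_on[OF \<phi>2(2)]] in
        \<open>simp_all add: not_supp\<close>)
  have "(LBINT x. h x * laplacian \<phi> x) = (LBINT x. laplacian h x * \<phi> x)"
    unfolding laplacian_def sum_distrib_left sum_distrib_right
    using z i1 i2 by (simp add: Bochner_Integration.integral_sum)
  moreover have "h x * laplacian \<phi> x = 0" "laplacian h x * \<phi> x = 0" if "x \<notin> D" for x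
    using that supp not_supp[of x \<phi>] laplacian_not_supp[of x \<phi>] by auto
  ultimately show ?thesis by (simp add: set_integral_supp)
qed

section \<open>The weak maximum principle\<close>

lemma continuous_on_integral_param:
  fixes f :: "'a::euclidean_space \<Rightarrow> 'b \<Rightarrow> real"
  assumes "\<And>y. continuous_on S (\<lambda>x. f x y)" "\<And>x. f x \<in> borel_measurable M"
    and "\<And>x y. x \<in> S \<Longrightarrow> \<bar>f x y\<bar> \<le> w y" "integrable M w"
  shows "continuous_on S (\<lambda>x. LINT y|M. f x y)"
proof (rule continuous_on_sequentiallyI)
  fix u a assume u: "\<forall>n. u n \<in> S" "a \<in> S" "u \<longlonglongrightarrow> a"
  show "(\<lambda>n. LINT y|M. f (u n) y) \<longlonglongrightarrow> (LINT y|M. f a y)"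
  proof (rule integral_dominated_convergence[where w = w])
    show "AE y in M. (\<lambda>n. f (u n) y) \<longlonglongrightarrow> f a y"
      using continuous_on_tendsto_compose[OF assms(1) u(3,2)] u(1) by simp
  qed (use assms u in auto)
qed

lemma integral_pos_ball:
  fixes f :: "'a::euclidean_space \<Rightarrow> real"
  assumes "continuous_on UNIV f" "integrable lborel f" "\<And>x. f x \<ge> 0" "f a > 0"
  shows "(LBINT x. f x) > 0"
proof -
  have "open {x. f x > f a / 2}"
    by (intro open_Collect_less continuous_on_const assms)
  then obtain e where e: "e > 0" "ball a e \<subseteq> {x. f x > f a / 2}"
    using assms(4) unfolding open_contains_ball by (elim ballE[where x = a]) auto
  have "0 < f a / 2 * measure lborel (ball a e)"
    using e(1) assms(4) content_ball_pos[of e a] by simp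
  also have "\<dots> = (LBINT x. f a / 2 * indicator (ball a e) x)" by simp
  also have "\<dots> \<le> (LBINT x. f x)"
  proof (rule integral_mono)
    show "integrable lborel (\<lambda>x. f a / 2 * indicator (ball a e) x)"
      using emeasure_bounded_finite[OF bounded_ball, of a e] by (auto intro: integrable_real_indicator)
  qed (use e assms in \<open>auto simp: indicator_def subset_iff less_imp_le\<close>)
  finally show ?thesis .
qed

lemma bump_translate: "bump (a - h) \<epsilon> y = bump a \<epsilon> (y + h)"
  by (simp add: bump_def algebra_simps)

lemma bump_le_1: "bump a \<epsilon> x \<le> 1"
  by (simp add: bump_def flat_exp_def)

lemma continuous_on_bump: "continuous_on UNIV (bump a \<epsilon>)"
  using C_on_imp_continuous_on[OF C_on_bump] .

lemma bump_measurable: "bump a \<epsilon> \<in> borel_measurable borel"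
  using borel_measurable_continuous_onI[OF continuous_on_bump] .

lemma integrable_bump: "\<epsilon> > 0 \<Longrightarrow> integrable lborel (bump a \<epsilon>)"
  by (rule integrable_compact_support[OF continuous_on_bump compact_cball[of a \<epsilon>]]) (auto intro: bump_zero)

lemma integral_bump: 
  fixes a :: "'a::euclidean_space"
  shows "(LBINT y. bump a \<epsilon> y) = (LBINT y. bump (0::'a) \<epsilon> y)"
  using integral_lborel_translation[OF bump_measurable, of 0 \<epsilon> "- a"]
  by (simp add: bump_def)

lemma continuous_on_bump_centre: "continuous_on UNIV (\<lambda>a. bump a \<epsilon> y)"
proof -
  have "(\<lambda>a. bump a \<epsilon> y) = bump y \<epsilon>"
    by (auto simp: bump_def norm_minus_commute)
  then show ?thesis by (simp only: continuous_on_bump)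
qed

lemma test_functions_zero:
  assumes "\<phi> \<in> test_functions D" "x \<notin> D"
  shows "\<phi> x = 0" "laplacian \<phi> x = 0"
  using assms(2) test_functions_supp(2)[OF assms(1)] not_supp[of x \<phi>] laplacian_not_supp[of x \<phi>]
  by (auto simp: subset_iff)

lemma test_function_integrable:
  fixes \<phi> g :: "'a::euclidean_space \<Rightarrow> real"
  assumes "open D" "\<phi> \<in> test_functions D" "continuous_on D g"
  shows "integrable lborel (\<lambda>x. g x * \<phi> x)" "integrable lborel (\<lambda>x. g x * laplacian \<phi> x)"
    "(LBINT x:D. g x * \<phi> x) = (LBINT x. g x * \<phi> x)"
    "(LBINT x:D. g x * laplacian \<phi> x) = (LBINT x. g x * laplacian \<phi> x)"
proof -
  note supp = test_functions_supp[OF assms(2)]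
  have C: "C_on (Suc (Suc 0)) D \<phi>"
    using C_on_subset[OF test_functions_C_on[OF assms(2)]] by blast
  show "integrable lborel (\<lambda>x. g x * \<phi> x)"
    by (rule integrable_zero_extension[OF assms(1) supp(1,2)])
      (use continuous_on_mult[OF assms(3) C_on_imp_continuous_on[OF C]] in \<open>simp_all add: not_supp\<close>)
  show "integrable lborel (\<lambda>x. g x * laplacian \<phi> x)"
    by (rule integrable_zero_extension[OF assms(1) supp(1,2)])
      (use continuous_on_mult[OF assms(3) continuous_on_laplacian[OF C]] in \<open>simp_all add: laplacian_not_supp\<close>)
  have "g x * \<phi> x = 0" "g x * laplacian \<phi> x = 0" if "x \<notin> D" for x
    using that test_functions_zero[OF assms(2)] by auto
  then show "(LBINT x:D. g x * \<phi> x) = (LBINT x. g x * \<phi> x)"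
    "(LBINT x:D. g x * laplacian \<phi> x) = (LBINT x. g x * laplacian \<phi> x)"
    by (simp_all add: set_integral_supp)
qed

lemma schroedinger_pairing:
  fixes \<phi> u q :: "'a::euclidean_space \<Rightarrow> real"
  assumes "open D" "\<phi> \<in> test_functions D" "continuous_on D u" "continuous_on D q"
  shows "(LBINT x:D. u x * (laplacian \<phi> x - q x * \<phi> x)) =
    (LBINT x. u x * laplacian \<phi> x) - (LBINT x. u x * q x * \<phi> x)"
proof -
  have "u x * (laplacian \<phi> x - q x * \<phi> x) = 0" if "x \<notin> D" for x
    using that test_functions_zero[OF assms(2)] by auto
  then have "(LBINT x:D. u x * (laplacian \<phi> x - q x * \<phi> x)) = 
      (LBINT x. u x * laplacian \<phi> x - u x * q x * \<phi> x)"
    by (subst set_integral_supp) (auto simp: algebra_simps)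
  also have "\<dots> = (LBINT x. u x * laplacian \<phi> x) - (LBINT x. u x * q x * \<phi> x)"
    using test_function_integrable[OF assms(1,2)] assms(3,4)
    by (intro Bochner_Integration.integral_diff) (auto intro: continuous_on_mult)
  finally show ?thesis .
qed

lemma laplacian_quadratic: "laplacian (\<lambda>x::'a::euclidean_space. c + m * (norm x)\<^sup>2) x = 2 * m * DIM('a)"
proof -
  have "partial_deriv b (\<lambda>x::'a. c + m * (norm x)\<^sup>2) = (\<lambda>x. 2 * m * (x \<bullet> b))" for b
  proof
    fix x :: 'a
    have "((\<lambda>x::'a. c + m * (x \<bullet> x)) has_derivative (\<lambda>h. 2 * m * (x \<bullet> h))) (at x)"
      by (auto intro!: derivative_eq_intros simp: inner_commute)
    from partial_deriv_eq[OF this] show "partial_deriv b (\<lambda>x::'a. c + m * (norm x)\<^sup>2) x = 2 * m * (x \<bullet> b)"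
      by (simp add: power2_norm_eq_inner)
  qed
  moreover have "partial_deriv b (\<lambda>x::'a. 2 * m * (x \<bullet> b)) x = 2 * m" if "b \<in> Basis" for b
  proof -
    have "((\<lambda>x::'a. 2 * m * (x \<bullet> b)) has_derivative (\<lambda>h. 2 * m * (h \<bullet> b))) (at x)"
      by (auto intro!: derivative_eq_intros)
    from partial_deriv_eq[OF this, of b] show ?thesis using that by simp
  qed
  ultimately show ?thesis by (simp add: laplacian_def)
qed

text \<open>Supplies the strict inequality in the maximum principle.\<close>

lemma integral_norm2_laplacian:
  fixes \<phi> :: "'a::euclidean_space \<Rightarrow> real"
  assumes "open D" "\<phi> \<in> test_functions D"
  shows "(LBINT x. (norm x)\<^sup>2 * laplacian \<phi> x) = 2 * DIM('a) * (LBINT x. \<phi> x)"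
proof -
  have "C_on 2 D (\<lambda>x::'a. (norm x)\<^sup>2)"
    using C_on_subset[OF C_on_norm_power2[of 2 0]] by simp
  from green_identity[OF assms(1) this assms(2)]
  have "(LBINT x:D. (norm x)\<^sup>2 * laplacian \<phi> x) = (LBINT x:D. (2 * DIM('a)) * \<phi> x)"
    by (simp add: laplacian_quadratic[of 0 1, simplified])
  then show ?thesis
    using test_function_integrable(3)[OF assms, of "\<lambda>x. 2 * DIM('a)"]
      test_function_integrable(4)[OF assms, of "\<lambda>x. (norm x)\<^sup>2"]
    by (simp add: continuous_intros)
qed

text \<open>At an interior maximum of the mollification of \<open>u + \<eta> |x|\<^sup>2\<close> all second difference quotients
  are nonpositive; in the limit this contradicts the strict positivity contributed by \<open>\<eta> |x|\<^sup>2\<close>.\<close>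

lemma weak_maximum_principle:
  fixes u q :: "'a::euclidean_space \<Rightarrow> real"
  assumes D: "open D" "bounded D"
    and u: "continuous_on (closure D) u" and q: "continuous_on D q" "\<And>x. x \<in> D \<Longrightarrow> q x \<ge> 0"
    and sub: "\<And>\<phi>. \<phi> \<in> test_functions D \<Longrightarrow> (\<And>x. \<phi> x \<ge> 0) \<Longrightarrow>
        (LBINT x:D. u x * (laplacian \<phi> x - q x * \<phi> x)) \<ge> 0"
    and bd: "\<And>x. x \<in> frontier D \<Longrightarrow> u x \<le> 0" and x0: "x0 \<in> D"
  shows "u x0 \<le> 0"
proof (rule ccontr)
  assume "\<not> u x0 \<le> 0"
  then have ux0: "u x0 > 0" by simp
  have cD: "compact (closure D)" using D(2) by (simp add: compact_closure)
  obtain r where r: "r > 0" "\<And>x. x \<in> closure D \<Longrightarrow> norm x \<le> r"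
    using bounded_closure[OF D(2)] by (auto simp: bounded_pos)
  \<comment> \<open>The levels are spaced by \<open>a\<close>: \<open>v \<le> a\<close> on the
    frontier, \<open>W\<close> lies above \<open>a\<close>, \<open>K\<close> at or above
    \<open>2 * a\<close>, and the maximum of \<open>v\<close> is at least
    \<open>v x0 \<ge> 4 * a\<close>. The gaps absorb the quadratic term, which is at most
    \<open>a\<close> by the choice of \<open>\<eta>\<close>, and the mollification error.\<close>
  define a where "a = u x0 / 4"
  have a: "a > 0" using ux0 by (simp add: a_def)
  define \<eta> where "\<eta> = a / r\<^sup>2"
  have \<eta>: "\<eta> > 0" using a r by (simp add: \<eta>_def)
  define v where "v x = u x + \<eta> * (norm x)\<^sup>2" for x
  have \<eta>r: "\<eta> * (norm x)\<^sup>2 \<le> a" "\<eta> * (norm x)\<^sup>2 \<ge> 0" if "x \<in> closure D" for x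
  proof -
    have "(norm x)\<^sup>2 \<le> r\<^sup>2" using r that by (intro power_mono) auto
    then have "\<eta> * (norm x)\<^sup>2 \<le> \<eta> * r\<^sup>2" using \<eta> by simp
    then show "\<eta> * (norm x)\<^sup>2 \<le> a" using r by (simp add: \<eta>_def)
    show "\<eta> * (norm x)\<^sup>2 \<ge> 0" using \<eta> by simp
  qed
  have cv: "continuous_on (closure D) v" unfolding v_def by (intro continuous_intros u)
  have Dsub: "D \<subseteq> closure D" by (rule closure_subset)
  obtain xs where xs: "xs \<in> closure D" "\<And>x. x \<in> closure D \<Longrightarrow> v x \<le> v xs"
    using continuous_attains_sup[OF cD _ cv] x0 Dsub by blast
  have vxs: "v xs \<ge> 4 * a" using xs(2)[of x0] x0 Dsub \<eta>r(2)[of x0] by (auto simp: v_def a_def)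
  have fr: "v x \<le> a" if "x \<in> frontier D" for x
    using bd[OF that] \<eta>r(1)[of x] that by (auto simp: v_def frontier_def)
  have inD: "x \<in> D" if "x \<in> closure D" "v x > a" for x
    using that fr[of x] D(1) by (auto simp: frontier_def interior_open)
  define W where "W = {x \<in> D. v x > a}"
  have cvD: "continuous_on D v" by (rule continuous_on_subset[OF cv Dsub])
  have oW: "open W" unfolding W_def
    using continuous_open_preimage[OF cvD D(1), of "{a<..}"] by (simp add: vimage_def Int_def conj_commute)
  have uW: "u x > 0" if "x \<in> W" for x using that \<eta>r(1)[of x] Dsub by (auto simp: W_def v_def)
  define K where "K = {x \<in> closure D. v x \<ge> 2 * a}"
  have cK: "compact K"
  proof -
    have "closed K" unfolding K_def
      using continuous_closed_preimage[OF cv closed_closure, of "{2 * a..}"] by (simp add: vimage_def Int_def conj_commute)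
    then show ?thesis
      using compact_Int_closed[OF cD, of K] by (simp add: K_def Int_absorb1 Int_def)
  qed
  have KW: "K \<subseteq> W" using inD a by (auto simp: K_def W_def)
  have xsK: "xs \<in> K" using xs vxs a by (auto simp: K_def)
  obtain e where e: "e > 0" "(\<Union>x\<in>K. cball x e) \<subseteq> W"
    using compact_subset_open_imp_cball_epsilon_subset[OF cK oW KW] by blast
  have "uniformly_continuous_on (closure D) v" by (rule compact_uniformly_continuous[OF cv cD])
  then obtain \<delta> where \<delta>: "\<delta> > 0" "\<And>x y. x \<in> closure D \<Longrightarrow> y \<in> closure D \<Longrightarrow> dist y x < \<delta> \<Longrightarrow> dist (v y) (v x) < a / 2"
    using a unfolding uniformly_continuous_on_def by (metis half_gt_zero)
  \<comment> \<open>\<open>e\<close> keeps the support of a bump centred in \<open>K\<close> inside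
    \<open>W\<close>; \<open>\<delta>\<close> keeps \<open>v\<close> on that support within
    \<open>a / 2\<close> of its value at the centre.\<close>
  define \<epsilon> where "\<epsilon> = min e \<delta>"
  have \<epsilon>: "\<epsilon> > 0" using e \<delta> by (simp add: \<epsilon>_def)
  have cbW: "cball x \<epsilon> \<subseteq> W" if "x \<in> K" for x
    using that e(2) by (fastforce simp: \<epsilon>_def)
  define V where "V y = indicator (closure D) y * v y" for y
  have Vm: "V \<in> borel_measurable borel"
    using borel_measurable_continuous_on_indicator[OF _ cv] by (simp add: V_def[abs_def])
  obtain C where C: "C > 0" "\<And>y. \<bar>V y\<bar> \<le> C"
  proof -
    have "bounded (v ` closure D)" by (intro compact_imp_bounded compact_continuous_image cv cD)
    then obtain C where "C > 0" "\<And>y. y \<in> closure D \<Longrightarrow> \<bar>v y\<bar> \<le> C" by (auto simp: bounded_pos)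
    then show ?thesis using that[of C] by (auto simp: V_def indicator_def)
  qed
  define c where "c = (LBINT y. bump (0::'a) \<epsilon> y)"
  have c: "c > 0" unfolding c_def
    by (rule integral_pos_ball[where a=0])
      (use \<epsilon> in \<open>auto intro: continuous_on_bump integrable_bump bump_nonneg simp: bump_pos_iff\<close>)
  have iVb: "integrable lborel (\<lambda>y. V y * bump x \<epsilon> y)" for x
  proof (rule integrable_bounded_support[where B = "C * 1" and r = r])
    show "(\<lambda>y. V y * bump x \<epsilon> y) \<in> borel_measurable borel" using Vm bump_measurable[of x \<epsilon>] by simp
    show "\<bar>V y * bump x \<epsilon> y\<bar> \<le> C * 1" for y
      unfolding abs_mult using C bump_nonneg[of x \<epsilon> y] bump_le_1[of x \<epsilon> y] by (intro mult_mono) auto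
  qed (use r in \<open>auto simp: V_def indicator_def\<close>)
  define M where "M x = (LBINT y. V y * bump x \<epsilon> y)" for x
  have cM: "continuous_on UNIV M" unfolding M_def
  proof (rule continuous_on_integral_param[where w = "\<lambda>y. C * indicator (cball 0 r) y"])
    show "\<bar>V y * bump x \<epsilon> y\<bar> \<le> C * indicator (cball 0 r) y" for x y
    proof (cases "y \<in> cball 0 r")
      case True
      then show ?thesis
        unfolding abs_mult using C bump_nonneg[of x \<epsilon> y] bump_le_1[of x \<epsilon> y] 
         mult_mono[OF C(2)[of y], of "bump x \<epsilon> y" 1] by auto
    next
      case False
      then show ?thesis using r by (auto simp: V_def indicator_def)
    qed
    show "integrable lborel (\<lambda>y. C * indicator (cball 0 r) y :: real)"
      by (rule integrable_bounded_support[of _ C r]) (use C in \<open>auto simp: indicator_def\<close>)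
    show "(\<lambda>y. V y * bump x \<epsilon> y) \<in> borel_measurable lborel" for x
      using Vm bump_measurable[of x \<epsilon>] by simp
    show "continuous_on UNIV (\<lambda>x. V y * bump x \<epsilon> y)" for y
      by (intro continuous_on_mult continuous_on_const continuous_on_bump_centre)
  qed
  have near: "\<bar>M x - c * v x\<bar> \<le> c * (a / 2)" if x: "x \<in> K" for x
  proof -
    have "M x - c * v x = (LBINT y. V y * bump x \<epsilon> y - v x * bump x \<epsilon> y)"
      using iVb integrable_bump[OF \<epsilon>, of x] integral_bump[of x \<epsilon>]
      by (simp add: M_def c_def Bochner_Integration.integral_diff mult.commute)
    also have "\<bar>\<dots>\<bar> \<le> (LBINT y. \<bar>V y * bump x \<epsilon> y - v x * bump x \<epsilon> y\<bar>)"
      by (rule integral_abs_bound)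
    also have "\<dots> \<le> (LBINT y. a / 2 * bump x \<epsilon> y)"
    proof (rule integral_mono)
      show "integrable lborel (\<lambda>y. \<bar>V y * bump x \<epsilon> y - v x * bump x \<epsilon> y\<bar>)"
        using iVb integrable_bump[OF \<epsilon>, of x] by auto
      show "integrable lborel (\<lambda>y. a / 2 * bump x \<epsilon> y)" using integrable_bump[OF \<epsilon>, of x] by auto
      show "\<bar>V y * bump x \<epsilon> y - v x * bump x \<epsilon> y\<bar> \<le> a / 2 * bump x \<epsilon> y" for y
      proof (cases "y \<in> ball x \<epsilon>")
        case True
        then have "y \<in> W" using cbW[OF x] by auto
        then have y: "y \<in> closure D" using Dsub by (auto simp: W_def)
        moreover have "x \<in> closure D" using x by (simp add: K_def)
        ultimately have "\<bar>V y - v x\<bar> \<le> a / 2"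
          using \<delta>(2)[of x y] True by (auto simp: V_def dist_real_def \<epsilon>_def dist_commute)
        then have "\<bar>V y - v x\<bar> * bump x \<epsilon> y \<le> a / 2 * bump x \<epsilon> y"
          by (rule mult_right_mono) (rule bump_nonneg)
        then show ?thesis using bump_nonneg[of x \<epsilon> y] by (simp add: left_diff_distrib[symmetric] abs_mult)
      next
        case False
        then show ?thesis using bump_zero[OF \<epsilon> False] by simp
      qed
    qed
    also have "\<dots> = c * (a / 2)" using integral_bump[of x \<epsilon>] by (simp add: c_def)
    finally show ?thesis .
  qed
  obtain xh where xh: "xh \<in> K" "\<And>x. x \<in> K \<Longrightarrow> M x \<le> M xh"
    using continuous_attains_sup[OF cK _ continuous_on_subset[OF cM]] xsK by blast
  have "c * v xs - c * (a / 2) \<le> c * v xh + c * (a / 2)"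
    using near[OF xsK] near[OF xh(1)] xh(2)[OF xsK] by linarith
  then have "c * (v xs - a) \<le> c * v xh" by (simp add: algebra_simps)
  then have "v xs - a \<le> v xh" using c by simp
  then have vxh: "v xh > 2 * a" using vxs a by linarith
  \<comment> \<open>\<open>xh\<close> maximises \<open>M\<close> on \<open>K\<close> only. As
    \<open>M\<close> differs from \<open>c * v\<close> by at most \<open>c * (a / 2)\<close> on
    \<open>K\<close>, \<open>v xh\<close> is at least \<open>3 * a\<close>; so a ball around
    \<open>xh\<close> lies in \<open>K\<close>, and small shifts may be compared with
    \<open>xh\<close>.\<close>
  define U where "U = {x \<in> D. v x > 2 * a}"
  have "open U" unfolding U_def
    using continuous_open_preimage[OF cvD D(1), of "{2 * a<..}"] by (simp add: vimage_def Int_def conj_commute)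
  moreover have "xh \<in> U" using xh(1) KW vxh by (auto simp: U_def W_def)
  ultimately obtain \<rho> where \<rho>: "\<rho> > 0" "ball xh \<rho> \<subseteq> U" using open_contains_ball by metis
  have UK: "U \<subseteq> K" using Dsub by (auto simp: U_def K_def)
  define \<psi> where "\<psi> = bump xh \<epsilon>"
  have \<psi>t: "\<psi> \<in> test_functions D" unfolding \<psi>_def
    using cbW[OF xh(1)] by (intro bump_test_function \<epsilon> D) (auto simp: W_def)
  have \<psi>0: "\<psi> x \<ge> 0" for x by (simp add: \<psi>_def bump_nonneg)
  \<comment> \<open>A shifted \<open>\<psi>\<close> is a bump with shifted centre. Pairing
    \<open>V\<close> with a second difference of \<open>\<psi>\<close> thus gives a second
    difference of \<open>M\<close> at its maximum \<open>xh\<close>.\<close>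
  have neg: "(LBINT y. V y * partial_deriv b (partial_deriv b \<psi>) y) \<le> 0" if b: "b \<in> Basis" for b
  proof (rule tendsto_upperbound[OF integral_second_difference_tendsto[OF Vm C(2) _ compact_cball[of xh \<epsilon>] _ b]])
    show "C_on 2 UNIV \<psi>" by (simp only: \<psi>_def C_on_bump)
    show "\<psi> x = 0" if "x \<notin> cball xh \<epsilon>" for x
      using that bump_zero[OF \<epsilon>, of x xh] by (auto simp: \<psi>_def)
    have "(\<lambda>n. inverse (real (Suc n))) \<longlonglongrightarrow> 0" by (rule LIMSEQ_inverse_real_of_nat)
    then have "\<forall>\<^sub>F n in sequentially. inverse (real (Suc n)) < \<rho>"
      using \<rho>(1) by (rule order_tendstoD)
    then show "\<forall>\<^sub>F n in sequentially. (LBINT y. V y * ((\<psi> (y + inverse (real (Suc n)) *\<^sub>R b)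
              + \<psi> (y - inverse (real (Suc n)) *\<^sub>R b) - 2 * \<psi> y) / (inverse (real (Suc n)))\<^sup>2)) \<le> 0"
    proof eventually_elim
      case (elim n)
      define t where "t = inverse (real (Suc n))"
      have t: "t > 0" "t < \<rho>" using elim by (auto simp: t_def)
      have "norm b = 1" using b by simp
      then have "xh - t *\<^sub>R b \<in> K" "xh + t *\<^sub>R b \<in> K"
        using \<rho>(2) UK t by (auto simp: subset_iff dist_norm)
      then have le: "M (xh - t *\<^sub>R b) \<le> M xh" "M (xh + t *\<^sub>R b) \<le> M xh" using xh(2) by auto
      have eq1: "\<psi> (y + t *\<^sub>R b) = bump (xh - t *\<^sub>R b) \<epsilon> y" for y
        by (simp add: \<psi>_def bump_translate)
      have eq2: "\<psi> (y - t *\<^sub>R b) = bump (xh + t *\<^sub>R b) \<epsilon> y" for y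
        using bump_translate[of xh "- (t *\<^sub>R b)" \<epsilon> y] by (simp add: \<psi>_def)
      have "(LBINT y. V y * ((\<psi> (y + t *\<^sub>R b) + \<psi> (y - t *\<^sub>R b) - 2 * \<psi> y) / t\<^sup>2)) =
        (LBINT y. (V y * bump (xh - t *\<^sub>R b) \<epsilon> y + V y * bump (xh + t *\<^sub>R b) \<epsilon> y - 2 * (V y * bump xh \<epsilon> y)) / t\<^sup>2)"
        unfolding eq1 eq2 by (simp add: \<psi>_def algebra_simps)
      also have "\<dots> = (M (xh - t *\<^sub>R b) + M (xh + t *\<^sub>R b) - 2 * M xh) / t\<^sup>2"
        using iVb by (simp add: M_def Bochner_Integration.integral_diff)
      also have "\<dots> \<le> 0" using le by (intro divide_nonpos_nonneg) auto
      finally show ?case by (simp add: t_def)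
    qed
  qed simp
  have C2: "C_on (Suc (Suc 0)) UNIV \<psi>" unfolding \<psi>_def by (rule C_on_bump)
  have i: "integrable lborel (\<lambda>y. V y * partial_deriv b (partial_deriv b \<psi>) y)" if b: "b \<in> Basis" for b
  proof -
    have "integrable lborel (\<lambda>y. v y * partial_deriv b (partial_deriv b \<psi>) y)"
      by (rule integrable_zero_extension[OF D(1) test_functions_supp(1,2)[OF \<psi>t]])
       (use continuous_on_mult[OF cvD continuous_on_subset[OF continuous_on_partial_deriv2[OF C2 b b]]] 
         in \<open>simp_all add: partial_deriv2_not_supp\<close>)
    moreover have "(\<lambda>y. V y * partial_deriv b (partial_deriv b \<psi>) y) = (\<lambda>y. v y * partial_deriv b (partial_deriv b \<psi>) y)"
    proof
      fix y show "V y * partial_deriv b (partial_deriv b \<psi>) y = v y * partial_deriv b (partial_deriv b \<psi>) y"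
        using test_functions_supp(2)[OF \<psi>t] Dsub
        by (cases "y \<in> supp \<psi>") (auto simp: V_def subset_iff partial_deriv2_not_supp)
    qed
    ultimately show ?thesis by simp
  qed
  have "(LBINT y. V y * laplacian \<psi> y) \<le> 0"
    unfolding laplacian_def sum_distrib_left using i neg by (simp add: Bochner_Integration.integral_sum sum_nonpos)
  moreover have "(LBINT y. V y * laplacian \<psi> y) = (LBINT y. u y * laplacian \<psi> y + \<eta> * ((norm y)\<^sup>2 * laplacian \<psi> y))"
  proof (rule Bochner_Integration.integral_cong[OF refl])
    fix y show "V y * laplacian \<psi> y = u y * laplacian \<psi> y + \<eta> * ((norm y)\<^sup>2 * laplacian \<psi> y)"
      using test_functions_supp(2)[OF \<psi>t] Dsub laplacian_not_supp[of y \<psi>]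
      by (cases "y \<in> supp \<psi>") (auto simp: V_def v_def subset_iff algebra_simps)
  qed
  moreover have cuD: "continuous_on D u" by (rule continuous_on_subset[OF u Dsub])
  moreover have "(LBINT y. u y * laplacian \<psi> y + \<eta> * ((norm y)\<^sup>2 * laplacian \<psi> y)) = 
     (LBINT y. u y * laplacian \<psi> y) + \<eta> * (2 * DIM('a) * (LBINT x. \<psi> x))"
    using test_function_integrable(2)[OF D(1) \<psi>t cuD] test_function_integrable(2)[OF D(1) \<psi>t, of "\<lambda>y. (norm y)\<^sup>2"]
     integral_norm2_laplacian[OF D(1) \<psi>t]
    by (simp add: continuous_intros)
  moreover have "(LBINT x. \<psi> x) > 0" using c integral_bump[of xh \<epsilon>] by (simp add: \<psi>_def c_def)
  then have "\<eta> * (2 * DIM('a) * (LBINT x. \<psi> x)) > 0"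
    using \<eta> DIM_positive[where 'a = 'a] by (intro mult_pos_pos) auto
  ultimately have "(LBINT y. u y * laplacian \<psi> y) < 0"
    by linarith
  moreover have "(LBINT y. u y * laplacian \<psi> y) - (LBINT y. u y * q y * \<psi> y) \<ge> 0"
    using sub[OF \<psi>t \<psi>0] schroedinger_pairing[OF D(1) \<psi>t cuD q(1)] by simp
  \<comment> \<open>\<open>\<psi>\<close> lives in \<open>W\<close>, where \<open>u > 0\<close>. So
    the potential term has a sign, and the subsolution inequality contradicts the strict inequality
    just obtained.\<close>
  moreover have "(LBINT y. u y * q y * \<psi> y) \<ge> 0"
  proof (rule Bochner_Integration.integral_nonneg)
    fix y show "u y * q y * \<psi> y \<ge> 0"
    proof (cases "y \<in> ball xh \<epsilon>")
      case True
      then have "y \<in> W" using cbW[OF xh(1)] by auto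
      then show ?thesis using uW[of y] q(2)[of y] \<psi>0[of y] by (auto simp: W_def)
    next
      case False
      then show ?thesis using bump_zero[OF \<epsilon> False] by (simp add: \<psi>_def)
    qed
  qed
  ultimately show False by linarith
qed

section \<open>Weak solutions and the a priori bound\<close>

definition weak_solution ::
  "('a::euclidean_space \<Rightarrow> real) \<Rightarrow> 'a set \<Rightarrow> ('a \<Rightarrow> real) \<Rightarrow> ('a \<Rightarrow> real) \<Rightarrow> bool" where
  "weak_solution q D f u \<longleftrightarrow> (\<forall>\<phi>\<in>test_functions D.
     (LBINT x:D. u x * (laplacian \<phi> x - q x * \<phi> x)) = - (LBINT x:D. f x * \<phi> x))"

text \<open>One coefficient \<open>c\<close> serves sums and differences alike; this is the origin
  of the terms \<open>+ 1 *\<close> and \<open>+ - 1 *\<close> below.\<close>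

lemma weak_solution_linear:
  assumes "open D" "continuous_on D q" "continuous_on D u" "continuous_on D v"
    "continuous_on D f" "continuous_on D g" "weak_solution q D f u" "weak_solution q D g v"
  shows "weak_solution q D (\<lambda>x. f x + c * g x) (\<lambda>x. u x + c * v x)"
  unfolding weak_solution_def
proof
  fix \<phi> assume \<phi>: "\<phi> \<in> test_functions D"
  note ti = test_function_integrable[OF assms(1) \<phi>]
  note sp = schroedinger_pairing[OF assms(1) \<phi> _ assms(2)]
  have cu: "continuous_on D (\<lambda>x. u x + c * v x)" "continuous_on D (\<lambda>x. f x + c * g x)"
     "continuous_on D (\<lambda>x. u x * q x)" "continuous_on D (\<lambda>x. v x * q x)"
    by (intro continuous_intros assms)+
  have "(LBINT x:D. (u x + c * v x) * (laplacian \<phi> x - q x * \<phi> x)) =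
    (LBINT x. u x * laplacian \<phi> x + c * (v x * laplacian \<phi> x)) - (LBINT x. u x * q x * \<phi> x + c * (v x * q x * \<phi> x))"
    unfolding sp[OF cu(1)] by (simp add: algebra_simps)
  also have "\<dots> = (LBINT x:D. u x * (laplacian \<phi> x - q x * \<phi> x)) + c * (LBINT x:D. v x * (laplacian \<phi> x - q x * \<phi> x))"
    unfolding sp[OF assms(3)] sp[OF assms(4)]
    using ti(2)[OF assms(3)] ti(2)[OF assms(4)] ti(1)[OF cu(3)] ti(1)[OF cu(4)] by (simp add: algebra_simps)
  also have "\<dots> = - (LBINT x:D. f x * \<phi> x) - c * (LBINT x:D. g x * \<phi> x)"
    using assms(7,8) \<phi> by (simp add: weak_solution_def)
  also have "\<dots> = - (LBINT x:D. (f x + c * g x) * \<phi> x)"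
    unfolding ti(3)[OF cu(2)] ti(3)[OF assms(5)] ti(3)[OF assms(6)]
    using ti(1)[OF assms(5)] ti(1)[OF assms(6)] by (simp add: algebra_simps)
  finally show "(LBINT x:D. (u x + c * v x) * (laplacian \<phi> x - q x * \<phi> x)) = - (LBINT x:D. (f x + c * g x) * \<phi> x)" .
qed

lemma classical_weak_solution:
  assumes "open D" "continuous_on D q" "C_on 2 D h"
  shows "weak_solution q D (\<lambda>x. q x * h x - laplacian h x) h"
  unfolding weak_solution_def
proof
  fix \<phi> assume \<phi>: "\<phi> \<in> test_functions D"
  note ti = test_function_integrable[OF assms(1) \<phi>]
  have c: "continuous_on D h" "continuous_on D (laplacian h)" "continuous_on D (\<lambda>x. q x * h x)"
    "continuous_on D (\<lambda>x. q x * h x - laplacian h x)"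
    using C_on_imp_continuous_on[OF assms(3)] continuous_on_laplacian[OF assms(3)[unfolded numeral_2_eq_2]] assms(2)
    by (auto intro!: continuous_intros)
  have "(LBINT x:D. (q x * h x - laplacian h x) * \<phi> x) = (LBINT x. q x * h x * \<phi> x) - (LBINT x. laplacian h x * \<phi> x)"
    unfolding ti(3)[OF c(4)] unfolding left_diff_distrib
    by (rule Bochner_Integration.integral_diff[OF ti(1)[OF c(3)] ti(1)[OF c(2)]])
  then show "(LBINT x:D. h x * (laplacian \<phi> x - q x * \<phi> x)) = - (LBINT x:D. (q x * h x - laplacian h x) * \<phi> x)"
    using green_identity[OF assms(1,3) \<phi>] ti(4)[OF c(1)] ti(3)[OF c(2)]
    unfolding schroedinger_pairing[OF assms(1) \<phi> c(1) assms(2)] by (simp add: mult.commute[of "q _"])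
qed

text \<open>Comparison with the barrier \<open>B x = M * (r\<^sup>2 - |x|\<^sup>2)\<close>. Its
  Laplacian \<open>- 2 * M * DIM('a)\<close> is at most \<open>- M\<close>, and
  \<open>q * B \<ge> 0\<close>, so \<open>u - B\<close> is a subsolution whatever \<open>q\<close>
  is. The bound does not involve \<open>q\<close>, which later permits steps of equal size in the
  potential.\<close>

lemma weak_solution_bound_above:
  fixes u q :: "'a::euclidean_space \<Rightarrow> real"
  assumes D: "open D" "D \<subseteq> cball 0 r"
    and u: "continuous_on (closure D) u" and q: "continuous_on D q" "\<And>x. x \<in> D \<Longrightarrow> q x \<ge> 0"
    and f: "continuous_on D f" "\<And>x. x \<in> D \<Longrightarrow> \<bar>f x\<bar> \<le> M" and M: "M \<ge> 0"
    and w: "weak_solution q D f u"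
    and bd: "\<And>x. x \<in> frontier D \<Longrightarrow> u x \<le> 0" and x0: "x0 \<in> D"
  shows "u x0 \<le> M * r\<^sup>2"
proof -
  have bD: "bounded D" using D(2) bounded_subset bounded_cball by blast
  have cl: "closure D \<subseteq> cball 0 r" using D(2) by (simp add: closure_minimal)
  define B where "B x = M * r\<^sup>2 + - M * (norm x)\<^sup>2" for x :: 'a
  have B: "B x \<ge> 0" if "x \<in> closure D" for x
  proof -
    have "(norm x)\<^sup>2 \<le> r\<^sup>2" using cl that by (intro power_mono) auto
    then show ?thesis using M by (simp add: B_def mult_left_mono)
  qed
  have LB: "laplacian B x = - 2 * M * DIM('a)" for x
    unfolding B_def laplacian_quadratic by simp
  have CB: "C_on 2 D B" unfolding B_def
    using C_on_subset[OF C_on_norm_power2[of 2 0], of D] D(1) by (intro C_on_add C_on_const C_on_cmult) simp_all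
  have cB: "continuous_on S B" for S unfolding B_def by (intro continuous_intros)
  have cuD: "continuous_on D u" by (rule continuous_on_subset[OF u closure_subset])
  define F where "F x = f x + - 1 * (q x * B x - laplacian B x)" for x
  have cF: "continuous_on D F" unfolding F_def LB by (intro continuous_intros f q cB)
  have wF: "weak_solution q D F (\<lambda>x. u x + - 1 * B x)"
    unfolding F_def
    by (intro weak_solution_linear D q cuD cB f w classical_weak_solution CB) (simp add: LB continuous_intros q cB)
  have F: "F x \<le> 0" if "x \<in> D" for x
  proof -
    have "M * 1 \<le> M * (2 * DIM('a))" using M DIM_positive[where 'a='a] by (intro mult_left_mono) linarith+
    moreover have "q x * B x \<ge> 0" using q(2)[OF that] B[of x] closure_subset[of D] that by auto
    ultimately show ?thesis using f(2)[OF that] by (simp add: F_def LB)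
  qed
  have "u x0 + - 1 * B x0 \<le> 0"
  proof (rule weak_maximum_principle[OF D(1) bD _ q])
    show "continuous_on (closure D) (\<lambda>x. u x + - 1 * B x)" by (intro continuous_intros u cB)
    show "u x + - 1 * B x \<le> 0" if "x \<in> frontier D" for x
      using bd[OF that] B[of x] that by (auto simp: frontier_def)
  next
    fix \<phi> assume \<phi>: "\<phi> \<in> test_functions D" "\<And>x. 0 \<le> \<phi> x"
    have "(LBINT x. - (F x * \<phi> x)) \<ge> 0"
    proof (rule Bochner_Integration.integral_nonneg)
      fix x show "- (F x * \<phi> x) \<ge> 0"
        using mult_nonpos_nonneg[OF F \<phi>(2), of x] test_functions_zero(1)[OF \<phi>(1), of x] by (cases "x \<in> D") auto
    qed
    then show "(LBINT x:D. (u x + - 1 * B x) * (laplacian \<phi> x - q x * \<phi> x)) \<ge> 0"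
      using wF \<phi>(1) test_function_integrable(3)[OF D(1) \<phi>(1) cF] by (simp add: weak_solution_def)
  qed (use x0 in auto)
  moreover have "B x0 \<le> M * r\<^sup>2" using M by (simp add: B_def)
  ultimately show ?thesis by linarith
qed

lemma weak_solution_bound:
  fixes u q :: "'a::euclidean_space \<Rightarrow> real"
  assumes D: "open D" "D \<subseteq> cball 0 r"
    and u: "continuous_on (closure D) u" and q: "continuous_on D q" "\<And>x. x \<in> D \<Longrightarrow> q x \<ge> 0"
    and f: "continuous_on D f" "\<And>x. x \<in> D \<Longrightarrow> \<bar>f x\<bar> \<le> M" and M: "M \<ge> 0"
    and w: "weak_solution q D f u"
    and bd: "\<And>x. x \<in> frontier D \<Longrightarrow> u x = 0" and x0: "x0 \<in> closure D"
  shows "\<bar>u x0\<bar> \<le> M * r\<^sup>2"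
proof (cases "x0 \<in> D")
  case True
  have cuD: "continuous_on D u" using u continuous_on_subset closure_subset by blast
  have "u x0 \<le> M * r\<^sup>2"
    by (rule weak_solution_bound_above[OF D u q f M w _ True]) (simp_all add: bd)
  moreover have "- u x0 \<le> M * r\<^sup>2"
  proof (rule weak_solution_bound_above[OF D _ q _ _ M _ _ True, where f = "\<lambda>x. - f x"])
    show "weak_solution q D (\<lambda>x. - f x) (\<lambda>x. - u x)"
      using weak_solution_linear[OF D(1) q(1) continuous_on_const[of _ 0] cuD continuous_on_const[of _ 0] f(1) _ w, of "-1"]
      by (simp add: weak_solution_def)
  qed (use u f bd in \<open>auto intro: continuous_intros\<close>)
  ultimately show ?thesis by linarith
next
  case False
  then show ?thesis using bd[of x0] x0 M D(1) by (auto simp: frontier_def interior_open)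
qed

section \<open>A parametrix for the Laplacian\<close>

text \<open>Banach's theorem in the sup norm over \<open>S\<close>, phrased for total functions:
  distances and the fixed point equation are only seen on \<open>S\<close>. The iterates converge as
  a telescoping series dominated by a geometric one.\<close>

lemma contraction_fixpoint:
  fixes T :: "('a::metric_space \<Rightarrow> real) \<Rightarrow> 'a \<Rightarrow> real" and S :: "'a set"
  defines "X \<equiv> {u. continuous_on S u \<and> bounded (u ` S)}"
  assumes T: "\<And>u. u \<in> X \<Longrightarrow> T u \<in> X"
    and contr: "\<And>u v M x. u \<in> X \<Longrightarrow> v \<in> X \<Longrightarrow> (\<And>x. x \<in> S \<Longrightarrow> \<bar>u x - v x\<bar> \<le> M) \<Longrightarrow> x \<in> S
       \<Longrightarrow> \<bar>T u x - T v x\<bar> \<le> M / 2"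
  obtains u where "u \<in> X" "\<And>x. x \<in> S \<Longrightarrow> T u x = u x"
proof -
  define U where "U n = (T ^^ n) (\<lambda>_. 0)" for n
  have U0: "U 0 = (\<lambda>_. 0)" and US: "U (Suc n) = T (U n)" for n by (simp_all add: U_def)
  have U: "U n \<in> X" for n
  proof (induction n)
    case 0
    have "bounded ((\<lambda>_. 0::real) ` S)" by (auto simp: bounded_iff)
    then show ?case by (simp add: U0 X_def)
  qed (simp add: US T)
  have "bounded (U 1 ` S)" using U[of 1] by (simp add: X_def)
  then obtain M where M: "\<And>x. x \<in> S \<Longrightarrow> \<bar>U 1 x\<bar> \<le> M" by (auto simp: bounded_iff)
  have step: "\<bar>U (Suc n) x - U n x\<bar> \<le> M * (1 / 2) ^ n" if "x \<in> S" for n x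
    using that
  proof (induction n arbitrary: x)
    case 0
    then show ?case using M by (simp add: U0)
  next
    case (Suc n)
    have "\<bar>T (U (Suc n)) x - T (U n) x\<bar> \<le> (M * (1 / 2) ^ n) / 2"
      by (rule contr[OF U U Suc.IH Suc.prems])
    then show ?case by (simp add: US)
  qed
  define u where "u x = (\<Sum>i. U (Suc i) x - U i x)" for x
  have "summable (\<lambda>n. M * (1 / 2) ^ n)" by (intro summable_mult summable_geometric) simp
  then have "uniform_limit S (\<lambda>n x. \<Sum>i<n. U (Suc i) x - U i x) u sequentially"
    unfolding u_def by (intro Weierstrass_m_test) (auto intro: step simp del: power_one_over)
  then have lim: "uniform_limit S U u sequentially"
    by (simp add: sum_lessThan_telescope[of "\<lambda>i. U i _"] U0 cong: uniform_limit_cong')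
  have "continuous_on S u"
    by (rule uniform_limit_theorem[OF _ lim]) (use U in \<open>auto simp: X_def\<close>)
  moreover have bu: "\<exists>n. \<forall>x\<in>S. \<bar>U n x - u x\<bar> \<le> e \<and> \<bar>U (Suc n) x - u x\<bar> \<le> e" if "e > 0" for e
  proof -
    have "\<forall>\<^sub>F n in sequentially. \<forall>x\<in>S. dist (U n x) (u x) < e" using uniform_limitD[OF lim that] .
    then obtain N where "\<forall>n\<ge>N. \<forall>x\<in>S. dist (U n x) (u x) < e" by (auto simp: eventually_sequentially)
    then have "\<forall>x\<in>S. dist (U N x) (u x) < e" "\<forall>x\<in>S. dist (U (Suc N) x) (u x) < e" by auto
    then show ?thesis by (intro exI[of _ N]) (auto simp: dist_real_def less_imp_le)
  qed
  moreover have "bounded (u ` S)"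
  proof -
    obtain n where n: "\<And>x. x \<in> S \<Longrightarrow> \<bar>U n x - u x\<bar> \<le> 1" using bu[of 1] by auto
    obtain B where "\<And>x. x \<in> S \<Longrightarrow> \<bar>U n x\<bar> \<le> B" using U[of n] by (auto simp: X_def bounded_iff)
    then have "\<bar>u x\<bar> \<le> B + 1" if "x \<in> S" for x using n[OF that] that by fastforce
    then show ?thesis by (auto simp: bounded_iff)
  qed
  ultimately have uX: "u \<in> X" by (simp add: X_def)
  moreover have "T u x = u x" if x: "x \<in> S" for x
  proof (rule ccontr)
    assume "T u x \<noteq> u x"
    \<comment> \<open>With a third, the two approximations below cost \<open>3 / 2 * e\<close>, less
      than the distance \<open>3 * e\<close>.\<close>
    define e where "e = \<bar>T u x - u x\<bar> / 3"
    have e: "e > 0" using \<open>T u x \<noteq> u x\<close> by (simp add: e_def)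
    obtain n where n: "\<And>x. x \<in> S \<Longrightarrow> \<bar>U n x - u x\<bar> \<le> e \<and> \<bar>U (Suc n) x - u x\<bar> \<le> e" using bu[OF e] by auto
    have "\<bar>T (U n) x - T u x\<bar> \<le> e / 2"
      by (rule contr[OF U uX _ x]) (use n in auto)
    then have "\<bar>T u x - u x\<bar> \<le> e / 2 + e" using n[OF x] US[of n] by (smt (verit))
    then show False using e by (simp add: e_def)
  qed
  ultimately show ?thesis using that by blast
qed

text \<open>Squaring smooths the kink of the positive part at 0. Hence \<open>cap2\<close> is
  differentiable across the unit sphere and can be integrated by parts, although \<open>cap\<close>
  is not differentiable there.\<close>

lemma has_real_derivative_max_square:
  "((\<lambda>t. (max 0 t)\<^sup>2) has_real_derivative 2 * max 0 t) (at (t::real))"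
proof -
  consider "t > 0" | "t < 0" | "t = 0" by linarith
  then show ?thesis
  proof cases
    case 1
    have "((\<lambda>t. t\<^sup>2) has_real_derivative 2 * max 0 t) (at t)"
      using 1 by (auto intro!: derivative_eq_intros)
    then show ?thesis
      by (rule has_field_derivative_transform_within_open[of _ _ _ "{0<..}"]) (use 1 in auto)
  next
    case 2
    have "((\<lambda>t. 0) has_real_derivative 2 * max 0 t) (at t)"
      using 2 by auto
    then show ?thesis
      by (rule has_field_derivative_transform_within_open[of _ _ _ "{..<0}"]) (use 2 in auto)
  next
    case 3
    have "(\<lambda>h. (max 0 (0 + h))\<^sup>2 / h) \<midarrow>0\<rightarrow> (0::real)"
    proof (rule Lim_null_comparison)
      show "\<forall>\<^sub>F h in at 0. norm ((max 0 (0 + h))\<^sup>2 / h) \<le> \<bar>h::real\<bar>"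
        by (rule always_eventually) (auto simp: power2_eq_square max_def)
      show "(\<lambda>h::real. \<bar>h\<bar>) \<midarrow>0\<rightarrow> 0" using tendsto_rabs[OF tendsto_ident_at, of 0 UNIV] by simp
    qed
    then show ?thesis using 3 by (simp add: DERIV_def)
  qed
qed

text \<open>\<open>cap\<close> and \<open>cap2\<close> are related by \<open>\<nabla> cap2 z = - cap z *\<^sub>R z\<close>, so that averages of a function
  against dilations of \<open>cap\<close> change with the dilation parameter by averages of the Laplacian
  against \<open>cap2\<close>.\<close>

definition cap :: "'a::euclidean_space \<Rightarrow> real" where "cap z = max 0 (1 - (norm z)\<^sup>2)"
definition cap2 :: "'a::euclidean_space \<Rightarrow> real" where "cap2 z = (cap z)\<^sup>2 / 4"

lemma cap_bounds: "0 \<le> cap z" "cap z \<le> 1" by (auto simp: cap_def)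
lemma cap2_bounds: "0 \<le> cap2 z" "cap2 z \<le> 1"
  using cap_bounds[of z] power_le_one[of "cap z" 2] by (auto simp: cap2_def)
lemma cap_zero: "norm z \<ge> 1 \<Longrightarrow> cap z = 0" by (auto simp: cap_def)
lemma cap2_zero: "norm z \<ge> 1 \<Longrightarrow> cap2 z = 0" by (simp add: cap2_def cap_zero)
lemma continuous_on_cap: "continuous_on S cap" unfolding cap_def[abs_def] by (intro continuous_intros)
lemma continuous_on_cap2: "continuous_on S cap2"
  unfolding cap2_def[abs_def] by (intro continuous_intros continuous_on_cap) simp

lemma cap2_has_derivative: "(cap2 has_derivative (\<lambda>h. - cap z * (z \<bullet> h))) (at (z::'a::euclidean_space))"
proof -
  have "((\<lambda>x::'a. 1 - x \<bullet> x) has_derivative (\<lambda>h. - (2 * (z \<bullet> h)))) (at z)"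
    by (auto intro!: derivative_eq_intros simp: inner_commute)
  from has_derivative_compose[OF this has_real_derivative_max_square[unfolded has_field_derivative_def]]
  have "((\<lambda>x::'a. (max 0 (1 - x \<bullet> x))\<^sup>2) has_derivative (\<lambda>h. 2 * max 0 (1 - z \<bullet> z) * - (2 * (z \<bullet> h)))) (at z)" .
  \<comment> \<open>The square and \<open>|z|\<^sup>2\<close> each contribute a factor 2, which the
    \<open>1 / 4\<close> in \<open>cap2\<close> cancels.\<close>
  from has_derivative_mult_right[OF this, of "1 / 4"]
  show ?thesis by (simp add: cap2_def[abs_def] cap_def power2_norm_eq_inner)
qed

lemma integrable_cap: "integrable lborel cap"
  by (rule integrable_compact_support[OF continuous_on_cap compact_cball[of 0 1]]) (auto simp: cap_zero)

lemma integral_cap_pos: "(LBINT z. cap (z::'a::euclidean_space)) > 0"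
  by (rule integral_pos_ball[OF continuous_on_cap integrable_cap cap_bounds(1), where a = 0]) (simp add: cap_def)

section \<open>Averages over dilates of the radial profile\<close>

lemma fubini_bounded_support:
  fixes f :: "'p::euclidean_space \<Rightarrow> 'q::euclidean_space \<Rightarrow> real"
  assumes m: "(\<lambda>p. f (fst p) (snd p)) \<in> borel_measurable borel"
    and B: "\<And>x y. \<bar>f x y\<bar> \<le> B" and R: "\<And>x y. R < norm x \<or> R < norm y \<Longrightarrow> f x y = 0"
  shows "(LBINT x. LBINT y. f x y) = (LBINT y. LBINT x. f x y)"
    and "(LBINT p. f (fst p) (snd p)) = (LBINT x. LBINT y. f x y)"
proof -
  have "integrable lborel (\<lambda>p. f (fst p) (snd p))"
  proof (rule integrable_bounded_support[OF m, where B = B and r = "2 * R"])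
    fix p :: "'p \<times> 'q" assume "p \<notin> cball 0 (2 * R)"
    then have "R < norm (fst p) \<or> R < norm (snd p)"
      using norm_Pair_le[of "fst p" "snd p"] by auto
    then show "f (fst p) (snd p) = 0" by (rule R)
  qed (rule B)
  then have i: "integrable (lborel \<Otimes>\<^sub>M lborel) (case_prod f)"
    by (simp add: lborel_prod case_prod_beta')
  show "(LBINT x. LBINT y. f x y) = (LBINT y. LBINT x. f x y)"
    using lborel_pair.Fubini_integral[OF i] by simp
  show "(LBINT p. f (fst p) (snd p)) = (LBINT x. LBINT y. f x y)"
    using lborel_pair.integral_fst[OF i] by (simp add: lborel_prod case_prod_beta')
qed

lemma test_function_bounds:
  assumes "\<phi> \<in> test_functions D"
  obtains B r where "B \<ge> 0" "\<And>x. \<bar>\<phi> x\<bar> \<le> B" "\<And>x. \<bar>laplacian \<phi> x\<bar> \<le> B" "\<And>x. norm (gradient \<phi> x) \<le> B"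
    "r > 0" "\<And>x. norm x > r \<Longrightarrow> \<phi> x = 0 \<and> laplacian \<phi> x = 0 \<and> gradient \<phi> x = 0"
proof -
  have C: "C_on (Suc (Suc 0)) UNIV \<phi>" using test_functions_C_on[OF assms] .
  note s = test_functions_supp(1)[OF assms]
  obtain B1 r1 where 1: "B1 \<ge> 0" "\<And>x. \<bar>\<phi> x\<bar> \<le> B1" "r1 > 0" "supp \<phi> \<subseteq> cball 0 r1"
    by (rule compact_support_bounds[OF C_on_imp_continuous_on[OF C] s]) (auto simp: not_supp)
  obtain B2 r2 where 2: "B2 \<ge> 0" "\<And>x. \<bar>laplacian \<phi> x\<bar> \<le> B2"
    by (rule compact_support_bounds[OF continuous_on_laplacian[OF C] s]) (auto simp: laplacian_not_supp)
  have "continuous_on UNIV (\<lambda>x. norm (gradient \<phi> x))"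
    by (intro continuous_on_norm continuous_on_gradient[OF C])
  then obtain B3 r3 where 3: "B3 \<ge> 0" "\<And>x. \<bar>norm (gradient \<phi> x)\<bar> \<le> B3"
    by (rule compact_support_bounds[OF _ s]) (auto simp: gradient_not_supp)
  show ?thesis
  proof (rule that[of "B1 + B2 + B3" r1])
    fix x show "\<bar>\<phi> x\<bar> \<le> B1 + B2 + B3" "\<bar>laplacian \<phi> x\<bar> \<le> B1 + B2 + B3" "norm (gradient \<phi> x) \<le> B1 + B2 + B3"
      using 1(1) 1(2)[of x] 2(1) 2(2)[of x] 3(1) 3(2)[of x] by auto
    assume "norm x > r1"
    then have "x \<notin> supp \<phi>" using 1(4) by auto
    then show "\<phi> x = 0 \<and> laplacian \<phi> x = 0 \<and> gradient \<phi> x = 0"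
      by (simp add: not_supp laplacian_not_supp gradient_not_supp)
  qed (use 1 2 3 in auto)
qed

lemma borel_measurable_continuous_comp:
  "continuous_on UNIV f \<Longrightarrow> continuous_on UNIV g \<Longrightarrow> (\<lambda>x. f (g x)) \<in> borel_measurable borel"
  using borel_measurable_continuous_onI[OF continuous_on_compose2[of UNIV f UNIV g]] by auto

text \<open>The divergence of \<open>cap2 z\<close> times the gradient of \<open>\<phi>\<close> at
  \<open>x + s z\<close> has integral 0. The chain rule gives the left-hand side with its factor
  \<open>s\<close>, the gradient of \<open>cap2\<close> the right-hand side.\<close>

lemma integral_cap2_laplacian:
  fixes x :: "'a::euclidean_space"
  assumes "\<phi> \<in> test_functions D"
  shows "(LBINT z. s * cap2 z * laplacian \<phi> (x + s *\<^sub>R z)) =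
    (LBINT z. cap z * (gradient \<phi> (x + s *\<^sub>R z) \<bullet> z))"
proof -
  have C: "C_on (Suc (Suc 0)) UNIV \<phi>" using test_functions_C_on[OF assms] .
  have aff: "continuous_on S (\<lambda>z. x + s *\<^sub>R z)" for S by (intro continuous_intros)
  have c1: "continuous_on S (\<lambda>z. partial_deriv b \<phi> (x + s *\<^sub>R z))" 
    "continuous_on S (\<lambda>z. partial_deriv b (partial_deriv b \<phi>) (x + s *\<^sub>R z))" if "b \<in> Basis" for b S
    using continuous_on_compose2[OF continuous_on_partial_deriv[OF C that] aff]
      continuous_on_compose2[OF continuous_on_partial_deriv2[OF C that that] aff] by auto
  have z: "(LBINT z. s * cap2 z * partial_deriv b (partial_deriv b \<phi>) (x + s *\<^sub>R z)
      - cap z * (partial_deriv b \<phi> (x + s *\<^sub>R z) * (z \<bullet> b))) = 0" if b: "b \<in> Basis" for b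
  proof -
    define F where "F z = cap2 z * partial_deriv b \<phi> (x + s *\<^sub>R z)" for z
    define F' where "F' z h = cap2 z * partial_deriv (s *\<^sub>R h) (partial_deriv b \<phi>) (x + s *\<^sub>R z)
       + - cap z * (z \<bullet> h) * partial_deriv b \<phi> (x + s *\<^sub>R z)" for z h
    have d: "(F has_derivative F' z) (at z)" for z
      unfolding F_def F'_def
      by (intro has_derivative_mult cap2_has_derivative
        has_derivative_compose[OF _ C_on_has_derivative[OF C_on_partial_deriv[OF C b]]])
        (auto intro!: derivative_eq_intros)
    have sc: "partial_deriv (s *\<^sub>R b) (partial_deriv b \<phi>) y = s * partial_deriv b (partial_deriv b \<phi>) y" for y
    proof -
      interpret linear "\<lambda>h. partial_deriv h (partial_deriv b \<phi>) y"
        using C_on_has_derivative[OF C_on_partial_deriv[OF C b], of y] has_derivative_linear by blast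
      show ?thesis by (simp add: scaleR)
    qed
    have "(LBINT z. F' z b) = 0"
    proof (rule integral_derivative_zero[OF d _ compact_cball[of 0 1]])
      show "continuous_on UNIV (\<lambda>z. F' z b)"
        unfolding F'_def sc by (intro continuous_intros continuous_on_cap continuous_on_cap2 c1 b)
      show "F z = 0" if "z \<notin> cball 0 1" for z using that by (simp add: F_def cap2_zero)
    qed
    moreover have "F' z b = s * cap2 z * partial_deriv b (partial_deriv b \<phi>) (x + s *\<^sub>R z)
      - cap z * (partial_deriv b \<phi> (x + s *\<^sub>R z) * (z \<bullet> b))" for z
      by (simp add: F'_def sc)
    ultimately show ?thesis by simp
  qed
  have i1: "integrable lborel (\<lambda>z. s * cap2 z * partial_deriv b (partial_deriv b \<phi>) (x + s *\<^sub>R z))" if "b \<in> Basis" for b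
    by (rule integrable_compact_support[OF _ compact_cball[of 0 1]])
      (auto intro!: continuous_intros continuous_on_cap2 c1 that simp: cap2_zero)
  have i2: "integrable lborel (\<lambda>z. cap z * (partial_deriv b \<phi> (x + s *\<^sub>R z) * (z \<bullet> b)))" if "b \<in> Basis" for b
    by (rule integrable_compact_support[OF _ compact_cball[of 0 1]])
      (auto intro!: continuous_intros continuous_on_cap c1 that simp: cap_zero)
  have g: "gradient \<phi> y \<bullet> z = (\<Sum>b\<in>Basis. partial_deriv b \<phi> y * (z \<bullet> b))" for y z
    by (simp add: gradient_def inner_sum_left inner_commute[of z])
  show ?thesis
    unfolding laplacian_def g sum_distrib_left using z i1 i2 by (simp add: Bochner_Integration.integral_sum)
qed

text \<open>The right-hand side of \<open>integral_cap2_laplacian\<close> is the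
  \<open>s\<close>-derivative of the average of \<open>\<phi>\<close> over the dilate of scale
  \<open>s\<close>. Fubini and the fundamental theorem of calculus along each ray integrate it from
  0 to \<open>S\<close>.\<close>

lemma dilation_average_difference:
  fixes x :: "'a::euclidean_space"
  assumes \<phi>: "\<phi> \<in> test_functions D" and S: "S \<ge> 0"
  shows "(LBINT s. indicator {0..S} s * (LBINT z. s * cap2 z * laplacian \<phi> (x + s *\<^sub>R z))) =
    (LBINT z. cap z * \<phi> (x + S *\<^sub>R z)) - (LBINT z. cap (z::'a)) * \<phi> x"
proof -
  have C: "C_on (Suc (Suc 0)) UNIV \<phi>" using test_functions_C_on[OF \<phi>] .
  obtain B where B: "B \<ge> 0" "\<And>x. norm (gradient \<phi> x) \<le> B"
    using test_function_bounds[OF \<phi>] by metis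
  have cg: "continuous_on UNIV (gradient \<phi>)" by (rule continuous_on_gradient[OF C])
  define g where "g s z = indicator {0..S} s * (cap z * (gradient \<phi> (x + s *\<^sub>R z) \<bullet> z))" for s :: real and z :: 'a
  have "(LBINT s. indicator {0..S} s * (LBINT z. s * cap2 z * laplacian \<phi> (x + s *\<^sub>R z))) =
    (LBINT s. LBINT z. g s z)"
    unfolding integral_cap2_laplacian[OF \<phi>] g_def by simp
  also have "\<dots> = (LBINT z. LBINT s. g s z)"
  proof (rule fubini_bounded_support(1)[where B = B and R = "max 1 S"])
    have "continuous_on UNIV (\<lambda>p::real\<times>'a. cap (snd p) * (gradient \<phi> (x + fst p *\<^sub>R snd p) \<bullet> snd p))"
      by (intro continuous_intros continuous_on_compose2[OF continuous_on_cap[of UNIV]] continuous_on_compose2[OF cg]) auto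
    then have "(\<lambda>p::real\<times>'a. cap (snd p) * (gradient \<phi> (x + fst p *\<^sub>R snd p) \<bullet> snd p)) \<in> borel_measurable borel"
      by (rule borel_measurable_continuous_onI)
    moreover have "(\<lambda>p::real\<times>'a. indicator {0..S} (fst p) :: real) \<in> borel_measurable borel"
      unfolding borel_prod[symmetric] by measurable
    ultimately show "(\<lambda>p. g (fst p) (snd p)) \<in> borel_measurable borel" 
      unfolding g_def by (rule borel_measurable_times[rotated])
  next
    fix s and z :: 'a
    show "\<bar>g s z\<bar> \<le> B"
    proof (cases "norm z \<ge> 1")
      case False
      have "\<bar>gradient \<phi> (x + s *\<^sub>R z) \<bullet> z\<bar> \<le> norm (gradient \<phi> (x + s *\<^sub>R z)) * norm z" by (rule Cauchy_Schwarz_ineq2)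
      also have "\<dots> \<le> B * 1" using B False by (intro mult_mono) auto
      finally have "\<bar>cap z * (gradient \<phi> (x + s *\<^sub>R z) \<bullet> z)\<bar> \<le> 1 * B"
        unfolding abs_mult using cap_bounds[of z] by (intro mult_mono) auto
      then show ?thesis using B by (auto simp: g_def indicator_def)
    qed (use B in \<open>simp add: g_def cap_zero\<close>)
    show "g s z = 0" if "max 1 S < norm s \<or> max 1 S < norm z"
      using that S by (auto simp: g_def cap_zero indicator_def)
  qed
  also have "\<dots> = (LBINT z. cap z * (\<phi> (x + S *\<^sub>R z) - \<phi> x))"
  proof (rule Bochner_Integration.integral_cong[OF refl])
    fix z :: 'a
    have "(LBINT s. (gradient \<phi> (x + s *\<^sub>R z) \<bullet> z) * indicator {0..S} s) = \<phi> (x + S *\<^sub>R z) - \<phi> (x + 0 *\<^sub>R z)"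
    proof (rule integral_FTC_Icc_real[OF S])
      fix s
      have D: "(\<phi> has_derivative (\<lambda>h. partial_deriv h \<phi> y)) (at y)" for y using C_on_has_derivative[OF C] by simp
      interpret linear "\<lambda>h. partial_deriv h \<phi> (x + s *\<^sub>R z)" using D by (rule has_derivative_linear)
      have "((\<lambda>s. \<phi> (x + s *\<^sub>R z)) has_derivative (\<lambda>h. partial_deriv (h *\<^sub>R z) \<phi> (x + s *\<^sub>R z))) (at s)"
        by (rule has_derivative_compose[OF _ D]) (auto intro!: derivative_eq_intros)
      then show "((\<lambda>s. \<phi> (x + s *\<^sub>R z)) has_real_derivative gradient \<phi> (x + s *\<^sub>R z) \<bullet> z) (at s)"
        using D[of "x + s *\<^sub>R z"]
        by (simp add: has_field_derivative_def scaleR mult_commute_abs gradient_inner differentiableI)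
      have "continuous_on UNIV (\<lambda>s. gradient \<phi> (x + s *\<^sub>R z) \<bullet> z)"
        by (intro continuous_intros continuous_on_compose2[OF cg]) auto
      then show "isCont (\<lambda>s. gradient \<phi> (x + s *\<^sub>R z) \<bullet> z) s" by (simp add: continuous_on_eq_continuous_at)
    qed
    then show "(LBINT s. g s z) = cap z * (\<phi> (x + S *\<^sub>R z) - \<phi> x)"
      unfolding g_def by (simp add: mult.left_commute[of _ "cap z"] mult.commute[of "indicator {0..S} _"])
  qed
  also have "\<dots> = (LBINT z. cap z * \<phi> (x + S *\<^sub>R z) - cap z * \<phi> x)"
    by (simp add: algebra_simps)
  also have "\<dots> = (LBINT z. cap z * \<phi> (x + S *\<^sub>R z)) - (LBINT z. cap (z::'a) * \<phi> x)"
  proof (rule Bochner_Integration.integral_diff)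
    show "integrable lborel (\<lambda>z. cap z * \<phi> (x + S *\<^sub>R z))"
      by (rule integrable_compact_support[OF _ compact_cball[of 0 1]])
        (auto intro!: continuous_intros continuous_on_cap continuous_on_compose2[OF C_on_imp_continuous_on[OF C]] simp: cap_zero)
  qed (use integrable_cap in auto)
  finally show ?thesis by simp
qed

section \<open>The parametrix and its error term\<close>

definition scale_kernel :: "real \<Rightarrow> real \<times> 'a::euclidean_space \<Rightarrow> real" where
  "scale_kernel S p = indicator {0..S} (fst p) * (fst p * cap2 (snd p))"

text \<open>Collapsing the pair \<open>(s, z)\<close> to \<open>s z\<close> would give a convolution
  kernel that behaves at 0 like the fundamental solution, and so depends on the dimension. With the
  pair as integration variable the kernel stays bounded with bounded support in every
  dimension.\<close>

definition parametrix :: "real \<Rightarrow> ('a::euclidean_space \<Rightarrow> real) \<Rightarrow> 'a \<Rightarrow> real" where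
  "parametrix S f y = (LBINT p. scale_kernel S p * f (y - fst p *\<^sub>R snd p))"

definition dilation_average :: "real \<Rightarrow> ('a::euclidean_space \<Rightarrow> real) \<Rightarrow> 'a \<Rightarrow> real" where
  "dilation_average S f y = (LBINT z. cap z * f (y - S *\<^sub>R z))"

lemma scale_kernel_measurable: 
  "scale_kernel S \<in> borel_measurable (borel :: (real \<times> 'a::euclidean_space) measure)"
proof -
  have "continuous_on UNIV (\<lambda>p::real\<times>'a. fst p * cap2 (snd p))"
    by (intro continuous_intros continuous_on_compose2[OF continuous_on_cap2[of UNIV]]) auto
  moreover have "(\<lambda>p::real\<times>'a. indicator {0..S} (fst p) :: real) \<in> borel_measurable borel"
    unfolding borel_prod[symmetric] by measurable
  ultimately show ?thesis
    unfolding scale_kernel_def[abs_def]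
    by (rule borel_measurable_times[rotated, OF borel_measurable_continuous_onI])
qed

lemma scale_kernel_bounds:
  assumes "S \<ge> 0"
  shows "\<bar>scale_kernel S p\<bar> \<le> S" "norm (snd p) \<ge> 1 \<or> fst p > S \<or> fst p < 0 \<Longrightarrow> scale_kernel S p = 0"
proof -
  show "\<bar>scale_kernel S p\<bar> \<le> S"
    using cap2_bounds[of "snd p"] assms mult_mono[of "fst p" S "cap2 (snd p)" 1]
    by (auto simp: scale_kernel_def indicator_def abs_mult)
qed (auto simp: scale_kernel_def cap2_zero)

lemma scale_kernel_zero:
  assumes "S \<ge> 0" "norm (p :: real \<times> 'a::euclidean_space) > S + 1"
  shows "scale_kernel S p = 0"
proof -
  have "\<bar>fst p\<bar> + norm (snd p) > S + 1" using norm_Pair_le[of "fst p" "snd p"] assms by auto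
  then have "norm (snd p) \<ge> 1 \<or> fst p > S \<or> fst p < 0" by linarith
  then show ?thesis by (rule scale_kernel_bounds(2)[OF assms(1)])
qed

lemma parametrix_continuous:
  fixes f :: "'a::euclidean_space \<Rightarrow> real"
  assumes f: "continuous_on UNIV f" "\<And>x. \<bar>f x\<bar> \<le> M" and S: "S \<ge> 0"
  shows "continuous_on UNIV (parametrix S f)"
  unfolding parametrix_def[abs_def]
proof (rule continuous_on_integral_param[where w = "\<lambda>p. \<bar>scale_kernel S p\<bar> * M"])
  show "(\<lambda>p. scale_kernel S p * f (y - fst p *\<^sub>R snd p)) \<in> borel_measurable lborel" for y
    using borel_measurable_times[OF scale_kernel_measurable borel_measurable_continuous_comp[OF f(1), of "\<lambda>p. y - fst p *\<^sub>R snd p"], of S]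
    by (simp add: continuous_intros)
  have "integrable lborel (scale_kernel S :: real \<times> 'a \<Rightarrow> real)"
    by (rule integrable_bounded_support[OF scale_kernel_measurable scale_kernel_bounds(1)[OF S], of "S + 1"])
      (simp add: scale_kernel_zero[OF S])
  then show "integrable lborel (\<lambda>p::real \<times> 'a. \<bar>scale_kernel S p\<bar> * M)" by auto
  show "\<bar>scale_kernel S p * f (y - fst p *\<^sub>R snd p)\<bar> \<le> \<bar>scale_kernel S p\<bar> * M" for y and p :: "real \<times> 'a"
    unfolding abs_mult by (intro mult_left_mono f) auto
  show "continuous_on UNIV (\<lambda>y. scale_kernel S p * f (y - fst p *\<^sub>R snd p))" for p
    by (intro continuous_intros continuous_on_compose2[OF f(1)]) auto
qed

lemma dilation_average_continuous:
  fixes f :: "'a::euclidean_space \<Rightarrow> real"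
  assumes f: "continuous_on UNIV f" "\<And>x. \<bar>f x\<bar> \<le> M"
  shows "continuous_on UNIV (dilation_average S f)"
  unfolding dilation_average_def[abs_def]
proof (rule continuous_on_integral_param[where w = "\<lambda>z. \<bar>cap z\<bar> * M"])
  show "(\<lambda>z. cap z * f (y - S *\<^sub>R z)) \<in> borel_measurable lborel" for y
    using borel_measurable_times[OF borel_measurable_continuous_onI[OF continuous_on_cap] borel_measurable_continuous_comp[OF f(1), of "\<lambda>z. y - S *\<^sub>R z"]]
    by (simp add: continuous_intros)
  show "integrable lborel (\<lambda>p::'a. \<bar>cap p\<bar> * M)" using integrable_cap by auto
  show "\<bar>cap z * f (y - S *\<^sub>R z)\<bar> \<le> \<bar>cap z\<bar> * M" for y and z
    unfolding abs_mult by (intro mult_left_mono f) auto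
  show "continuous_on UNIV (\<lambda>y. cap z * f (y - S *\<^sub>R z))" for z
    by (intro continuous_intros continuous_on_compose2[OF f(1)]) auto
qed

text \<open>Moves an average from \<open>f\<close> to \<open>g\<close>: Fubini, and for each fixed
  \<open>p\<close> the translation by \<open>m p\<close>. It is needed for two kernels:
  \<open>p = (s, z)\<close> with \<open>m p = s z\<close> for the parametrix, and
  \<open>p = z\<close> with \<open>m p = S z\<close> for the dilation average.\<close>

lemma kernel_average_transpose:
  fixes \<kappa> :: "'p::euclidean_space \<Rightarrow> real" and m :: "'p \<Rightarrow> 'a::euclidean_space"
  assumes \<kappa>: "\<kappa> \<in> borel_measurable borel" "\<And>p. \<bar>\<kappa> p\<bar> \<le> C" "\<And>p. norm p > R \<Longrightarrow> \<kappa> p = 0"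
    and m: "continuous_on UNIV m" "\<And>p. \<kappa> p \<noteq> 0 \<Longrightarrow> norm (m p) \<le> L"
    and f: "continuous_on UNIV f" "\<And>x. \<bar>f x\<bar> \<le> M"
    and g: "continuous_on UNIV g" "\<And>x. \<bar>g x\<bar> \<le> B" "\<And>x. norm x > r \<Longrightarrow> g x = 0"
  shows "(LBINT y. (LBINT p. \<kappa> p * f (y - m p)) * g y) = (LBINT x. f x * (LBINT p. \<kappa> p * g (x + m p)))"
proof -
  have M: "C \<ge> 0" "M \<ge> 0" "B \<ge> 0"
    using \<kappa>(2)[of 0] f(2)[of 0] g(2)[of 0] by linarith+
  have bd: "\<bar>\<kappa> p * (f x * g y)\<bar> \<le> C * (M * B)" for p x y
    unfolding abs_mult using M by (intro mult_mono \<kappa> f g) auto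
  have \<kappa>m: "(\<lambda>p. \<kappa> (fst p)) \<in> borel_measurable (borel :: ('p \<times> 'a) measure)"
    by (rule measurable_compose[OF borel_measurable_continuous_onI \<kappa>(1)]) (intro continuous_intros)
  have mc: "continuous_on S (\<lambda>p. m (h p))" if "continuous_on S h" for S h
    by (rule continuous_on_compose2[OF m(1) that]) auto
  have "(LBINT y. (LBINT p. \<kappa> p * f (y - m p)) * g y) = (LBINT y. LBINT p. \<kappa> p * (f (y - m p) * g y))"
    by (simp add: mult.assoc flip: Bochner_Integration.integral_mult_left_zero)
  also have "\<dots> = (LBINT p. LBINT y. \<kappa> p * (f (y - m p) * g y))"
  proof (rule fubini_bounded_support(1)[symmetric, OF _ bd, where R = "max R r"])
    show "(\<lambda>p. \<kappa> (fst p) * (f (snd p - m (fst p)) * g (snd p))) \<in> borel_measurable borel"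
      by (intro borel_measurable_times[OF \<kappa>m] borel_measurable_times borel_measurable_continuous_comp[OF f(1)]
          borel_measurable_continuous_comp[OF g(1)] continuous_intros mc)
  qed (use \<kappa>(3) g(3) in auto)
  also have "\<dots> = (LBINT p. LBINT x. \<kappa> p * (f x * g (x + m p)))"
  proof (rule Bochner_Integration.integral_cong[OF refl])
    fix p
    have "(\<lambda>y. \<kappa> p * (f (y - m p) * g y)) \<in> borel_measurable borel"
      by (intro borel_measurable_times borel_measurable_const borel_measurable_continuous_comp[OF f(1)] 
         borel_measurable_continuous_comp[OF g(1)] continuous_intros)
    from integral_lborel_translation[OF this, of "m p", symmetric]
    show "(LBINT y. \<kappa> p * (f (y - m p) * g y)) = (LBINT x. \<kappa> p * (f x * g (x + m p)))"
      by (simp only: add_diff_cancel_left' add.commute[of "m p"] add_diff_cancel_right')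
  qed
  also have "\<dots> = (LBINT x. LBINT p. \<kappa> p * (f x * g (x + m p)))"
  proof (rule fubini_bounded_support(1)[OF _ bd, where R = "max R (r + L)"])
    show "(\<lambda>p. \<kappa> (fst p) * (f (snd p) * g (snd p + m (fst p)))) \<in> borel_measurable borel"
      by (intro borel_measurable_times[OF \<kappa>m] borel_measurable_times borel_measurable_continuous_comp[OF f(1)]
          borel_measurable_continuous_comp[OF g(1)] continuous_intros mc)
    show "\<kappa> p * (f x * g (x + m p)) = 0" if n: "max R (r + L) < norm p \<or> max R (r + L) < norm x" for p x
    proof (cases "\<kappa> p = 0")
      case False
      then have "norm (x + m p) > r" using n \<kappa>(3)[of p] m(2)[of p] norm_diff_ineq[of x "m p"] by auto
      then show ?thesis using g(3) by simp
    qed simp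
  qed
  also have "\<dots> = (LBINT x. f x * (LBINT p. \<kappa> p * g (x + m p)))"
    by (simp add: mult.left_commute[of _ "f _"])
  finally show ?thesis .
qed

text \<open>As distributions, \<Delta> applied to \<open>parametrix S f\<close> is
  \<open>dilation_average S f - c f\<close>, where \<open>c\<close> is the mass of
  \<open>cap\<close>. The kernel is transposed onto the test function,
  \<open>dilation_average_difference\<close> is applied at each point, and the average is transposed
  back.\<close>

lemma parametrix_pairing:
  fixes f :: "'a::euclidean_space \<Rightarrow> real"
  assumes f: "continuous_on UNIV f" "\<And>x. \<bar>f x\<bar> \<le> M" and S: "S \<ge> 0"
    and \<phi>: "\<phi> \<in> test_functions D"
  shows "(LBINT y. parametrix S f y * laplacian \<phi> y) =
    (LBINT y. dilation_average S f y * \<phi> y) - (LBINT z. cap (z::'a)) * (LBINT y. f y * \<phi> y)"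
proof -
  have C: "C_on (Suc (Suc 0)) UNIV \<phi>" using test_functions_C_on[OF \<phi>] .
  note c\<phi> = C_on_imp_continuous_on[OF C] and cl = continuous_on_laplacian[OF C]
  obtain B r where B: "B \<ge> 0" "\<And>x. \<bar>\<phi> x\<bar> \<le> B" "\<And>x. \<bar>laplacian \<phi> x\<bar> \<le> B" "r > 0" 
      "\<And>x. norm x > r \<Longrightarrow> \<phi> x = 0 \<and> laplacian \<phi> x = 0"
    using test_function_bounds[OF \<phi>] by metis
  define w where "w = (scale_kernel S :: real \<times> 'a \<Rightarrow> real)"
  have dil: "norm (S *\<^sub>R z) \<le> S" if "cap z \<noteq> 0" for z :: 'a
  proof -
    have "norm z \<le> 1" using that cap_zero[of z] by linarith
    then show ?thesis using S mult_left_mono[of "norm z" 1 S] by simp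
  qed
  have "(LBINT y. parametrix S f y * laplacian \<phi> y) =
      (LBINT x. f x * (LBINT p. w p * laplacian \<phi> (x + fst p *\<^sub>R snd p)))"
    unfolding parametrix_def w_def
  proof (rule kernel_average_transpose[OF scale_kernel_measurable scale_kernel_bounds(1)[OF S]
        scale_kernel_zero[OF S] _ _ f cl B(3), where L = S])
    show "norm (fst p *\<^sub>R snd p) \<le> S" if "scale_kernel S p \<noteq> 0" for p :: "real \<times> 'a"
    proof -
      have "0 \<le> fst p" "fst p \<le> S" "norm (snd p) \<le> 1"
        using that scale_kernel_bounds(2)[OF S, of p] by linarith+
      then show ?thesis using mult_mono[of "fst p" S "norm (snd p)" 1] by simp
    qed
  qed (use B(5) in \<open>auto intro!: continuous_intros\<close>)
  also have "\<dots> = (LBINT x. f x * (LBINT z. cap z * \<phi> (x + S *\<^sub>R z)) - (LBINT z. cap (z::'a)) * (f x * \<phi> x))"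
  proof (rule Bochner_Integration.integral_cong[OF refl])
    fix x
    have "(LBINT p. w p * laplacian \<phi> (x + fst p *\<^sub>R snd p)) =
      (LBINT p. (\<lambda>s z. w (s, z) * laplacian \<phi> (x + s *\<^sub>R z)) (fst p) (snd p))" by simp
    also have "\<dots> = (LBINT s. LBINT z. w (s, z) * laplacian \<phi> (x + s *\<^sub>R z))"
    proof (rule fubini_bounded_support(2)[where B = "S * B" and R = "S + 1"])
      show "(\<lambda>p. w (fst p, snd p) * laplacian \<phi> (x + fst p *\<^sub>R snd p)) \<in> borel_measurable borel"
        using scale_kernel_measurable[of S]
        by (intro borel_measurable_times borel_measurable_continuous_comp[OF cl] continuous_intros) (simp add: w_def)
      show "\<bar>w (s, z) * laplacian \<phi> (x + s *\<^sub>R z)\<bar> \<le> S * B" for s z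
        unfolding abs_mult w_def using S by (intro mult_mono scale_kernel_bounds B) auto
      show "w (s, z) * laplacian \<phi> (x + s *\<^sub>R z) = 0" if "S + 1 < norm s \<or> S + 1 < norm z" for s z
      proof -
        have "norm z \<ge> 1 \<or> s > S \<or> s < 0" using that S by auto
        then show ?thesis using scale_kernel_bounds(2)[OF S, of "(s, z)"] by (simp add: w_def)
      qed
    qed
    also have "\<dots> = (LBINT s. indicator {0..S} s * (LBINT z. s * cap2 z * laplacian \<phi> (x + s *\<^sub>R z)))"
      by (simp add: w_def scale_kernel_def mult.assoc)
    also have "\<dots> = (LBINT z. cap z * \<phi> (x + S *\<^sub>R z)) - (LBINT z. cap (z::'a)) * \<phi> x"
      by (rule dilation_average_difference[OF \<phi> S])
    finally show "f x * (LBINT p. w p * laplacian \<phi> (x + fst p *\<^sub>R snd p)) =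
      f x * (LBINT z. cap z * \<phi> (x + S *\<^sub>R z)) - (LBINT z. cap (z::'a)) * (f x * \<phi> x)"
      by (simp add: right_diff_distrib mult.left_commute)
  qed
  also have "\<dots> = (LBINT x. f x * (LBINT z. cap z * \<phi> (x + S *\<^sub>R z)))
       - (LBINT x. (LBINT z. cap (z::'a)) * (f x * \<phi> x))"
  proof (rule Bochner_Integration.integral_diff)
    have i: "integrable lborel (\<lambda>x. f x * \<phi> x)"
      by (rule integrable_compact_support[OF continuous_on_mult[OF f(1) c\<phi>] test_functions_supp(1)[OF \<phi>]]) (simp add: not_supp)
    then show "integrable lborel (\<lambda>x. (LBINT z. cap (z::'a)) * (f x * \<phi> x))" by auto
    \<comment> \<open>An average over \<open>x + S z\<close> is a dilation average with parameter
      \<open>- S\<close>.\<close>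
    have cc: "continuous_on UNIV (\<lambda>x. LBINT z. cap z * \<phi> (x + S *\<^sub>R z))"
      using dilation_average_continuous[OF c\<phi> B(2), of "- S"] by (simp add: dilation_average_def[abs_def])
    show "integrable lborel (\<lambda>x. f x * (LBINT z. cap z * \<phi> (x + S *\<^sub>R z)))"
    proof (rule integrable_compact_support[OF continuous_on_mult[OF f(1) cc] compact_cball[of 0 "r + S"]])
      fix x :: 'a assume x: "x \<notin> cball 0 (r + S)"
      have "cap z * \<phi> (x + S *\<^sub>R z) = 0" for z
      proof (cases "cap z = 0")
        case False
        then have "norm (x + S *\<^sub>R z) > r" using norm_diff_ineq[of x "S *\<^sub>R z"] x dil[of z] by simp
        then show ?thesis using B(5) by simp
      qed simp
      then show "f x * (LBINT z. cap z * \<phi> (x + S *\<^sub>R z)) = 0"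
        by (simp only: Bochner_Integration.integral_zero mult_zero_right)
    qed
  qed
  also have "(LBINT x. f x * (LBINT z. cap z * \<phi> (x + S *\<^sub>R z))) = (LBINT y. dilation_average S f y * \<phi> y)"
    unfolding dilation_average_def
    by (rule kernel_average_transpose[symmetric, where C = 1 and R = 1 and L = S, OF _ _ _ _ dil f c\<phi> B(2)])
      (use B(5) in \<open>auto simp: cap_zero cap_bounds abs_of_nonneg[OF cap_bounds(1)] intro!: continuous_intros borel_measurable_continuous_onI continuous_on_cap\<close>)
  finally show ?thesis by simp
qed

section \<open>The Dirichlet problem for Schroedinger operators\<close>

lemma weak_solution_cong:
  assumes "open D" "\<And>x. x \<in> D \<Longrightarrow> f x = f' x" "\<And>x. x \<in> D \<Longrightarrow> u x = u' x" "weak_solution q D f u"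
  shows "weak_solution q D f' u'"
  unfolding weak_solution_def
proof
  fix \<phi> assume \<phi>: "\<phi> \<in> test_functions D"
  have D: "D \<in> sets lborel" using assms(1) by simp
  have "(LBINT x:D. u x * (laplacian \<phi> x - q x * \<phi> x)) = (LBINT x:D. u' x * (laplacian \<phi> x - q x * \<phi> x))"
    "(LBINT x:D. f x * \<phi> x) = (LBINT x:D. f' x * \<phi> x)"
    using assms(2,3) by (auto intro!: set_lebesgue_integral_cong[OF D])
  then show "(LBINT x:D. u' x * (laplacian \<phi> x - q x * \<phi> x)) = - (LBINT x:D. f' x * \<phi> x)"
    using assms(4) \<phi> by (simp add: weak_solution_def)
qed

text \<open>As a function of \<open>z\<close>, \<open>h (y - S z)\<close> lives in a ball of radius
  \<open>r / S\<close>, and \<open>cap\<close> is at most 1; the bound is \<open>m\<close> times the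
  volume of that ball, small for large \<open>S\<close>.\<close>

lemma dilation_average_small:
  fixes h :: "'a::euclidean_space \<Rightarrow> real"
  assumes h: "continuous_on UNIV h" "\<And>x. \<bar>h x\<bar> \<le> m" "\<And>x. norm x > r \<Longrightarrow> h x = 0" and S: "S > 0" "r > 0"
  shows "\<bar>dilation_average S h y\<bar> \<le> m * (unit_ball_vol DIM('a) * (r / S) ^ DIM('a))"
proof -
  let ?C = "cball (y /\<^sub>R S) (r / S)"
  have m: "m \<ge> 0" using h(2)[of 0] by linarith
  have ch: "continuous_on UNIV (\<lambda>z. h (y - S *\<^sub>R z))"
    by (intro continuous_on_compose2[OF h(1)] continuous_intros) auto
  have i: "integrable lborel (\<lambda>z. cap z * h (y - S *\<^sub>R z))"
    by (rule integrable_compact_support[OF continuous_on_mult[OF continuous_on_cap ch] compact_cball[of 0 1]])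
      (auto simp: cap_zero)
  have b: "\<bar>cap z * h (y - S *\<^sub>R z)\<bar> \<le> m * indicator ?C z" for z
  proof (cases "z \<in> ?C")
    case True
    have "\<bar>cap z * h (y - S *\<^sub>R z)\<bar> \<le> 1 * m"
      unfolding abs_mult using cap_bounds[of z] by (intro mult_mono h) auto
    then show ?thesis using True by simp
  next
    case False
    have "y - S *\<^sub>R z = S *\<^sub>R (y /\<^sub>R S - z)" using S by (simp add: algebra_simps)
    then have "norm (y - S *\<^sub>R z) = S * dist (y /\<^sub>R S) z" using S by (simp add: dist_norm)
    also have "\<dots> > S * (r / S)" using False S(1) by (intro mult_strict_left_mono) auto
    finally have "norm (y - S *\<^sub>R z) > r" using S(1) by simp
    then show ?thesis using h(3) False by simp
  qed
  have "\<bar>dilation_average S h y\<bar> \<le> (LBINT z. \<bar>cap z * h (y - S *\<^sub>R z)\<bar>)"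
    unfolding dilation_average_def by (rule integral_abs_bound)
  also have "\<dots> \<le> (LBINT z. m * indicator ?C z)"
  proof (rule integral_mono)
    show "integrable lborel (\<lambda>z. m * indicator ?C z :: real)"
      using emeasure_bounded_finite[OF bounded_cball, of "y /\<^sub>R S" "r / S"] by (auto intro: integrable_real_indicator)
  qed (use i b in auto)
  also have "\<dots> = m * measure lborel ?C" by simp
  also have "\<dots> = m * (unit_ball_vol DIM('a) * (r / S) ^ DIM('a))"
    using S by (simp add: content_cball)
  finally show ?thesis .
qed

text \<open>The correction \<open>dilation_average S\<close> in \<open>parametrix_pairing\<close>, cut off to a neighbourhood of
  \<open>D\<close>, has small norm for large \<open>S\<close>, so that \<open>c g - dilation_average S (cut g) = f\<close> is solvable.\<close>

lemma poisson_solution: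
  fixes f :: "'a::euclidean_space \<Rightarrow> real"
  assumes D: "open D" "bounded D" and f: "continuous_on UNIV f" "bounded (range f)"
  obtains v where "continuous_on UNIV v" "weak_solution (\<lambda>_. 0) D f v"
proof -
  define c where "c = (LBINT z. cap (z::'a))"
  have c: "c > 0" unfolding c_def by (rule integral_cap_pos)
  obtain r where r: "r > 0" "\<And>x. x \<in> D \<Longrightarrow> norm x \<le> r" using D(2) by (auto simp: bounded_pos)
  \<comment> \<open>The cutoff gives the average a function of bounded support, and being 1 on
    \<open>D\<close> it is invisible to test functions of \<open>D\<close>.\<close>
  define cut where "cut x = max 0 (min 1 (r + 1 - norm x))" for x :: 'a
  have cut: "0 \<le> cut x" "cut x \<le> 1" for x by (auto simp: cut_def)
  have cut1: "cut x = 1" if "x \<in> D" for x using r(2)[OF that] by (auto simp: cut_def)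
  have cut0: "cut x = 0" if "norm x > r + 1" for x using that by (auto simp: cut_def)
  have ccut: "continuous_on UNIV cut" unfolding cut_def by (intro continuous_intros)
  define V where "V = unit_ball_vol (real DIM('a)) * (r + 1) ^ DIM('a)"
  have V: "V \<ge> 0" using r by (simp add: V_def)
  \<comment> \<open>\<open>S \<ge> 1\<close> gives \<open>S ^ DIM('a) \<ge> S\<close>, so
    \<open>S \<ge> 2 * V / c\<close> forces the ball volume \<open>V / S ^ DIM('a)\<close> below
    \<open>c / 2\<close> in every dimension. Divided by \<open>c\<close> in \<open>T\<close>, this
    is the contraction factor 1/2.\<close>
  define S where "S = max 1 (2 * V / c)"
  have S: "S \<ge> 1" "S > 0" by (auto simp: S_def)
  have small: "unit_ball_vol (real DIM('a)) * ((r + 1) / S) ^ DIM('a) \<le> c / 2"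
  proof -
    have "S ^ 1 \<le> S ^ DIM('a)" by (rule power_increasing) (use S DIM_positive[where 'a='a] in \<open>auto simp: Suc_le_eq\<close>)
    then have "V / S ^ DIM('a) \<le> V / S" using V S by (intro divide_left_mono) auto
    also have "\<dots> \<le> c / 2"
    proof -
      have "2 * V / c \<le> S" by (simp add: S_def)
      then show ?thesis using c S by (simp add: field_simps)
    qed
    finally show ?thesis by (simp add: V_def power_divide)
  qed
  define T where "T g y = (f y + dilation_average S (\<lambda>x. cut x * g x) y) / c" for g and y :: 'a
  have cg: "continuous_on UNIV (\<lambda>x. cut x * g x)" if "continuous_on UNIV g" for g
    by (intro continuous_on_mult ccut that)
  have bg: "\<bar>cut x * g x\<bar> \<le> m" if "\<bar>g x\<bar> \<le> m" for g x m
    using mult_mono[OF cut(2) that, of x] cut(1)[of x] by (simp add: abs_mult)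
  have cA: "continuous_on UNIV (dilation_average S (\<lambda>x. cut x * g x))" 
    if "continuous_on UNIV g" "\<And>x. \<bar>g x\<bar> \<le> m" for g m
    by (rule dilation_average_continuous[OF cg[OF that(1)]]) (rule bg[OF that(2)])
  have bA: "\<bar>dilation_average S (\<lambda>x. cut x * g x) y\<bar> \<le> m * (c / 2)" 
    if "continuous_on UNIV g" "\<And>x. \<bar>g x\<bar> \<le> m" for g m y
  proof -
    have m: "m \<ge> 0" using that(2)[of 0] by linarith
    have "\<bar>dilation_average S (\<lambda>x. cut x * g x) y\<bar> \<le> m * (unit_ball_vol DIM('a) * ((r + 1) / S) ^ DIM('a))"
      by (rule dilation_average_small[OF cg[OF that(1)]]) (use S r cut0 bg[OF that(2)] in auto)
    also have "\<dots> \<le> m * (c / 2)" using small m by (intro mult_left_mono) auto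
    finally show ?thesis .
  qed
  obtain g where g: "g \<in> {u. continuous_on UNIV u \<and> bounded (u ` UNIV)}" "\<And>x. T g x = g x"
  proof (rule contraction_fixpoint[of UNIV T])
    fix u :: "'a \<Rightarrow> real" assume u: "u \<in> {u. continuous_on UNIV u \<and> bounded (range u)}"
    then obtain m where m: "\<And>x. \<bar>u x\<bar> \<le> m" by (auto simp: bounded_iff)
    have cu: "continuous_on UNIV u" using u by simp
    have "continuous_on UNIV (T u)"
      unfolding T_def using c by (intro continuous_intros f cA[OF cu m]) auto
    moreover obtain F where F: "\<And>x. \<bar>f x\<bar> \<le> F" using f(2) by (auto simp: bounded_iff)
    have "\<bar>T u y\<bar> \<le> (F + m * (c / 2)) / c" for y
      unfolding T_def abs_divide using bA[OF cu m, of y] F[of y] c by (intro frac_le) auto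
    then have "bounded (range (T u))" by (auto simp: bounded_iff)
    ultimately show "T u \<in> {u. continuous_on UNIV u \<and> bounded (range u)}" by simp
  next
    fix u v :: "'a \<Rightarrow> real" and M x
    assume u: "u \<in> {u. continuous_on UNIV u \<and> bounded (range u)}" and v: "v \<in> {u. continuous_on UNIV u \<and> bounded (range u)}"
      and M: "\<And>x. x \<in> UNIV \<Longrightarrow> \<bar>u x - v x\<bar> \<le> M"
    have i: "integrable lborel (\<lambda>z. cap z * (cut (x - S *\<^sub>R z) * w (x - S *\<^sub>R z)))" if "continuous_on UNIV w" for w
    proof (rule integrable_compact_support[OF continuous_on_mult[OF continuous_on_cap] compact_cball[of 0 1]])
      show "continuous_on UNIV (\<lambda>z. cut (x - S *\<^sub>R z) * w (x - S *\<^sub>R z))"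
        by (rule continuous_on_compose2[OF cg[OF that]]) (auto intro!: continuous_intros)
    qed (auto simp: cap_zero)
    have "dilation_average S (\<lambda>x. cut x * u x) x - dilation_average S (\<lambda>x. cut x * v x) x =
      dilation_average S (\<lambda>x. cut x * (u x - v x)) x"
      unfolding dilation_average_def using i[of u] i[of v] u v by (simp add: algebra_simps)
    moreover have "\<bar>dilation_average S (\<lambda>x. cut x * (u x - v x)) x\<bar> \<le> M * (c / 2)"
      by (rule bA) (use u v M in \<open>auto intro: continuous_intros\<close>)
    moreover have "T u x - T v x = (dilation_average S (\<lambda>x. cut x * u x) x - dilation_average S (\<lambda>x. cut x * v x) x) / c"
      by (simp add: T_def diff_divide_distrib[symmetric])
    ultimately have "\<bar>T u x - T v x\<bar> = \<bar>dilation_average S (\<lambda>x. cut x * (u x - v x)) x\<bar> / c"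
      and "\<bar>dilation_average S (\<lambda>x. cut x * (u x - v x)) x\<bar> / c \<le> M * (c / 2) / c"
      using c by (simp_all only: abs_divide abs_of_pos divide_right_mono less_imp_le)
    then show "\<bar>T u x - T v x\<bar> \<le> M / 2" using c by simp
  qed auto
  have cont: "continuous_on UNIV g" using g by simp
  obtain m where m: "\<And>x. \<bar>g x\<bar> \<le> m" using g(1) by (auto simp: bounded_iff)
  have bgm: "\<bar>cut x * g x\<bar> \<le> m" for x by (rule bg[OF m])
  \<comment> \<open>For the fixed point \<open>g\<close> the averaging term equals
    \<open>c * g - f\<close>. On \<open>D\<close>, where \<open>cut\<close> is 1, the part
    \<open>c * g\<close> cancels against the main term of \<open>parametrix_pairing\<close>, which
    leaves \<open>- f\<close>.\<close>
  define v where "v = parametrix S (\<lambda>x. cut x * g x)"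
  have "continuous_on UNIV v" unfolding v_def
    by (rule parametrix_continuous[OF cg[OF cont] bgm]) (use S in auto)
  moreover have "weak_solution (\<lambda>_. 0) D f v"
    unfolding weak_solution_def
  proof
    fix \<phi> assume \<phi>: "\<phi> \<in> test_functions D"
    note ti = test_function_integrable[OF D(1) \<phi>]
    have cD: "continuous_on D h" if "continuous_on UNIV h" for h :: "'a \<Rightarrow> real"
      using continuous_on_subset[OF that] by auto
    have A: "dilation_average S (\<lambda>x. cut x * g x) y = c * g y - f y" for y
      using g(2)[of y] c by (simp add: T_def field_simps)
    have "(LBINT x:D. v x * (laplacian \<phi> x - 0 * \<phi> x)) = (LBINT x. v x * laplacian \<phi> x)"
      using ti(4)[OF cD[OF \<open>continuous_on UNIV v\<close>]] by simp
    also have "\<dots> = (LBINT y. (c * g y - f y) * \<phi> y) - c * (LBINT y. cut y * g y * \<phi> y)"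
      unfolding v_def c_def
      using parametrix_pairing[OF cg[OF cont] bgm _ \<phi>] S A by (simp add: c_def)
    also have "(LBINT y. cut y * g y * \<phi> y) = (LBINT y. g y * \<phi> y)"
    proof (rule Bochner_Integration.integral_cong[OF refl])
      fix y show "cut y * g y * \<phi> y = g y * \<phi> y"
        using cut1[of y] test_functions_zero[OF \<phi>, of y] by (cases "y \<in> D") auto
    qed
    also have "(LBINT y. (c * g y - f y) * \<phi> y) = (LBINT y. c * (g y * \<phi> y) - f y * \<phi> y)"
      by (simp add: algebra_simps)
    also have "\<dots> = c * (LBINT y. g y * \<phi> y) - (LBINT y. f y * \<phi> y)"
      using ti(1)[OF cD[OF cont]] ti(1)[OF cD[OF f(1)]] by simp
    finally show "(LBINT x:D. v x * (laplacian \<phi> x - 0 * \<phi> x)) = - (LBINT x:D. f x * \<phi> x)"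
      using ti(3)[OF cD[OF f(1)]] by simp
  qed
  ultimately show ?thesis using that by blast
qed

section \<open>The Dirichlet problem and continuation in the potential\<close>

definition dirichlet_solution ::
  "('a::euclidean_space \<Rightarrow> real) \<Rightarrow> 'a set \<Rightarrow> ('a \<Rightarrow> real) \<Rightarrow> ('a \<Rightarrow> real) \<Rightarrow> ('a \<Rightarrow> real) \<Rightarrow> bool" where
  "dirichlet_solution q D f g u \<longleftrightarrow>
     continuous_on (closure D) u \<and> (\<forall>x\<in>frontier D. u x = g x) \<and> weak_solution q D f u"

text \<open>Quantified over all data, so that the property passes from one potential to the next:
  the new problem is solved through the old one with changing right-hand sides.\<close>

definition dirichlet_solvable :: "('a::euclidean_space \<Rightarrow> real) \<Rightarrow> 'a set \<Rightarrow> bool" where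
  "dirichlet_solvable q D \<longleftrightarrow> (\<forall>f g. continuous_on (closure D) f \<longrightarrow> continuous_on (frontier D) g \<longrightarrow>
     (\<exists>u. dirichlet_solution q D f g u))"

text \<open>The difference has right-hand side 0 and boundary values 0, so the a priori bound
  applies with \<open>M = 0\<close>.\<close>

lemma dirichlet_solution_unique:
  assumes D: "open D" "bounded D" and q: "continuous_on D q" "\<And>x. x \<in> D \<Longrightarrow> q x \<ge> 0"
    and f: "continuous_on D f" and u: "dirichlet_solution q D f g u" "dirichlet_solution q D f g v"
    and x: "x \<in> closure D"
  shows "u x = v x"
proof -
  obtain r where r: "D \<subseteq> cball 0 r" using D(2) by (auto simp: bounded_iff subset_iff)
  have c: "continuous_on (closure D) u" "continuous_on (closure D) v" using u by (auto simp: dirichlet_solution_def)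
  have cD: "continuous_on D u" "continuous_on D v" using c continuous_on_subset closure_subset by blast+
  have "weak_solution q D (\<lambda>x. f x + - 1 * f x) (\<lambda>x. u x + - 1 * v x)"
    using u by (intro weak_solution_linear D q cD f) (auto simp: dirichlet_solution_def)
  from weak_solution_bound[OF D(1) r _ q _ _ _ this, of 0 x]
  show ?thesis using c u x by (auto simp: dirichlet_solution_def intro: continuous_intros)
qed

lemma dirichlet_solvable_laplace:
  fixes D :: "'a::euclidean_space set"
  assumes D: "open D" "bounded D" and reg: "laplace_regular D"
  shows "dirichlet_solvable (\<lambda>_. 0) D"
  unfolding dirichlet_solvable_def
proof (intro allI impI)
  fix f g :: "'a \<Rightarrow> real" assume f: "continuous_on (closure D) f" and g: "continuous_on (frontier D) g"
  have cD: "compact (closure D)" using D(2) by (simp add: compact_closure)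
  have "bounded (f ` closure D)" by (intro compact_imp_bounded compact_continuous_image f cD)
  then obtain B where B: "B > 0" "\<And>x. x \<in> closure D \<Longrightarrow> norm (f x) \<le> B" by (auto simp: bounded_pos)
  have cl: "closedin (top_of_set UNIV) (closure D)" by simp
  \<comment> \<open>The averages behind \<open>poisson_solution\<close> look outside
    \<open>D\<close>, so the right-hand side has to be continuous and bounded on the whole
    space.\<close>
  obtain F where F: "continuous_on UNIV F" "\<And>x. x \<in> closure D \<Longrightarrow> F x = f x" "\<And>x. norm (F x) \<le> B"
  proof (rule Tietze[OF f cl less_imp_le[OF B(1)] B(2)])
    fix F assume "continuous_on UNIV F" "\<And>x. x \<in> closure D \<Longrightarrow> F x = f x" "\<And>x. x \<in> UNIV \<Longrightarrow> norm (F x) \<le> B"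
    then show thesis using that[of F] by simp
  qed
  have "bounded (range F)" using F(3) by (auto simp: bounded_iff)
  with F(1) obtain v where v: "continuous_on UNIV v" "weak_solution (\<lambda>_. 0) D F v"
    using poisson_solution[OF D] by blast
  have "continuous_on (frontier D) (\<lambda>x. g x - v x)"
    using v(1) by (intro continuous_intros g) (auto intro: continuous_on_subset)
  then obtain h where h: "continuous_on (closure D) h" "\<And>x. x \<in> frontier D \<Longrightarrow> h x = g x - v x" "harmonic_on D h"
    using reg unfolding laplace_regular_def by blast
  have hw: "weak_solution (\<lambda>_. 0) D (\<lambda>_. 0) h"
    using h(3) by (intro weak_solution_cong[OF D(1) _ refl classical_weak_solution[OF D(1) continuous_on_const]])
      (auto simp: harmonic_on_def)
  have sub: "D \<subseteq> closure D" by (rule closure_subset)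
  have "weak_solution (\<lambda>_. 0) D (\<lambda>x. F x + 1 * 0) (\<lambda>x. v x + 1 * h x)"
    using v F(1) h(1) sub by (intro weak_solution_linear D hw) (auto intro: continuous_on_subset)
  then have "weak_solution (\<lambda>_. 0) D f (\<lambda>x. v x + h x)"
    by (rule weak_solution_cong[OF D(1), rotated -1]) (use F(2) sub in auto)
  moreover have "continuous_on (closure D) (\<lambda>x. v x + h x)"
    using v(1) by (intro continuous_intros h(1)) (auto intro: continuous_on_subset)
  ultimately show "\<exists>u. dirichlet_solution (\<lambda>_. 0) D f g u"
    using h(2) by (intro exI[of _ "\<lambda>x. v x + h x"]) (simp add: dirichlet_solution_def)
qed

text \<open>A small change \<open>a' - a\<close> of the potential is moved to the right-hand side; the fixed point
  argument uses that the solution operator is bounded by \<open>r\<^sup>2\<close> whatever the potential.\<close>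

lemma dirichlet_solvable_step:
  fixes D :: "'a::euclidean_space set"
  assumes D: "open D" "D \<subseteq> cball 0 r" and r: "r > 0"
    and a: "continuous_on (closure D) a" "\<And>x. x \<in> D \<Longrightarrow> a x \<ge> 0" and a': "continuous_on (closure D) a'"
    and close: "\<And>x. x \<in> D \<Longrightarrow> \<bar>a' x - a x\<bar> * r\<^sup>2 \<le> 1 / 2"
    and sol: "dirichlet_solvable a D"
  shows "dirichlet_solvable a' D"
  unfolding dirichlet_solvable_def
proof (intro allI impI)
  fix f g :: "'a \<Rightarrow> real" assume f: "continuous_on (closure D) f" and g: "continuous_on (frontier D) g"
  have cpt: "compact (closure D)" using bounded_subset[OF bounded_cball D(2)] by (simp add: compact_closure)
  have sub: "D \<subseteq> closure D" by (rule closure_subset)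
  have cD: "continuous_on D h" if "continuous_on (closure D) h" for h :: "'a \<Rightarrow> real"
    using continuous_on_subset[OF that sub] .
  define F where "F w x = f x - (a' x - a x) * w x" for w x
  have cF: "continuous_on (closure D) (F w)" if "continuous_on (closure D) w" for w
    unfolding F_def by (intro continuous_intros f a a' that)
  define T where "T w = (SOME u. dirichlet_solution a D (F w) g u)" for w
  have T: "dirichlet_solution a D (F w) g (T w)" if "continuous_on (closure D) w" for w
    unfolding T_def by (rule someI_ex[OF sol[unfolded dirichlet_solvable_def, rule_format, OF cF[OF that] g]])
  obtain u where u: "u \<in> {u. continuous_on (closure D) u \<and> bounded (u ` closure D)}" "\<And>x. x \<in> closure D \<Longrightarrow> T u x = u x"
  proof (rule contraction_fixpoint[of "closure D" T])
    fix w :: "'a \<Rightarrow> real" assume "w \<in> {u. continuous_on (closure D) u \<and> bounded (u ` closure D)}"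
    then have "continuous_on (closure D) (T w)" using T by (auto simp: dirichlet_solution_def)
    then show "T w \<in> {u. continuous_on (closure D) u \<and> bounded (u ` closure D)}"
      by (auto intro: compact_imp_bounded compact_continuous_image cpt)
  next
    fix w w' :: "'a \<Rightarrow> real" and M x
    assume w: "w \<in> {u. continuous_on (closure D) u \<and> bounded (u ` closure D)}"
      and w': "w' \<in> {u. continuous_on (closure D) u \<and> bounded (u ` closure D)}"
      and M: "\<And>x. x \<in> closure D \<Longrightarrow> \<bar>w x - w' x\<bar> \<le> M" and x: "x \<in> closure D"
    have M0: "M \<ge> 0" using M[OF x] by linarith
    have cw: "continuous_on (closure D) w" "continuous_on (closure D) w'" using w w' by auto
    note Tw = T[OF cw(1), unfolded dirichlet_solution_def] T[OF cw(2), unfolded dirichlet_solution_def]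
    have "weak_solution a D (\<lambda>x. F w x + - 1 * F w' x) (\<lambda>x. T w x + - 1 * T w' x)"
      by (intro weak_solution_linear D cD a cF cw) (use Tw in auto)
    \<comment> \<open>The a priori bound multiplies by \<open>r\<^sup>2\<close>, so
      \<open>|a' - a| \<le> 1 / (2 * r\<^sup>2)\<close> yields exactly the contraction factor
      1/2.\<close>
    moreover have "\<bar>F w x + - 1 * F w' x\<bar> \<le> M / (2 * r\<^sup>2)" if x: "x \<in> D" for x
    proof -
      have "F w x + - 1 * F w' x = (a' x - a x) * (w' x - w x)" by (simp add: F_def algebra_simps)
      then have "\<bar>F w x + - 1 * F w' x\<bar> = \<bar>a' x - a x\<bar> * \<bar>w x - w' x\<bar>" by (simp add: abs_mult abs_minus_commute)
      also have "\<dots> \<le> (1 / (2 * r\<^sup>2)) * M"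
      proof (rule mult_mono)
        show "\<bar>a' x - a x\<bar> \<le> 1 / (2 * r\<^sup>2)" using close[OF x] r by (simp add: field_simps)
      qed (use M x sub in auto)
      finally show ?thesis by simp
    qed
    ultimately have "\<bar>T w x + - 1 * T w' x\<bar> \<le> M / (2 * r\<^sup>2) * r\<^sup>2"
      by (intro weak_solution_bound[OF D _ cD[OF a(1)] a(2), where f = "\<lambda>x. F w x + - 1 * F w' x"])
        (use Tw M0 x cD[OF cF[OF cw(1)]] cD[OF cF[OF cw(2)]] in \<open>auto intro!: continuous_intros\<close>)
    then show "\<bar>T w x - T w' x\<bar> \<le> M / 2" using r by simp
  qed auto
  have cu: "continuous_on (closure D) u" using u by simp
  note Tu = T[OF cu, unfolded dirichlet_solution_def]
  have wu: "weak_solution a D (F u) u"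
    by (rule weak_solution_cong[OF D(1) _ _ conjunct2[OF conjunct2[OF Tu]]]) (use u(2) sub in auto)
  have "weak_solution a' D f u"
    unfolding weak_solution_def
  proof
    fix \<phi> assume \<phi>: "\<phi> \<in> test_functions D"
    note ti = test_function_integrable[OF D(1) \<phi>]
    have cc: "continuous_on D (\<lambda>x. u x * a x)" "continuous_on D (\<lambda>x. u x * a' x)"
      by (intro cD continuous_intros cu a a')+
    have "(LBINT x:D. u x * (laplacian \<phi> x - a x * \<phi> x)) = - (LBINT x. F u x * \<phi> x)"
      using wu \<phi> ti(3)[OF cD[OF cF[OF cu]]] by (simp add: weak_solution_def)
    also have "(LBINT x. F u x * \<phi> x) = (LBINT x. f x * \<phi> x - u x * a' x * \<phi> x + u x * a x * \<phi> x)"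
      by (simp add: F_def algebra_simps)
    also have "\<dots> = (LBINT x. f x * \<phi> x) - (LBINT x. u x * a' x * \<phi> x) + (LBINT x. u x * a x * \<phi> x)"
      using ti(1)[OF cD[OF f]] ti(1)[OF cc(1)] ti(1)[OF cc(2)] by simp
    finally show "(LBINT x:D. u x * (laplacian \<phi> x - a' x * \<phi> x)) = - (LBINT x:D. f x * \<phi> x)"
      unfolding schroedinger_pairing[OF D(1) \<phi> cD[OF cu] cD[OF a(1)]] schroedinger_pairing[OF D(1) \<phi> cD[OF cu] cD[OF a']]
      using ti(3)[OF cD[OF f]] by simp
  qed
  moreover have "u x = g x" if "x \<in> frontier D" for x
    using Tu u(2)[of x] that by (auto simp: frontier_def)
  ultimately show "\<exists>u. dirichlet_solution a' D f g u" using cu by (auto simp: dirichlet_solution_def)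
qed

lemma dirichlet_solvable_potential:
  fixes D :: "'a::euclidean_space set"
  assumes D: "open D" "bounded D" "laplace_regular D"
    and q: "continuous_on (closure D) q" "\<And>x. x \<in> D \<Longrightarrow> q x \<ge> 0"
  shows "dirichlet_solvable q D"
proof -
  obtain r where r: "r > 0" "D \<subseteq> cball 0 r" using D(2) by (auto simp: bounded_pos subset_iff)
  have sub: "D \<subseteq> closure D" by (rule closure_subset)
  have "compact (closure D)" using D(2) by (simp add: compact_closure)
  then have "bounded (q ` closure D)" by (intro compact_imp_bounded compact_continuous_image q)
  then obtain Q where Q: "Q > 0" "\<And>x. x \<in> closure D \<Longrightarrow> \<bar>q x\<bar> \<le> Q" by (auto simp: bounded_pos)
  \<comment> \<open>Each of the \<open>N\<close> steps changes the potential by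
    \<open>q / N\<close>, and \<open>N > 2 * Q * r\<^sup>2\<close> meets the smallness condition of
    \<open>dirichlet_solvable_step\<close>.\<close>
  obtain N :: nat where N: "2 * (Q * r\<^sup>2) < real N" using reals_Archimedean2 by blast
  have N0: "real N > 0"   proof -
    have "Q * r\<^sup>2 > 0" using Q(1) r(1) by simp
    then show ?thesis using N by linarith
  qed
  have "dirichlet_solvable (\<lambda>x. real j / real N * q x) D" for j
  proof (induction j)
    case 0
    then show ?case using dirichlet_solvable_laplace[OF D] by simp
  next
    case (Suc j)
    show ?case
    proof (rule dirichlet_solvable_step[OF D(1) r(2,1) _ _ _ _ Suc])
      fix x assume x: "x \<in> D"
      have "real (Suc j) / real N * q x - real j / real N * q x = q x / real N"
        using N0 by (simp add: field_simps)
      then have "\<bar>real (Suc j) / real N * q x - real j / real N * q x\<bar> * r\<^sup>2 = \<bar>q x\<bar> * r\<^sup>2 / real N"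
        using N0 by (simp add: abs_divide)
      also have "\<dots> \<le> Q * r\<^sup>2 / real N"
        using Q(2)[of x] x sub N0 by (intro divide_right_mono mult_right_mono) auto
      also have "\<dots> \<le> 1 / 2" using N N0 by (simp add: field_simps)
      finally show "\<bar>real (Suc j) / real N * q x - real j / real N * q x\<bar> * r\<^sup>2 \<le> 1 / 2" .
    qed (use q N0 in \<open>auto intro!: continuous_intros\<close>)
  qed
  from this[of N] show ?thesis using N0 by simp
qed

section \<open>Root systems and the ground state transform\<close>

text \<open>Fubini and translation invariance applied to \<open>cap x * g (x + T y)\<close>, as in the proof of the
  uniqueness of Haar measure; the constant is \<open>1\<close> because \<open>cap\<close> is radial.\<close>

lemma integral_linear_involution:
  fixes T :: "'a::euclidean_space \<Rightarrow> 'a" and g :: "'a \<Rightarrow> real"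
  assumes T: "linear T" "\<And>x. norm (T x) = norm x" "\<And>x. T (T x) = x"
    and g: "continuous_on UNIV g" and K: "compact K" "\<And>x. x \<notin> K \<Longrightarrow> g x = 0"
  shows "(LBINT y. g (T y)) = (LBINT y. g y)"
proof -
  define c where "c = (LBINT z. cap (z::'a))"
  have c: "c > 0" unfolding c_def by (rule integral_cap_pos)
  have cT: "continuous_on UNIV T" using T(1) by (simp add: linear_continuous_on linear_conv_bounded_linear)
  obtain B r where B: "B \<ge> 0" "\<And>x. \<bar>g x\<bar> \<le> B" "r > 0" "K \<subseteq> cball 0 r"
    using compact_support_bounds[OF g K] by metis
  have g0: "g x = 0" if "norm x > r" for x using K(2)[of x] B(4) that by force
  have Tadd: "T (x + y) = T x + T y" "T (x - y) = T x - T y" for x y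
    using T(1) by (simp_all add: linear_add linear_diff)
  have bd: "\<bar>cap z * g y\<bar> \<le> 1 * B" for z y :: 'a
    unfolding abs_mult using cap_bounds[of z] by (intro mult_mono B) auto
  have "c * (LBINT y. g (T y)) = (LBINT x. cap (x::'a) * (LBINT y. g (T y)))"
    by (simp add: c_def)
  also have "\<dots> = (LBINT x. LBINT y. cap x * g (x + T y))"
  proof (rule Bochner_Integration.integral_cong[OF refl])
    fix x
    \<comment> \<open>As \<open>T\<close> is a linear involution,
      \<open>T (T x + y) = x + T y\<close>: a shift of the argument of \<open>g\<close> by
      \<open>x\<close> is a translation of \<open>y\<close> by \<open>T x\<close>.\<close>
    have "(LBINT y. g (T (T x + y))) = (LBINT y. g (T y))"
      by (rule integral_lborel_translation[OF borel_measurable_continuous_comp[OF g cT]])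
    then show "cap x * (LBINT y. g (T y)) = (LBINT y. cap x * g (x + T y))"
      by (simp add: Tadd T)
  qed
  also have "\<dots> = (LBINT y. LBINT x. cap x * g (x + T y))"
  proof (rule fubini_bounded_support(1)[OF _ bd, where R = "r + 1"])
    show "(\<lambda>p. cap (fst p) * g (fst p + T (snd p))) \<in> borel_measurable borel"
      by (intro borel_measurable_times borel_measurable_continuous_comp[OF g] 
         borel_measurable_continuous_comp[OF continuous_on_cap] continuous_intros continuous_on_compose2[OF cT]) auto
    show "cap x * g (x + T y) = 0" if n: "r + 1 < norm x \<or> r + 1 < norm y" for x y
    proof (cases "norm x \<ge> 1")
      case False
      then have "norm (x + T y) > r" using n norm_diff_ineq[of "T y" x] T(2)[of y] B(3) by (simp add: add.commute)
      then show ?thesis using g0 by simp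
    qed (simp add: cap_zero)
  qed
  also have "\<dots> = (LBINT y. LBINT x. cap (x - T y) * g x)"
  proof (rule Bochner_Integration.integral_cong[OF refl])
    fix y
    have "(\<lambda>x. cap (x - T y) * g x) \<in> borel_measurable borel"
      by (intro borel_measurable_times borel_measurable_continuous_onI[OF g]
         borel_measurable_continuous_comp[OF continuous_on_cap] continuous_intros)
    from integral_lborel_translation[OF this, of "T y"]
    show "(LBINT x. cap x * g (x + T y)) = (LBINT x. cap (x - T y) * g x)"
      by (simp add: add.commute)
  qed
  also have "\<dots> = (LBINT x. LBINT y. cap (x - T y) * g x)"
  proof (rule fubini_bounded_support(1)[OF _ bd, where R = "r + 1"])
    show "(\<lambda>p. cap (snd p - T (fst p)) * g (snd p)) \<in> borel_measurable borel"
      by (intro borel_measurable_times borel_measurable_continuous_comp[OF g] 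
         borel_measurable_continuous_comp[OF continuous_on_cap] continuous_intros continuous_on_compose2[OF cT]) auto
    show "cap (x - T y) * g x = 0" if n: "r + 1 < norm y \<or> r + 1 < norm x" for x y
    proof (cases "norm x > r")
      case False
      then have "norm (x - T y) \<ge> 1" using n norm_triangle_ineq3[of x "T y"] T(2)[of y] by simp
      then show ?thesis by (simp add: cap_zero)
    qed (simp add: g0)
  qed
  also have "\<dots> = (LBINT x. c * g x)"
  proof (rule Bochner_Integration.integral_cong[OF refl])
    fix x
    \<comment> \<open>Applying the isometry \<open>T\<close> inside the norm turns
      \<open>x - T y\<close> into \<open>T x - y\<close>; after that the inner integral is a
      translate of the one defining \<open>c\<close>.\<close>
    have "cap (x - T y) = cap (- T x + y)" for y
    proof -
      have "norm (x - T y) = norm (T (x - T y))" by (simp only: T)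
      also have "\<dots> = norm (- T x + y)" by (simp add: Tadd T norm_minus_commute)
      finally show ?thesis by (simp add: cap_def)
    qed
    moreover have "(LBINT y. cap (- T x + y)) = c"
      unfolding c_def by (rule integral_lborel_translation[OF borel_measurable_continuous_onI[OF continuous_on_cap]])
    ultimately show "(LBINT y. cap (x - T y) * g x) = c * g x" by simp
  qed
  finally show ?thesis using c by simp
qed

text \<open>Finitely many hyperplanes do not cover the space. In the induction \<open>v\<close> is
  moved along the new vector \<open>w\<close>, and each vector excludes at most one multiple of
  \<open>w\<close>.\<close>

lemma ex_nonorthogonal:
  fixes W :: "'a::real_inner set"
  assumes "finite W" "0 \<notin> W"
  obtains v where "\<And>w. w \<in> W \<Longrightarrow> w \<bullet> v \<noteq> 0"
proof -
  have "\<exists>v. \<forall>w\<in>W. w \<bullet> v \<noteq> 0"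
    using assms
  proof (induction W)
    case (insert w W)
    then obtain v where v: "\<forall>u\<in>W. u \<bullet> v \<noteq> 0" by auto
    obtain s :: real where s: "s \<notin> (\<lambda>u. - (u \<bullet> v) / (u \<bullet> w)) ` insert w W"
      using ex_new_if_finite[OF infinite_UNIV_char_0, of "(\<lambda>u. - (u \<bullet> v) / (u \<bullet> w)) ` insert w W"]
        insert.hyps(1) by auto
    have "u \<bullet> (v + s *\<^sub>R w) \<noteq> 0" if u: "u \<in> insert w W" for u
    proof (cases "u \<bullet> w = 0")
      case True
      then have "u \<noteq> w" using insert.prems by auto
      then show ?thesis using True u v by (auto simp: inner_add_right)
    next
      case False
      moreover have "s \<noteq> - (u \<bullet> v) / (u \<bullet> w)" using s u by auto
      ultimately show ?thesis by (auto simp: inner_add_right field_simps eq_neg_iff_add_eq_0)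
    qed
    then show ?case by blast
  qed simp
  then show ?thesis using that by blast
qed

section \<open>Reflections\<close>

lemma reflection_linear: "linear (reflection a)"
  by (rule linearI) (simp_all add: reflection_def inner_add_left algebra_simps add_divide_distrib)

lemma reflection_adjoint: "reflection a x \<bullet> y = x \<bullet> reflection a y"
  by (simp add: reflection_def inner_diff_left inner_diff_right inner_commute)

lemma reflection_self: "a \<noteq> 0 \<Longrightarrow> reflection a a = - a"
  by (simp add: reflection_def power2_norm_eq_inner scaleR_2)

lemma reflection_minus: "reflection a (- x) = - reflection a x"
  using linear_neg[OF reflection_linear] .

lemma reflection_reflection: "a \<noteq> 0 \<Longrightarrow> reflection a (reflection a x) = x"
  by (simp add: reflection_def inner_diff_left power2_norm_eq_inner field_simps)

lemma reflection_norm: "a \<noteq> 0 \<Longrightarrow> norm (reflection a x) = norm x"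
  by (simp add: norm_eq_sqrt_inner reflection_adjoint reflection_reflection)

lemma reflection_orthogonal: "y \<bullet> a = 0 \<Longrightarrow> reflection a y = y"
  by (simp add: reflection_def)

lemma reflection_inner_root: "a \<noteq> 0 \<Longrightarrow> reflection a x \<bullet> a = - (x \<bullet> a)"
  by (simp add: reflection_adjoint reflection_self)

lemma continuous_on_reflection: "continuous_on S (reflection a)"
  using linear_continuous_on[of "reflection a" S] reflection_linear[of a] by (simp add: linear_conv_bounded_linear)

section \<open>Symmetric sums over roots\<close>

locale dunkl =
  fixes R Rp :: "'a::euclidean_space set" and k :: "'a \<Rightarrow> real"
  assumes root_system: "root_system R" and positive: "positive_subsystem R Rp"
    and multiplicity: "multiplicity_function R k"
begin

lemma finite_R: "finite R" and zero_notin_R: "0 \<notin> R"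
  using root_system by (auto simp: root_system_def)

lemma Rp_subset: "Rp \<subseteq> R"
  using positive by (auto simp: positive_subsystem_def)

lemma finite_Rp: "finite Rp" using Rp_subset finite_R finite_subset by blast

lemma root_nonzero: "a \<in> R \<Longrightarrow> a \<noteq> 0" using zero_notin_R by auto

lemma proportional_roots: "a \<in> R \<Longrightarrow> c *\<^sub>R a \<in> R \<Longrightarrow> c *\<^sub>R a = a \<or> c *\<^sub>R a = - a"
  using root_system unfolding root_system_def by blast

lemma reflection_root: "a \<in> R \<Longrightarrow> reflection a ` R = R"
  using root_system by (auto simp: root_system_def)

lemma minus_root: "a \<in> R \<Longrightarrow> - a \<in> R"
  using root_system by (auto simp: root_system_def)

lemma R_split: "R = Rp \<union> uminus ` Rp" "Rp \<inter> uminus ` Rp = {}"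
proof -
  obtain b where b: "\<And>a. a \<in> R \<Longrightarrow> a \<bullet> b \<noteq> 0" "Rp = {a\<in>R. a \<bullet> b > 0}"
    using positive by (auto simp: positive_subsystem_def)
  show "Rp \<inter> uminus ` Rp = {}" using b by auto
  have "a \<in> Rp \<union> uminus ` Rp" if a: "a \<in> R" for a
  proof (cases "a \<bullet> b > 0")
    case False
    then have "- a \<in> Rp" using b a minus_root[OF a] by (auto simp: not_less le_less)
    then have "- (- a) \<in> uminus ` Rp" by blast
    then show ?thesis by simp
  qed (use b a in auto)
  moreover have "a \<in> R" if "a \<in> Rp \<union> uminus ` Rp" for a
    using that Rp_subset minus_root by auto
  ultimately show "R = Rp \<union> uminus ` Rp" by blast
qed

lemma k_reflection: "a \<in> R \<Longrightarrow> b \<in> R \<Longrightarrow> k (reflection a b) = k b"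
proof -
  assume a: "a \<in> R" and b: "b \<in> R"
  have "reflection a \<circ> id \<in> reflection_group R"
    by (rule reflection_group.comp[OF reflection_group.id a])
  then have "k ((reflection a \<circ> id) b) = k b"
    using multiplicity b unfolding multiplicity_function_def by blast
  then show ?thesis by simp
qed

lemma k_minus: "a \<in> R \<Longrightarrow> k (- a) = k a"
  using k_reflection[of a a] reflection_self[OF root_nonzero] by simp

lemma sum_even_roots:
  fixes F :: "'a \<Rightarrow> real"
  assumes "\<And>b. b \<in> R \<Longrightarrow> F (- b) = F b"
  shows "(\<Sum>b\<in>R. F b) = 2 * (\<Sum>b\<in>Rp. F b)"
proof -
  have "(\<Sum>b\<in>R. F b) = (\<Sum>b\<in>Rp. F b) + (\<Sum>b\<in>uminus ` Rp. F b)"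
    by (subst R_split(1)) (rule sum.union_disjoint, simp_all add: finite_Rp R_split(2))
  also have "(\<Sum>b\<in>uminus ` Rp. F b) = (\<Sum>b\<in>Rp. F (- b))"
    by (simp add: sum.reindex)
  also have "\<dots> = (\<Sum>b\<in>Rp. F b)"
    by (rule sum.cong) (use assms Rp_subset in auto)
  finally show ?thesis by simp
qed

text \<open>A reflection need not map \<open>Rp\<close> to itself, but it permutes \<open>R\<close>;
  for even summands the sum over \<open>Rp\<close> is half of that over \<open>R\<close>.\<close>

lemma sum_reflection:
  fixes F :: "'a \<Rightarrow> real"
  assumes "a \<in> R" "\<And>b. b \<in> R \<Longrightarrow> F (- b) = F b"
  shows "(\<Sum>b\<in>Rp. F (reflection a b)) = (\<Sum>b\<in>Rp. F b)"
proof -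
  have inj: "inj_on (reflection a) R"
    by (rule inj_on_inverseI[of _ "reflection a"]) (simp add: reflection_reflection root_nonzero assms(1))
  have mem: "reflection a b \<in> R" if "b \<in> R" for b using reflection_root[OF assms(1)] that by auto
  have "2 * (\<Sum>b\<in>Rp. F (reflection a b)) = (\<Sum>b\<in>R. F (reflection a b))"
    by (rule sum_even_roots[symmetric]) (simp add: reflection_minus assms mem)
  also have "\<dots> = (\<Sum>b\<in>reflection a ` R. F b)" by (simp add: sum.reindex[OF inj])
  also have "\<dots> = 2 * (\<Sum>b\<in>Rp. F b)"
    by (simp add: reflection_root[OF assms(1)] sum_even_roots assms)
  finally show ?thesis by simp
qed

text \<open>The term \<open>b = a\<close> vanishes by the convention \<open>x / 0 = 0\<close>.\<close>

lemma residue_zero: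
  assumes "a \<in> Rp" "y \<bullet> a = 0"
  shows "(\<Sum>b\<in>Rp. k b * (a \<bullet> b) / (y \<bullet> b)) = 0"
proof -
  let ?F = "\<lambda>b. k b * (a \<bullet> b) / (y \<bullet> b)"
  have a: "a \<in> R" using assms Rp_subset by auto
  have "(\<Sum>b\<in>Rp. ?F (reflection a b)) = (\<Sum>b\<in>Rp. ?F b)"
    by (rule sum_reflection[OF a]) (simp add: k_minus)
  \<comment> \<open>The reflection fixes \<open>y\<close> and negates \<open>a\<close>, so it keeps
    the denominators and flips the numerators; the sum equals its own negative.\<close>
  moreover have "(\<Sum>b\<in>Rp. ?F (reflection a b)) = (\<Sum>b\<in>Rp. - ?F b)"
  proof (rule sum.cong[OF refl])
    fix b assume "b \<in> Rp"
    then show "?F (reflection a b) = - ?F b"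
      using Rp_subset a assms(2) by (simp add: subset_iff k_reflection reflection_self root_nonzero
        reflection_orthogonal flip: reflection_adjoint)
  qed
  ultimately show ?thesis by (simp add: sum_negf)
qed

text \<open>On a generic line through \<open>x\<close> the off-diagonal terms expand into partial fractions, and all
  residues vanish by \<open>residue_zero\<close>.\<close>

lemma norm_log_gradient:
  assumes x: "\<And>a. a \<in> Rp \<Longrightarrow> x \<bullet> a \<noteq> 0"
  shows "(norm (\<Sum>a\<in>Rp. (k a / (x \<bullet> a)) *\<^sub>R a))\<^sup>2 = dunkl_potential Rp k x"
proof -
  \<comment> \<open>\<open>d a b \<bullet> v \<noteq> 0\<close> says that the line through
    \<open>x\<close> in direction \<open>v\<close> meets the hyperplanes of \<open>a\<close> and
    \<open>b\<close> in different points. Such a \<open>v\<close> exists because distinct positive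
    roots are not proportional.\<close>
  define d where "d a b = (x \<bullet> b) *\<^sub>R a - (x \<bullet> a) *\<^sub>R b" for a b
  have d: "d a b \<noteq> 0" if "a \<in> Rp" "b \<in> Rp" "a \<noteq> b" for a b
  proof
    assume "d a b = 0"
    then have "(1 / (x \<bullet> a)) *\<^sub>R ((x \<bullet> a) *\<^sub>R b) = (1 / (x \<bullet> a)) *\<^sub>R ((x \<bullet> b) *\<^sub>R a)" by (simp add: d_def)
    then have "b = ((x \<bullet> b) / (x \<bullet> a)) *\<^sub>R a" using x[OF that(1)] by simp
    then have "b = a \<or> b = - a"
      using proportional_roots[of a "(x \<bullet> b) / (x \<bullet> a)"] that Rp_subset by auto
    then show False using that R_split(2) by auto
  qed
  have "finite (Rp \<union> (\<lambda>(a, b). d a b) ` ({p \<in> Rp \<times> Rp. fst p \<noteq> snd p}))" using finite_Rp by auto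
  moreover have "0 \<notin> Rp \<union> (\<lambda>(a, b). d a b) ` ({p \<in> Rp \<times> Rp. fst p \<noteq> snd p})"
    using zero_notin_R Rp_subset d by force
  ultimately obtain v where v: "\<And>w. w \<in> Rp \<union> (\<lambda>(a, b). d a b) ` ({p \<in> Rp \<times> Rp. fst p \<noteq> snd p}) \<Longrightarrow> w \<bullet> v \<noteq> 0"
    using ex_nonorthogonal by (metis (no_types, lifting))
  have v1: "a \<bullet> v \<noteq> 0" if "a \<in> Rp" for a using v that by auto
  have v2: "d a b \<bullet> v \<noteq> 0" if "a \<in> Rp" "b \<in> Rp" "a \<noteq> b" for a b using v[of "d a b"] that by force
  \<comment> \<open>The point where that line meets the hyperplane of \<open>a\<close>.\<close>
  define y where "y a = x - ((x \<bullet> a) / (a \<bullet> v)) *\<^sub>R v" for a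
  have y0: "y a \<bullet> a = 0" if "a \<in> Rp" for a
    using v1[OF that] by (simp add: y_def inner_diff_left inner_commute[of v a])
  define A where "A a b = k b * (a \<bullet> b) / (y a \<bullet> b)" for a b
  have A: "(\<Sum>b\<in>Rp. A a b) = 0" if "a \<in> Rp" for a
    unfolding A_def by (rule residue_zero[OF that y0[OF that]])
  define c where "c a b = k a * k b * (a \<bullet> b) / ((x \<bullet> a) * (x \<bullet> b))" for a b
  \<comment> \<open>Partial fractions along the line: one term for the zero of \<open>a\<close>, one
    for the zero of \<open>b\<close>. If \<open>a = b\<close>, both vanish, since
    \<open>y a \<bullet> a = 0\<close> makes the quotient 0, and the diagonal term remains.\<close>
  have pf: "c a b = (k a / (x \<bullet> a)) * A a b + (k b / (x \<bullet> b)) * A b a + (if a = b then c a a else 0)"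
    if ab: "a \<in> Rp" "b \<in> Rp" for a b
  proof (cases "a = b")
    case True
    then show ?thesis using y0 ab by (simp add: A_def)
  next
    case False
    define D where "D = (x \<bullet> b) * (a \<bullet> v) - (x \<bullet> a) * (b \<bullet> v)"
    have D: "D \<noteq> 0" using v2[OF ab False] by (simp add: D_def d_def inner_diff_left)
    have y: "y a \<bullet> b = D / (a \<bullet> v)" "y b \<bullet> a = - D / (b \<bullet> v)"
      using v1[OF ab(1)] v1[OF ab(2)] by (simp_all add: y_def D_def inner_diff_left inner_commute[of v] field_simps)
    have "(k a / (x \<bullet> a)) * A a b + (k b / (x \<bullet> b)) * A b a
      = k a * k b * (a \<bullet> b) * ((a \<bullet> v) / ((x \<bullet> a) * D) - (b \<bullet> v) / ((x \<bullet> b) * D))"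
      unfolding A_def y by (simp add: algebra_simps inner_commute[of b a])
    also have "(a \<bullet> v) / ((x \<bullet> a) * D) - (b \<bullet> v) / ((x \<bullet> b) * D) = D / ((x \<bullet> a) * (x \<bullet> b) * D)"
    proof -
      have "(a \<bullet> v) / ((x \<bullet> a) * D) - (b \<bullet> v) / ((x \<bullet> b) * D)
        = ((x \<bullet> b) * (a \<bullet> v) - (x \<bullet> a) * (b \<bullet> v)) / ((x \<bullet> a) * (x \<bullet> b) * D)"
        using D x[OF ab(1)] x[OF ab(2)] by (simp add: field_simps)
      then show ?thesis unfolding D_def[symmetric] .
    qed
    finally show ?thesis using False D by (simp add: c_def)
  qed
  have "(norm (\<Sum>a\<in>Rp. (k a / (x \<bullet> a)) *\<^sub>R a))\<^sup>2 = (\<Sum>a\<in>Rp. \<Sum>b\<in>Rp. c a b)"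
    unfolding power2_norm_eq_inner inner_sum_left inner_sum_right
    by (intro sum.cong refl) (simp add: c_def inner_commute mult_ac)
  also have "\<dots> = (\<Sum>a\<in>Rp. \<Sum>b\<in>Rp. (k a / (x \<bullet> a)) * A a b + (k b / (x \<bullet> b)) * A b a + (if a = b then c a a else 0))"
    by (intro sum.cong refl pf)
  also have "\<dots> = (\<Sum>a\<in>Rp. (k a / (x \<bullet> a)) * (\<Sum>b\<in>Rp. A a b)) + (\<Sum>a\<in>Rp. \<Sum>b\<in>Rp. (k b / (x \<bullet> b)) * A b a)
     + (\<Sum>a\<in>Rp. c a a)"
    by (simp add: sum.distrib sum_distrib_left finite_Rp)
  also have "(\<Sum>a\<in>Rp. \<Sum>b\<in>Rp. (k b / (x \<bullet> b)) * A b a) = (\<Sum>b\<in>Rp. (k b / (x \<bullet> b)) * (\<Sum>a\<in>Rp. A b a))"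
    by (subst sum.swap) (simp add: sum_distrib_left)
  also have "(\<Sum>a\<in>Rp. c a a) = dunkl_potential Rp k x"
    unfolding dunkl_potential_def
    by (rule sum.cong) (simp_all add: c_def power_mult_distrib power_divide power2_norm_eq_inner[symmetric] power2_eq_square mult_ac)
  finally show ?thesis by (simp add: A)
qed

text \<open>The logarithm of \<open>sqrt w\<^sub>k\<close> off the hyperplanes. Its gradient is a
  plain sum over roots, and exponentials of its multiples give both \<open>sqrt w\<^sub>k\<close>
  and its inverse.\<close>

definition log_weight :: "'a \<Rightarrow> real" where
  "log_weight x = (\<Sum>a\<in>Rp. k a * ln \<bar>x \<bullet> a\<bar>)"

lemma dunkl_weight_eq:
  assumes x: "\<And>a. a \<in> Rp \<Longrightarrow> x \<bullet> a \<noteq> 0"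
  shows "dunkl_weight Rp k x = exp (2 * log_weight x)" "sqrt (dunkl_weight Rp k x) = exp (log_weight x)"
proof -
  have "dunkl_weight Rp k x = (\<Prod>a\<in>Rp. exp (2 * (k a * ln \<bar>x \<bullet> a\<bar>)))"
    unfolding dunkl_weight_def by (rule prod.cong) (use x in \<open>auto simp: powr_def\<close>)
  also have "\<dots> = exp (2 * log_weight x)"
    by (simp add: log_weight_def sum_distrib_left exp_sum finite_Rp)
  finally show "dunkl_weight Rp k x = exp (2 * log_weight x)" .
  moreover have "exp (2 * log_weight x) = (exp (log_weight x))\<^sup>2" by (simp add: exp_double)
  ultimately show "sqrt (dunkl_weight Rp k x) = exp (log_weight x)" by simp
qed

lemma log_weight_reflection: "a \<in> R \<Longrightarrow> log_weight (reflection a x) = log_weight x"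
proof -
  assume a: "a \<in> R"
  have "log_weight (reflection a x) = (\<Sum>b\<in>Rp. (\<lambda>b. k b * ln \<bar>x \<bullet> b\<bar>) (reflection a b))"
    unfolding log_weight_def
    by (rule sum.cong) (use Rp_subset a in \<open>auto simp: k_reflection reflection_adjoint\<close>)
  also have "\<dots> = log_weight x"
    unfolding log_weight_def by (rule sum_reflection[OF a]) (simp add: k_minus)
  finally show ?thesis .
qed

lemma reflection_regular:
  assumes "\<And>b. b \<in> Rp \<Longrightarrow> x \<bullet> b \<noteq> 0" "a \<in> R" "b \<in> Rp"
  shows "reflection a x \<bullet> b \<noteq> 0"
proof -
  have "reflection a b \<in> R" using reflection_root[OF assms(2)] assms(3) Rp_subset by auto
  then consider "reflection a b \<in> Rp" | "- reflection a b \<in> Rp" using R_split(1) by auto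
  then have "x \<bullet> reflection a b \<noteq> 0"
    by cases (use assms(1)[of "reflection a b"] assms(1)[of "- reflection a b"] in auto)
  then show ?thesis by (simp add: reflection_adjoint)
qed

lemma dunkl_weight_reflection:
  assumes "\<And>b. b \<in> Rp \<Longrightarrow> x \<bullet> b \<noteq> 0" "a \<in> R"
  shows "dunkl_weight Rp k (reflection a x) = dunkl_weight Rp k x"
  using dunkl_weight_eq(1)[OF assms(1)] dunkl_weight_eq(1)[OF reflection_regular[OF assms]]
  by (simp add: log_weight_reflection assms(2))

lemma C_on_exp_log_weight:
  assumes "open S" "\<And>x a. x \<in> S \<Longrightarrow> a \<in> Rp \<Longrightarrow> x \<bullet> a \<noteq> 0"
  shows "C_on n S (\<lambda>x. exp (c * log_weight x))"
proof -
  have "C_on n S (\<lambda>x. ln \<bar>x \<bullet> a\<bar>)" if "a \<in> Rp" for a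
    using C_on_ln_abs[OF assms(1) _ C_on_inner[OF assms(1), of n 0 a]] assms(2)[OF _ that] by simp
  then show ?thesis
    unfolding log_weight_def
    by (intro C_on_exp C_on_cmult C_on_sum assms(1))
qed

lemma log_weight_has_derivative:
  assumes "\<And>a. a \<in> Rp \<Longrightarrow> x \<bullet> a \<noteq> 0"
  shows "(log_weight has_derivative (\<lambda>h. \<Sum>a\<in>Rp. (k a / (x \<bullet> a)) * (h \<bullet> a))) (at x)"
proof -
  have "((\<lambda>x. k a * ln \<bar>x \<bullet> a\<bar>) has_derivative (\<lambda>h. k a * (inverse (x \<bullet> a) * (h \<bullet> a)))) (at x)"
    if "a \<in> Rp" for a
    by (intro has_derivative_mult_right has_derivative_ln_abs assms that) (auto intro!: derivative_eq_intros)
  then have "((\<lambda>x. \<Sum>a\<in>Rp. k a * ln \<bar>x \<bullet> a\<bar>) has_derivative (\<lambda>h. \<Sum>a\<in>Rp. k a * (inverse (x \<bullet> a) * (h \<bullet> a)))) (at x)"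
    by (rule has_derivative_sum)
  then show ?thesis by (simp add: log_weight_def[abs_def] divide_inverse mult.assoc)
qed

lemma exp_log_weight_gradient:
  assumes "\<And>a. a \<in> Rp \<Longrightarrow> x \<bullet> a \<noteq> 0"
  shows "partial_deriv b (\<lambda>x. exp (log_weight x)) x = exp (log_weight x) * (\<Sum>a\<in>Rp. (k a / (x \<bullet> a)) * (b \<bullet> a))"
  using partial_deriv_eq[OF has_derivative_exp[OF log_weight_has_derivative[OF assms]]] by simp

text \<open>With L for \<open>log_weight\<close>, the Laplacian of exp L is exp L times
  (|\<nabla>L|^2 + \<Delta>L). The first summand is the potential by
  \<open>norm_log_gradient\<close>, the second is the negative sum.\<close>

lemma exp_log_weight_laplacian:
  assumes S: "open S" "\<And>x a. x \<in> S \<Longrightarrow> a \<in> Rp \<Longrightarrow> x \<bullet> a \<noteq> 0" and x: "x \<in> S"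
  shows "laplacian (\<lambda>x. exp (log_weight x)) x =
    exp (log_weight x) * (dunkl_potential Rp k x - (\<Sum>a\<in>Rp. k a * (norm a)\<^sup>2 / (x \<bullet> a)\<^sup>2))"
proof -
  let ?s = "\<lambda>x. exp (log_weight x)"
  let ?g = "\<lambda>b x. \<Sum>a\<in>Rp. (k a / (x \<bullet> a)) * (b \<bullet> a)"
  have x0: "x \<bullet> a \<noteq> 0" if "a \<in> Rp" for a using S(2)[OF x that] .
  have 2: "partial_deriv b (partial_deriv b ?s) x =
    ?s x * ((?g b x)\<^sup>2 - (\<Sum>a\<in>Rp. k a * (b \<bullet> a)\<^sup>2 / (x \<bullet> a)\<^sup>2))" for b
  proof -
    have "partial_deriv b (partial_deriv b ?s) x = partial_deriv b (\<lambda>x. ?s x * ?g b x) x"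
      by (rule partial_deriv_cong_open[OF S(1) x]) (use exp_log_weight_gradient S(2) in auto)
    also have "\<dots> = ?s x * (\<Sum>a\<in>Rp. (- (k a * (b \<bullet> a)) / (x \<bullet> a)\<^sup>2) * (b \<bullet> a)) + ?s x * ?g b x * ?g b x"
    proof -
      have "(?g b has_derivative (\<lambda>h. \<Sum>a\<in>Rp. (- (k a * (h \<bullet> a)) / (x \<bullet> a)\<^sup>2) * (b \<bullet> a))) (at x)"
      proof (rule has_derivative_sum, rule has_derivative_mult_left)
        fix a assume a: "a \<in> Rp"
        show "((\<lambda>x. k a / (x \<bullet> a)) has_derivative (\<lambda>h. - (k a * (h \<bullet> a)) / (x \<bullet> a)\<^sup>2)) (at x)"
          using x0[OF a] by (auto intro!: derivative_eq_intros simp: power2_eq_square field_simps)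
      qed
      from partial_deriv_eq[OF has_derivative_mult[OF has_derivative_exp[OF log_weight_has_derivative[OF x0]] this], of b]
      show ?thesis by simp
    qed
    also have "\<dots> = ?s x * ((?g b x)\<^sup>2 - (\<Sum>a\<in>Rp. k a * (b \<bullet> a)\<^sup>2 / (x \<bullet> a)\<^sup>2))"
    proof -
      have "(\<Sum>a\<in>Rp. (- (k a * (b \<bullet> a)) / (x \<bullet> a)\<^sup>2) * (b \<bullet> a)) = - (\<Sum>a\<in>Rp. k a * (b \<bullet> a)\<^sup>2 / (x \<bullet> a)\<^sup>2)"
        by (simp add: power2_eq_square sum_negf mult_ac)
      then show ?thesis by (simp only: power2_eq_square[of "?g b x"]) (simp add: algebra_simps)
    qed
    finally show ?thesis .
  qed
  have g: "(\<Sum>b\<in>Basis. (?g b x)\<^sup>2) = dunkl_potential Rp k x"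
  proof -
    let ?v = "\<Sum>a\<in>Rp. (k a / (x \<bullet> a)) *\<^sub>R a"
    have "?g b x = ?v \<bullet> b" for b by (simp add: inner_sum_left inner_commute[of b])
    then have "(\<Sum>b\<in>Basis. (?g b x)\<^sup>2) = ?v \<bullet> ?v"
      by (simp only: power2_eq_square flip: euclidean_inner)
    also have "\<dots> = (norm ?v)\<^sup>2" by (rule power2_norm_eq_inner[symmetric])
    finally have "(\<Sum>b\<in>Basis. (?g b x)\<^sup>2) = (norm ?v)\<^sup>2" .
    then show ?thesis using norm_log_gradient[OF x0] by simp
  qed
  have n: "(\<Sum>b\<in>Basis. \<Sum>a\<in>Rp. k a * (b \<bullet> a)\<^sup>2 / (x \<bullet> a)\<^sup>2) = (\<Sum>a\<in>Rp. k a * (norm a)\<^sup>2 / (x \<bullet> a)\<^sup>2)"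
  proof (subst sum.swap, rule sum.cong[OF refl])
    fix a :: 'a
    have "(norm a)\<^sup>2 = a \<bullet> a" by (rule power2_norm_eq_inner)
    also have "\<dots> = (\<Sum>b\<in>Basis. (b \<bullet> a)\<^sup>2)"
      by (subst euclidean_inner) (simp add: power2_eq_square inner_commute[of a])
    finally have "(norm a)\<^sup>2 = (\<Sum>b\<in>Basis. (b \<bullet> a)\<^sup>2)" .
    then show "(\<Sum>b\<in>Basis. k a * (b \<bullet> a)\<^sup>2 / (x \<bullet> a)\<^sup>2) = k a * (norm a)\<^sup>2 / (x \<bullet> a)\<^sup>2"
      by (simp add: sum_distrib_left sum_divide_distrib)
  qed
  show ?thesis
    unfolding laplacian_def 2 sum_distrib_left[symmetric] sum_subtractf g n ..
qed

text \<open>Where \<open>\<phi>\<close> vanishes at the reflected points, the difference part of the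
  Dunkl Laplacian is multiplication by the negative sum of
  \<open>k a * |a|\<^sup>2 / (x \<bullet> a)\<^sup>2\<close>. The Laplacian of
  \<open>exp (log_weight x)\<close> contains the same sum, so only the potential is left over; the
  first order terms agree by the product rule.\<close>

lemma ground_state_transform:
  assumes S: "open S" "\<And>x a. x \<in> S \<Longrightarrow> a \<in> Rp \<Longrightarrow> x \<bullet> a \<noteq> 0" and x: "x \<in> S" and \<phi>: "C_on 2 S \<phi>"
    and refl0: "\<And>a. a \<in> Rp \<Longrightarrow> \<phi> (reflection a x) = 0"
  shows "exp (log_weight x) * dunkl_laplacian Rp k \<phi> x =
    laplacian (\<lambda>x. exp (log_weight x) * \<phi> x) x - dunkl_potential Rp k x * (exp (log_weight x) * \<phi> x)"
proof -
  let ?s = "\<lambda>x. exp (log_weight x)"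
  have x0: "x \<bullet> a \<noteq> 0" if "a \<in> Rp" for a using S(2)[OF x that] .
  have s: "C_on 2 S ?s" using C_on_exp_log_weight[OF S, of 2 1] by simp
  have gs: "gradient ?s x = ?s x *\<^sub>R (\<Sum>a\<in>Rp. (k a / (x \<bullet> a)) *\<^sub>R a)"
  proof (rule euclidean_eqI)
    fix b :: 'a assume b: "b \<in> Basis"
    have "?s differentiable (at x)" 
      by (rule C_on_differentiable[OF _ x]) (rule s[unfolded numeral_2_eq_2])
    then have "gradient ?s x \<bullet> b = ?s x * (\<Sum>a\<in>Rp. (k a / (x \<bullet> a)) * (b \<bullet> a))"
      by (simp add: gradient_inner exp_log_weight_gradient x0)
    then show "gradient ?s x \<bullet> b = (?s x *\<^sub>R (\<Sum>a\<in>Rp. (k a / (x \<bullet> a)) *\<^sub>R a)) \<bullet> b"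
      by (simp add: inner_sum_left inner_commute[of b])
  qed
  have "laplacian (\<lambda>x. ?s x * \<phi> x) x = ?s x * laplacian \<phi> x + 2 * (gradient ?s x \<bullet> gradient \<phi> x) + laplacian ?s x * \<phi> x"
    by (rule laplacian_mult[OF S(1) x s \<phi>])
  also have "laplacian ?s x = ?s x * (dunkl_potential Rp k x - (\<Sum>a\<in>Rp. k a * (norm a)\<^sup>2 / (x \<bullet> a)\<^sup>2))"
    by (rule exp_log_weight_laplacian[OF S x])
  also have "gradient ?s x \<bullet> gradient \<phi> x = ?s x * (\<Sum>a\<in>Rp. k a * ((gradient \<phi> x \<bullet> a) / (x \<bullet> a)))"
    unfolding gs inner_scaleR_left inner_sum_left by (simp add: inner_commute[of _ "gradient \<phi> x"])
  finally have L: "laplacian (\<lambda>x. ?s x * \<phi> x) x = ?s x * (laplacian \<phi> x + 2 * (\<Sum>a\<in>Rp. k a * ((gradient \<phi> x \<bullet> a) / (x \<bullet> a)))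
     + (dunkl_potential Rp k x - (\<Sum>a\<in>Rp. k a * (norm a)\<^sup>2 / (x \<bullet> a)\<^sup>2)) * \<phi> x)"
    by (simp add: algebra_simps)
  have "dunkl_laplacian Rp k \<phi> x = laplacian \<phi> x + (\<Sum>a\<in>Rp. 2 * (k a * ((gradient \<phi> x \<bullet> a) / (x \<bullet> a)))
      - k a * (norm a)\<^sup>2 / (x \<bullet> a)\<^sup>2 * \<phi> x)"
    unfolding dunkl_laplacian_def sum_distrib_left
    by (intro arg_cong2[where f = "(+)"] refl sum.cong) (simp add: refl0 inner_commute[of _ x] right_diff_distrib)
  also have "\<dots> = laplacian \<phi> x + 2 * (\<Sum>a\<in>Rp. k a * ((gradient \<phi> x \<bullet> a) / (x \<bullet> a)))
     - (\<Sum>a\<in>Rp. k a * (norm a)\<^sup>2 / (x \<bullet> a)\<^sup>2) * \<phi> x"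
    by (simp add: sum_subtractf sum_distrib_left sum_distrib_right)
  finally have E: "dunkl_laplacian Rp k \<phi> x = laplacian \<phi> x + 2 * (\<Sum>a\<in>Rp. k a * ((gradient \<phi> x \<bullet> a) / (x \<bullet> a)))
     - (\<Sum>a\<in>Rp. k a * (norm a)\<^sup>2 / (x \<bullet> a)\<^sup>2) * \<phi> x" .
  show ?thesis unfolding L E by (simp add: algebra_simps)
qed

end

section \<open>The Dirichlet problem for the Dunkl Laplacian\<close>

locale dunkl_domain = dunkl R Rp k
  for R Rp :: "'a::euclidean_space set" and k :: "'a \<Rightarrow> real" +
  fixes D \<Omega> :: "'a set"
  assumes open_D: "open D" and bounded_D: "bounded D"
    and open_\<Omega>: "open \<Omega>" and connected_\<Omega>: "connected \<Omega>"
    and \<Omega>_subset: "\<Omega> \<subseteq> - (\<Union>a\<in>Rp. orth_hyperplane a)" and closure_D: "closure D \<subseteq> \<Omega>"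
begin

abbreviation s :: "'a \<Rightarrow> real" where "s x \<equiv> exp (log_weight x)"

lemma \<Omega>_regular: "x \<in> \<Omega> \<Longrightarrow> a \<in> Rp \<Longrightarrow> x \<bullet> a \<noteq> 0"
  using \<Omega>_subset by (auto simp: orth_hyperplane_def)

lemma D_closure: "x \<in> D \<Longrightarrow> x \<in> closure D" using closure_subset by blast

lemma D_\<Omega>: "D \<subseteq> \<Omega>" using closure_subset closure_D by blast

text \<open>Connectedness enters here: \<open>a\<close> takes opposite signs at \<open>x\<close> and
  at its reflection, so with both points in \<open>\<Omega>\<close> it would vanish somewhere in
  \<open>\<Omega>\<close>.\<close>

lemma reflection_notin_\<Omega>:
  assumes x: "x \<in> \<Omega>" and a: "a \<in> Rp"
  shows "reflection a x \<notin> \<Omega>"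
proof
  assume r: "reflection a x \<in> \<Omega>"
  have i: "a \<bullet> reflection a x = - (a \<bullet> x)"
    using reflection_inner_root[of a x] root_nonzero Rp_subset a by (auto simp: inner_commute)
  have "\<exists>z\<in>\<Omega>. a \<bullet> z = 0"
  proof (cases "a \<bullet> x \<le> 0")
    case True
    then show ?thesis using connected_ivt_hyperplane[OF connected_\<Omega> x r, of a 0] i by auto
  next
    case False
    then show ?thesis using connected_ivt_hyperplane[OF connected_\<Omega> r x, of a 0] i by auto
  qed
  then show False using \<Omega>_regular[OF _ a] by (auto simp: inner_commute)
qed

text \<open>Stated up to the boundary, so that the composition of \<open>f\<close>, continuous off
  \<open>D\<close>, with a reflection is continuous on the closure; this makes \<open>N f\<close> an
  admissible right-hand side.\<close>

lemma reflection_notin_D: "x \<in> closure D \<Longrightarrow> a \<in> Rp \<Longrightarrow> reflection a x \<notin> D"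
  using reflection_notin_\<Omega> closure_D D_\<Omega> by blast

lemma weight_\<Omega>: "x \<in> \<Omega> \<Longrightarrow> dunkl_weight Rp k x = s x * s x" "x \<in> \<Omega> \<Longrightarrow> sqrt (dunkl_weight Rp k x) = s x"
  using dunkl_weight_eq[of x] \<Omega>_regular[of x] by (auto simp flip: exp_add)

lemma C_on_s: "C_on n \<Omega> (\<lambda>x. exp (c * log_weight x))"
  by (rule C_on_exp_log_weight[OF open_\<Omega> \<Omega>_regular])

lemma continuous_on_s: "continuous_on \<Omega> s"
  using C_on_imp_continuous_on[OF C_on_s[of 0 1]] by simp

text \<open>The cases \<open>c = 1\<close> and \<open>c = - 1\<close> are mutually inverse, so the
  test functions of the two problems correspond bijectively.\<close>

lemma test_function_weight:
  assumes "\<phi> \<in> test_functions D"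
  shows "(\<lambda>x. exp (c * log_weight x) * \<phi> x) \<in> test_functions D"
  by (rule test_functionsI[OF open_D test_functions_supp(1,2)[OF assms]])
    (use C_on_mult[OF open_D C_on_subset[OF C_on_s D_\<Omega>] C_on_subset[OF test_functions_C_on[OF assms] subset_UNIV]] in
      \<open>auto simp: not_supp\<close>)

lemma continuous_on_potential: "continuous_on \<Omega> (dunkl_potential Rp k)"
  unfolding dunkl_potential_def[abs_def] by (intro continuous_intros) (use \<Omega>_regular in auto)

lemma continuous_on_nonlocal:
  assumes "continuous_on (- D) f"
  shows "continuous_on (closure D) (dunkl_nonlocal Rp k f)"
proof -
  have "continuous_on (closure D) (\<lambda>x. f (reflection a x))" if "a \<in> Rp" for a
    by (rule continuous_on_compose2[OF assms continuous_on_reflection]) (use reflection_notin_D that in auto)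
  then show ?thesis
    unfolding dunkl_nonlocal_def[abs_def]
    by (intro continuous_intros) (use \<Omega>_regular closure_D in auto)
qed

text \<open>The nonlocal part of \<open>\<Delta>\<^sub>k \<phi>\<close> lives on the reflected copies of \<open>D\<close>, which are disjoint from
  \<open>D\<close>; substituting \<open>x \<mapsto> \<sigma>\<^sub>a x\<close> moves it back to \<open>D\<close> with coefficients taken from outside.\<close>

lemma dunkl_pairing:
  assumes h: "continuous_on UNIV h" and \<phi>: "\<phi> \<in> test_functions D"
  defines "\<psi> \<equiv> \<lambda>x. s x * \<phi> x"
  shows "(LBINT x. h x * dunkl_laplacian Rp k \<phi> x * dunkl_weight Rp k x) =
    (LBINT x:D. (h x * s x) * (laplacian \<psi> x - dunkl_potential Rp k x * \<psi> x))
    + (LBINT x:D. (s x * dunkl_nonlocal Rp k h x) * \<psi> x)"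
proof -
  let ?q = "dunkl_potential Rp k" and ?w = "dunkl_weight Rp k"
  have \<psi>: "\<psi> \<in> test_functions D" using test_function_weight[OF \<phi>, of 1] by (simp add: \<psi>_def)
  define A where "A x = (h x * s x) * (laplacian \<psi> x - ?q x * \<psi> x)" for x
  define G where "G a y = \<phi> y * ?w y * h (reflection a y) / (y \<bullet> a)\<^sup>2" for a y
  have A0: "A x = 0" if "x \<notin> D" for x using test_functions_zero[OF \<psi> that] by (simp add: A_def)
  have C2: "C_on 2 D \<phi>" by (rule C_on_subset[OF test_functions_C_on[OF \<phi>] subset_UNIV])
  have reg: "x \<bullet> a \<noteq> 0" if "x \<in> D" "a \<in> Rp" for x a using \<Omega>_regular that D_\<Omega> by blast
  have cD: "continuous_on D s" "continuous_on D ?q" "continuous_on D h" "continuous_on D \<phi>"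
    using continuous_on_subset[OF continuous_on_s D_\<Omega>] continuous_on_subset[OF continuous_on_potential D_\<Omega>]
      continuous_on_subset[OF h] C_on_imp_continuous_on[OF C2] by auto
  have aR: "a \<in> R" "a \<noteq> 0" if "a \<in> Rp" for a using that Rp_subset root_nonzero by auto
  \<comment> \<open>Reflection preserves the weight and \<open>(x \<bullet> a)\<^sup>2\<close>. The
    invariance of the weight is used off the hyperplanes, which holds when the reflected point is in
    \<open>D\<close>; otherwise both sides vanish with \<open>\<phi>\<close>.\<close>
  have wG: "\<phi> (reflection a x) * ?w x * h x / (x \<bullet> a)\<^sup>2 = G a (reflection a x)" if a: "a \<in> Rp" for a x
  proof (cases "reflection a x \<in> D")
    case True
    have "?w (reflection a (reflection a x)) = ?w (reflection a x)"
      by (rule dunkl_weight_reflection[OF reg[OF True] aR(1)[OF a]])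
    then show ?thesis using aR(2)[OF a] by (simp add: G_def reflection_reflection reflection_inner_root)
  next
    case False
    then show ?thesis using test_functions_zero(1)[OF \<phi>] by (simp add: G_def)
  qed
  \<comment> \<open>The two contributions live on disjoint sets: on \<open>D\<close> the reflected
    values of \<open>\<phi>\<close> vanish; off \<open>D\<close> the derivatives and the value of
    \<open>\<phi>\<close> vanish, and only the reflected values remain.\<close>
  have pt: "h x * dunkl_laplacian Rp k \<phi> x * ?w x = A x + (\<Sum>a\<in>Rp. k a * (norm a)\<^sup>2 * G a (reflection a x))" for x
  proof (cases "x \<in> D")
    case True
    have z: "\<phi> (reflection a x) = 0" if "a \<in> Rp" for a
      using test_functions_zero(1)[OF \<phi> reflection_notin_D[OF D_closure[OF True] that]] .
    have "s x * dunkl_laplacian Rp k \<phi> x = laplacian \<psi> x - ?q x * \<psi> x"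
      unfolding \<psi>_def by (rule ground_state_transform[OF open_D reg True C2 z])
    then have "A x = h x * s x * (s x * dunkl_laplacian Rp k \<phi> x)" by (simp add: A_def)
    moreover have "(\<Sum>a\<in>Rp. k a * (norm a)\<^sup>2 * G a (reflection a x)) = 0"
      by (rule sum.neutral) (simp add: G_def z)
    ultimately show ?thesis using weight_\<Omega>(1) True D_\<Omega> by (auto simp: mult_ac)
  next
    case False
    have x: "x \<notin> supp \<phi>" using False test_functions_supp(2)[OF \<phi>] by auto
    have "dunkl_laplacian Rp k \<phi> x = (\<Sum>a\<in>Rp. k a * (norm a)\<^sup>2 * (\<phi> (reflection a x) / (x \<bullet> a)\<^sup>2))"
      unfolding dunkl_laplacian_def sum_distrib_left laplacian_not_supp[OF x] gradient_not_supp[OF x] not_supp[OF x]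
      by (simp add: inner_commute[of x] mult.assoc)
    then have "h x * dunkl_laplacian Rp k \<phi> x * ?w x =
       (\<Sum>a\<in>Rp. k a * (norm a)\<^sup>2 * (\<phi> (reflection a x) * ?w x * h x / (x \<bullet> a)\<^sup>2))"
      by (simp add: sum_distrib_left sum_distrib_right mult_ac)
    then show ?thesis using A0[OF False] by (simp add: wG)
  qed
  have cG: "continuous_on D (G a)" if "a \<in> Rp" for a
  proof -
    have "continuous_on D (\<lambda>y. \<phi> y * (s y * s y) * h (reflection a y) / (y \<bullet> a)\<^sup>2)"
      by (intro continuous_intros continuous_on_compose2[OF h continuous_on_reflection] cD) (use reg that in auto)
    then show ?thesis
      by (rule continuous_on_cong[THEN iffD1, OF refl, rotated]) (use weight_\<Omega>(1) D_\<Omega> in \<open>auto simp: G_def\<close>)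
  qed
  have G0: "G a x = 0" if "x \<notin> supp \<phi>" for a x using not_supp[OF that] by (simp add: G_def)
  note supp = test_functions_supp(1,2)[OF \<phi>]
  have cGU: "continuous_on UNIV (G a)" if "a \<in> Rp" for a
    by (rule continuous_on_zero_extension[OF open_D supp cG[OF that] G0])
  have iG: "integrable lborel (G a)" if "a \<in> Rp" for a
    by (rule integrable_compact_support[OF cGU[OF that] supp(1) G0])
  have iGr: "integrable lborel (\<lambda>x. G a (reflection a x))" if a: "a \<in> Rp" for a
  proof (rule integrable_compact_support)
    show "continuous_on UNIV (\<lambda>x. G a (reflection a x))"
      by (rule continuous_on_compose2[OF cGU[OF a] continuous_on_reflection]) auto
    show "compact (reflection a ` supp \<phi>)"
      by (rule compact_continuous_image[OF continuous_on_reflection supp(1)])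
    show "G a (reflection a x) = 0" if "x \<notin> reflection a ` supp \<phi>" for x
    proof (rule G0)
      show "reflection a x \<notin> supp \<phi>"
        using that reflection_reflection[OF aR(2)[OF a], of x] by (metis image_eqI)
    qed
  qed
  have Gr: "(LBINT x. G a (reflection a x)) = (LBINT x. G a x)" if a: "a \<in> Rp" for a
    by (rule integral_linear_involution[OF reflection_linear _ _ cGU[OF a] supp(1) G0])
      (simp_all add: reflection_norm reflection_reflection aR[OF a])
  have iA: "integrable lborel A"
  proof -
    have "A = (\<lambda>x. h x * s x * laplacian \<psi> x - h x * s x * ?q x * \<psi> x)"
      by (simp add: fun_eq_iff A_def algebra_simps)
    moreover have "integrable lborel (\<lambda>x. h x * s x * laplacian \<psi> x - h x * s x * ?q x * \<psi> x)"
      by (intro Bochner_Integration.integrable_diff test_function_integrable(1,2)[OF open_D \<psi>] continuous_on_mult cD)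
    ultimately show ?thesis by simp
  qed
  have "(LBINT x. h x * dunkl_laplacian Rp k \<phi> x * ?w x) =
    (LBINT x. A x) + (\<Sum>a\<in>Rp. k a * (norm a)\<^sup>2 * (LBINT x. G a x))"
    unfolding pt using iA iGr Gr by (simp add: Bochner_Integration.integral_sum)
  also have "(\<Sum>a\<in>Rp. k a * (norm a)\<^sup>2 * (LBINT x. G a x)) = (LBINT x. (\<Sum>a\<in>Rp. k a * (norm a)\<^sup>2 * G a x))"
    using iG by (simp add: Bochner_Integration.integral_sum)
  also have "\<dots> = (LBINT x. (s x * dunkl_nonlocal Rp k h x) * \<psi> x)"
  proof (rule Bochner_Integration.integral_cong[OF refl])
    fix x show "(\<Sum>a\<in>Rp. k a * (norm a)\<^sup>2 * G a x) = (s x * dunkl_nonlocal Rp k h x) * \<psi> x"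
    proof (cases "x \<in> D")
      case True
      then have "?w x = s x * s x" using weight_\<Omega>(1) D_\<Omega> by auto
      then show ?thesis
        by (simp add: G_def \<psi>_def dunkl_nonlocal_def sum_distrib_left sum_distrib_right mult_ac)
    next
      case False
      then show ?thesis using test_functions_zero(1)[OF \<phi> False] by (simp add: G_def \<psi>_def)
    qed
  qed
  also have "\<dots> = (LBINT x:D. (s x * dunkl_nonlocal Rp k h x) * \<psi> x)"
    using test_functions_zero(1)[OF \<psi>] by (subst set_integral_supp) auto
  also have "(LBINT x. A x) = (LBINT x:D. A x)"
    using A0 by (simp add: set_integral_supp)
  finally show ?thesis by (simp add: A_def)
qed

definition source :: "('a \<Rightarrow> real) \<Rightarrow> 'a \<Rightarrow> real" where
  "source f x = sqrt (dunkl_weight Rp k x) * dunkl_nonlocal Rp k f x"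

lemma continuous_on_sqrt_weight: "continuous_on (closure D) (\<lambda>x. sqrt (dunkl_weight Rp k x))"
  by (rule continuous_on_cong[THEN iffD2, OF refl _ continuous_on_subset[OF continuous_on_s closure_D]])
    (use weight_\<Omega>(2) closure_D in auto)

lemma sqrt_weight_pos: "x \<in> closure D \<Longrightarrow> sqrt (dunkl_weight Rp k x) > 0"
  using weight_\<Omega>(2) closure_D by (metis exp_gt_zero subsetD)

lemma continuous_on_source:
  "continuous_on (- D) f \<Longrightarrow> continuous_on (closure D) (source f)"
  unfolding source_def[abs_def]
  by (intro continuous_on_mult continuous_on_sqrt_weight continuous_on_nonlocal)

lemma dunkl_solution_iff:
  assumes h: "continuous_on UNIV h" "\<And>x. x \<notin> D \<Longrightarrow> h x = f x"
  shows "dunkl_dirichlet_solution Rp k D f h \<longleftrightarrow>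
    weak_solution (dunkl_potential Rp k) D (source f) (\<lambda>x. h x * sqrt (dunkl_weight Rp k x))"
proof -
  have N: "dunkl_nonlocal Rp k h x = dunkl_nonlocal Rp k f x" if "x \<in> D" for x
    unfolding dunkl_nonlocal_def
    by (rule sum.cong[OF refl]) (use h(2) reflection_notin_D[OF D_closure[OF that]] in auto)
  have D: "D \<in> sets lborel" using open_D by simp
  have eq: "(LBINT x. h x * dunkl_laplacian Rp k \<phi> x * dunkl_weight Rp k x) =
    (LBINT x:D. (h x * sqrt (dunkl_weight Rp k x)) * (laplacian \<psi> x - dunkl_potential Rp k x * \<psi> x))
    + (LBINT x:D. source f x * \<psi> x)"
    if "\<phi> \<in> test_functions D" "\<psi> = (\<lambda>x. s x * \<phi> x)" for \<phi> \<psi>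
    unfolding dunkl_pairing[OF h(1) that(1)] that(2)
    by (intro arg_cong2[where f = "(+)"] set_lebesgue_integral_cong[OF D])
      (use weight_\<Omega>(2) D_\<Omega> N in \<open>auto simp: source_def\<close>)
  show ?thesis
  proof
    assume sol: "dunkl_dirichlet_solution Rp k D f h"
    show "weak_solution (dunkl_potential Rp k) D (source f) (\<lambda>x. h x * sqrt (dunkl_weight Rp k x))"
      unfolding weak_solution_def
    proof
      fix \<psi> assume \<psi>: "\<psi> \<in> test_functions D"
      \<comment> \<open>The Dunkl equation is tested with \<open>\<psi>\<close> divided by
        \<open>sqrt w\<^sub>k\<close>, so that the transformed test function is
        \<open>\<psi>\<close> itself.\<close>
      have \<phi>: "(\<lambda>x. exp (- 1 * log_weight x) * \<psi> x) \<in> test_functions D" by (rule test_function_weight[OF \<psi>])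
      have "\<psi> = (\<lambda>x. s x * (exp (- 1 * log_weight x) * \<psi> x))" by (simp add: fun_eq_iff exp_minus)
      from eq[OF \<phi> this] sol \<phi>
      show "(LBINT x:D. (h x * sqrt (dunkl_weight Rp k x)) * (laplacian \<psi> x - dunkl_potential Rp k x * \<psi> x)) =
        - (LBINT x:D. source f x * \<psi> x)"
        by (simp add: dunkl_dirichlet_solution_def)
    qed
  next
    assume w: "weak_solution (dunkl_potential Rp k) D (source f) (\<lambda>x. h x * sqrt (dunkl_weight Rp k x))"
    have "(LBINT x. h x * dunkl_laplacian Rp k \<phi> x * dunkl_weight Rp k x) = 0" if \<phi>: "\<phi> \<in> test_functions D" for \<phi>
    proof -
      have "(\<lambda>x. s x * \<phi> x) \<in> test_functions D" using test_function_weight[OF \<phi>, of 1] by simp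
      then show ?thesis using eq[OF \<phi> refl] w by (simp add: weak_solution_def)
    qed
    then show "dunkl_dirichlet_solution Rp k D f h" using h by (simp add: dunkl_dirichlet_solution_def)
  qed
qed

end

text \<open>Uniqueness determines a solution on the closure only; its extensional representative
  \<open>restrict u (closure D)\<close> is what the definite description picks.\<close>

lemma the_dirichlet_solution:
  assumes D: "open D" "bounded D" and q: "continuous_on D q" "\<And>x. x \<in> D \<Longrightarrow> q x \<ge> 0"
    and f: "continuous_on D f" and u: "dirichlet_solution q D f g u" and x: "x \<in> closure D"
  shows "(THE h. h \<in> extensional (closure D) \<and> dirichlet_solution q D f g h) x = u x"
proof -
  have "(THE h. h \<in> extensional (closure D) \<and> dirichlet_solution q D f g h) = restrict u (closure D)"
  proof (rule the_equality)
    have "weak_solution q D f (restrict u (closure D))"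
      by (rule weak_solution_cong[OF D(1) _ _ conjunct2[OF conjunct2[OF u[unfolded dirichlet_solution_def]]]])
        (use closure_subset[of D] in auto)
    moreover have "continuous_on (closure D) (restrict u (closure D))"
      using u by (simp add: dirichlet_solution_def cong: continuous_on_cong)
    ultimately show "restrict u (closure D) \<in> extensional (closure D) \<and> dirichlet_solution q D f g (restrict u (closure D))"
      using u by (auto simp: dirichlet_solution_def frontier_def)
  next
    fix h assume h: "h \<in> extensional (closure D) \<and> dirichlet_solution q D f g h"
    then have "h x = u x" if "x \<in> closure D" for x
      using dirichlet_solution_unique[OF D q f _ u that] by simp
    then show "h = restrict u (closure D)" using h by (auto simp: extensional_def restrict_def)
  qed
  then show ?thesis using x by simp
qed

lemma H_schroedinger_eq_the:
  "H_schroedinger q D g = (THE h. h \<in> extensional (closure D) \<and> dirichlet_solution q D (\<lambda>_. 0) g h)"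
  by (simp add: H_schroedinger_def dirichlet_solution_def weak_solution_def)

lemma G_schroedinger_eq_the:
  "G_schroedinger q D f = (THE h. h \<in> extensional (closure D) \<and> dirichlet_solution q D f (\<lambda>_. 0) h)"
  by (simp add: G_schroedinger_def dirichlet_solution_def weak_solution_def)

context dunkl_domain
begin

lemma dunkl_dirichlet:
  assumes reg: "laplace_regular D" and f: "continuous_on (- D) f"
  shows "\<exists>!h. dunkl_dirichlet_solution Rp k D f h"
    and "x \<in> D \<Longrightarrow> H_dunkl Rp k D f x = 1 / sqrt (dunkl_weight Rp k x) *
         (H_schroedinger (dunkl_potential Rp k) D (\<lambda>y. f y * sqrt (dunkl_weight Rp k y)) x
          + G_schroedinger (dunkl_potential Rp k) D
              (\<lambda>y. sqrt (dunkl_weight Rp k y) * dunkl_nonlocal Rp k f y) x)"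
proof -
  let ?q = "dunkl_potential Rp k" and ?r = "\<lambda>x. sqrt (dunkl_weight Rp k x)"
  let ?g = "\<lambda>y. f y * ?r y"
  have q: "continuous_on (closure D) ?q" "continuous_on D ?q" "?q x \<ge> 0" for x
    using continuous_on_subset[OF continuous_on_potential closure_D] 
      continuous_on_subset[OF continuous_on_potential D_\<Omega>] by (auto simp: dunkl_potential_def intro: sum_nonneg)
  have sol: "dirichlet_solvable ?q D"
    by (rule dirichlet_solvable_potential[OF open_D bounded_D reg q(1) q(3)])
  have F: "continuous_on (closure D) (source f)" "continuous_on D (source f)"
    using continuous_on_source[OF f] continuous_on_subset[OF continuous_on_source[OF f] closure_subset] by auto
  have frontier_D: "frontier D \<subseteq> closure D" "frontier D \<subseteq> - D"
    using open_D by (auto simp: frontier_def interior_open)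
  have g: "continuous_on (frontier D) ?g"
    by (intro continuous_on_mult continuous_on_subset[OF f frontier_D(2)]
        continuous_on_subset[OF continuous_on_sqrt_weight frontier_D(1)])
  obtain u1 where u1: "dirichlet_solution ?q D (\<lambda>_. 0) ?g u1"
    using sol g unfolding dirichlet_solvable_def by (metis continuous_on_const)
  obtain u2 where u2: "dirichlet_solution ?q D (source f) (\<lambda>_. 0) u2"
    using sol F(1) unfolding dirichlet_solvable_def by (metis continuous_on_const)
  define u where "u x = u1 x + 1 * u2 x" for x
  have cu: "continuous_on (closure D) u1" "continuous_on (closure D) u2"
    using u1 u2 by (auto simp: dirichlet_solution_def)
  have u: "dirichlet_solution ?q D (source f) ?g u"
  proof -
    have "weak_solution ?q D (\<lambda>x. 0 + 1 * source f x) u"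
      unfolding u_def
      by (rule weak_solution_linear[OF open_D q(2) _ _ continuous_on_const F(2)])
        (use u1 u2 cu continuous_on_subset[OF _ closure_subset] in \<open>auto simp: dirichlet_solution_def\<close>)
    then show ?thesis
      using u1 u2 by (auto simp: dirichlet_solution_def u_def intro: continuous_on_add)
  qed
  \<comment> \<open>On the frontier \<open>u\<close> is \<open>f\<close> times
    \<open>sqrt w\<^sub>k\<close>, so both branches equal \<open>f\<close> there. Hence
    \<open>h\<close> is continuous on each of the closed sets \<open>closure D\<close> and
    \<open>- D\<close>, which cover the space.\<close>
  define h where "h x = (if x \<in> closure D then u x / ?r x else f x)" for x
  have hf: "h x = f x" if "x \<notin> D" for x
  proof (cases "x \<in> closure D")
    case True
    then have "x \<in> frontier D" using that open_D by (simp add: frontier_def interior_open)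
    then have "u x = f x * ?r x" using u by (simp add: dirichlet_solution_def)
    then show ?thesis using True sqrt_weight_pos[OF True] by (simp add: h_def)
  qed (simp add: h_def)
  have hu: "h x * ?r x = u x" if "x \<in> closure D" for x
    using that sqrt_weight_pos[OF that] by (simp add: h_def)
  have ch: "continuous_on UNIV h"
  proof -
    have "continuous_on (closure D) (\<lambda>x. u x / ?r x)"
      using u less_imp_neq[OF sqrt_weight_pos]
      by (intro continuous_on_divide continuous_on_sqrt_weight) (auto simp: dirichlet_solution_def)
    then have "continuous_on (closure D) h"
      by (rule continuous_on_cong[THEN iffD1, OF refl, rotated]) (simp add: h_def)
    moreover have "continuous_on (- D) h"
      by (rule continuous_on_cong[THEN iffD1, OF refl _ f]) (simp add: hf)
    moreover have "closure D \<union> - D = UNIV" using closure_subset by auto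
    ultimately show ?thesis
      using continuous_on_closed_Un[of "closure D" "- D" h] open_D by auto
  qed
  have h: "dunkl_dirichlet_solution Rp k D f h"
  proof (subst dunkl_solution_iff[OF ch hf])
    show "weak_solution ?q D (source f) (\<lambda>x. h x * ?r x)"
      by (rule weak_solution_cong[OF open_D _ _ conjunct2[OF conjunct2[OF u[unfolded dirichlet_solution_def]]]])
        (use hu D_closure in auto)
  qed auto
  have unique: "h' = h" if h': "dunkl_dirichlet_solution Rp k D f h'" for h'
  proof
    fix x
    have c': "continuous_on UNIV h'" and f': "\<And>x. x \<notin> D \<Longrightarrow> h' x = f x"
      using h' by (auto simp: dunkl_dirichlet_solution_def)
    have "weak_solution ?q D (source f) (\<lambda>x. h' x * ?r x)"
      using h' dunkl_solution_iff[OF c' f'] by simp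
    moreover have "continuous_on (closure D) (\<lambda>x. h' x * ?r x)"
      using c' by (intro continuous_on_mult continuous_on_sqrt_weight) (auto intro: continuous_on_subset)
    ultimately have "dirichlet_solution ?q D (source f) ?g (\<lambda>x. h' x * ?r x)"
      using f' frontier_D(2) by (auto simp: dirichlet_solution_def)
    from dirichlet_solution_unique[OF open_D bounded_D q(2,3) F(2) this u]
    have "h' x * ?r x = h x * ?r x" if "x \<in> closure D" using that hu by simp
    then show "h' x = h x"
      using sqrt_weight_pos[of x] D_closure[of x] f'[of x] hf[of x] by (cases "x \<in> D") auto
  qed
  show ex: "\<exists>!h. dunkl_dirichlet_solution Rp k D f h" using h unique by blast
  assume x: "x \<in> D"
  have "H_dunkl Rp k D f = h"
    unfolding H_dunkl_def by (rule the_equality[of "dunkl_dirichlet_solution Rp k D f"]) (rule h, rule unique)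
  moreover have "h x = u x / ?r x" using D_closure[OF x] by (simp add: h_def)
  moreover have "H_schroedinger ?q D ?g x = u1 x"
    unfolding H_schroedinger_eq_the
    by (rule the_dirichlet_solution[OF open_D bounded_D q(2,3) continuous_on_const u1 D_closure[OF x]])
  moreover have "G_schroedinger ?q D (\<lambda>y. ?r y * dunkl_nonlocal Rp k f y) x = u2 x"
    unfolding G_schroedinger_eq_the source_def[symmetric, abs_def]
    by (rule the_dirichlet_solution[OF open_D bounded_D q(2,3) F(2) u2 D_closure[OF x]])
  ultimately show "H_dunkl Rp k D f x = 1 / ?r x *
         (H_schroedinger ?q D ?g x + G_schroedinger ?q D (\<lambda>y. ?r y * dunkl_nonlocal Rp k f y) x)"
    by (simp add: u_def)
qed

end

theorem theorem1:
  fixes R Rp D :: "'a::euclidean_space set" and k :: "'a \<Rightarrow> real"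
  assumes "root_system R"
    and "positive_subsystem R Rp"
    and "multiplicity_function R k"
    and "bounded D" and "open D"
    and "\<exists>\<Omega>. open \<Omega> \<and> connected \<Omega> \<and> \<Omega> \<subseteq> - (\<Union>\<alpha>\<in>Rp. orth_hyperplane \<alpha>) \<and> closure D \<subseteq> \<Omega>"
    and "laplace_regular D"
  shows "dunkl_regular Rp k D \<and>
    (\<forall>f :: 'a \<Rightarrow> real. continuous_on (- D) f \<longrightarrow> (\<forall>x\<in>D.
       H_dunkl Rp k D f x = 1 / sqrt (dunkl_weight Rp k x) *
         (H_schroedinger (dunkl_potential Rp k) D (\<lambda>y. f y * sqrt (dunkl_weight Rp k y)) x
          + G_schroedinger (dunkl_potential Rp k) D
              (\<lambda>y. sqrt (dunkl_weight Rp k y) * dunkl_nonlocal Rp k f y) x)))"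
proof -
  obtain \<Omega> where "open \<Omega>" "connected \<Omega>" "\<Omega> \<subseteq> - (\<Union>\<alpha>\<in>Rp. orth_hyperplane \<alpha>)" "closure D \<subseteq> \<Omega>"
    using assms(6) by blast
  then interpret dunkl_domain R Rp k D \<Omega>
    using assms by unfold_locales
  show ?thesis
    using dunkl_dirichlet[OF assms(7)] by (simp add: dunkl_regular_def)
qed

end
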